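(* Let $p(x)$ be a real polynomial with $\deg p=d$, parity $d\bmod 2$, and $|p(x)|\le1$ for all $x\in[-1,1]$; let $A$ and $O$ be Hermitian matrices with $\|A\|\le1$ and $\|O\|\le1$; and let $|\psi\rangle$ be a quantum state. Suppose we are given access to a block-encoding $U_A$ of $A$, a block-encoding $U_O$ of $O$, and a state preparation oracle $O_\psi$ of $|\psi\rangle$, and that QSP circuits are implemented with noisy $Z$-rotations with independent additive phase errors $e_j$ having even probability distribution functions. Then the noisy-QSP observable estimation algorithm (described in the context) outputs an $\epsilon$-approximation of $\langle\psi|p(A)^\dagger O\,p(A)|\psi\rangle$ with probability at least $1-\delta$. Furthermore, 1. the algorithm independently runs $$\mathcal{O}\left(\frac{1}{\epsilon^2\left(\prod_{j=1}^d\mathbb{E}\cos e_j\right)^4}\log\left(\frac1\delta\right)\right)$$ many quantum circuits; 2. each circuit uses $\mathcal{O}(d)$ queries to $U_A$, and $\mathcal{O}(1)$ queries to $U_O$ and $O_\psi$.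
   Context: Block-encoding: a unitary $U_B$ is a block-encoding of a matrix $B$ if $B=(\langle 0|^{\otimes a}\otimes I)\,U_B\,(|0\rangle^{\otimes a}\otimes I)$ for some number $a$ of ancilla qubits. $\|\cdot\|$ is the spectral norm; $O_\psi|0\rangle=|\psi\rangle$; $\epsilon,\delta\in(0,1)$. QSP: for $p$ as in the claim there exist (known fact) a complex polynomial $P$ with $\mathrm{Re}\,P(x)=p(x)$ and phase factors $\Phi=(\phi_1,\dots,\phi_d)\in\mathbb{R}^d$ such that for $x\in[-1,1]$ $$e^{i\phi_d Z}R(x)\cdots e^{i\phi_1 Z}R(x)=\begin{pmatrix}P(x)&\cdot\\ \cdot&\cdot\end{pmatrix},\qquad R(x)=\begin{pmatrix}x&\sqrt{1-x^2}\\ \sqrt{1-x^2}&-x\end{pmatrix}.$$ Then $p(A)=\frac12(P(A)+P(A)^\dagger)$. QSP circuit: on one rotation ancilla, the $a$ block-encoding ancillas and the system, for $j=1,\dots,d$ apply $U_A$ ($j$ odd) or $U_A^\dagger$ ($j$ even) and then $C(e^{-i\phi_jZ}\otimes I)C$, where the $Z$-rotation acts on the rotation ancilla and $C$ is a NOT on the rotation ancilla controlled on the block-encoding ancillas being $|0\rangle^{\otimes a}$. The noiseless circuit is a block-encoding of $P(A)$ (known fact). Noise model: in each implementation of the QSP circuit the phases $\phi_j$ are replaced by $\widetilde\phi_j=\phi_j+e_j$, where $e_1,\dots,e_d$ are independent with distributions symmetric about $0$; different implementations use independent copies. A noisy sample is a block-encoding of $\widetilde P(A)$, where $\widetilde P$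 is the random polynomial with phase factors $\widetilde\phi_1,\dots,\widetilde\phi_d$. All other operations are exact. Noisy-QSP observable estimation algorithm: (i) In each run, construct by noisy QSP block-encodings of four independent noisy samples $\widetilde P_1(A),\dots,\widetilde P_4(A)$ of $P(A)$, and from them and $U_O$, by linear combination of unitaries and products of block-encodings, a block-encoding $U_{\widetilde O}$ of $$\widetilde O=\tfrac14\bigl(\widetilde P_1(A)+\widetilde P_2(A)^\dagger\bigr)\,O\,\bigl(\widetilde P_3(A)+\widetilde P_4(A)^\dagger\bigr).$$ (ii) Estimate $o=\langle\psi|\mathbb{E}\widetilde O|\psi\rangle$ by averaging over independent runs of the Hadamard test: prepare $|0\rangle|0\rangle|\psi\rangle$ (control qubit, block-encoding ancillas, system), apply a Hadamard gate to the control, apply $U_{\widetilde O}$ (fresh sample) controlled on the control qubit, apply a Hadamard gate to the control, measure control and ancillas; record $+1$ for outcome $|0\rangle|0\rangle$, $-1$ for $|1\rangle|0\rangle$, $0$ otherwise. (iii) Output the estimate of $o$ divided by $\left(\prod_{j=1}^d\mathbb{E}\cos e_j\right)^2$. *)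

theory Defs
  imports "HOL-Probability.Probability" "Jordan_Normal_Form.Schur_Decomposition"
begin

section \<open>Matrices and block-encodings\<close>

definition kron :: "complex mat \<Rightarrow> complex mat \<Rightarrow> complex mat" where
  "kron A B = mat (dim_row A * dim_row B) (dim_col A * dim_col B)
     (\<lambda>(i, j). A $$ (i div dim_row B, j div dim_col B) * B $$ (i mod dim_row B, j mod dim_col B))"

definition hermitian_mat :: "complex mat \<Rightarrow> bool" where
  "hermitian_mat A \<longleftrightarrow> mat_adjoint A = A"

definition unitary_mat :: "nat \<Rightarrow> complex mat \<Rightarrow> bool" where
  "unitary_mat m U \<longleftrightarrow> U \<in> carrier_mat m m \<and> mat_adjoint U * U = 1\<^sub>m m \<and> U * mat_adjoint U = 1\<^sub>m m"

definition vec_norm :: "complex vec \<Rightarrow> real" where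
  "vec_norm v = sqrt (Re (v \<bullet>c v))"

definition spectral_norm :: "complex mat \<Rightarrow> real" where
  "spectral_norm A = (SUP v \<in> {v \<in> carrier_vec (dim_col A). vec_norm v = 1}. vec_norm (A *\<^sub>v v))"

definition mat_poly :: "real poly \<Rightarrow> complex mat \<Rightarrow> complex mat" where
  "mat_poly p A = mat (dim_row A) (dim_row A)
     (\<lambda>(i, j). \<Sum>k\<le>degree p. complex_of_real (coeff p k) * (A ^\<^sub>m k) $$ (i, j))"

(* <psi| M |psi>; the second argument of the product is the conjugated one *)
definition quad_form :: "complex mat \<Rightarrow> complex vec \<Rightarrow> complex" where
  "quad_form M \<psi> = (M *\<^sub>v \<psi>) \<bullet>c \<psi>"

definition ket0 :: "nat \<Rightarrow> complex mat" where
  "ket0 a = mat_of_cols (2 ^ a) [unit_vec (2 ^ a) 0]"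

definition block_encoding :: "nat \<Rightarrow> nat \<Rightarrow> complex mat \<Rightarrow> complex mat \<Rightarrow> bool" where
  "block_encoding a n U B \<longleftrightarrow> unitary_mat (2 ^ a * n) U \<and>
     B = mat_adjoint (kron (ket0 a) (1\<^sub>m n)) * U * kron (ket0 a) (1\<^sub>m n)"


section \<open>Quantum signal processing\<close>

definition zrot :: "real \<Rightarrow> complex mat" where
  "zrot \<phi> = mat_of_rows_list 2 [[cis \<phi>, 0], [0, cis (- \<phi>)]]"

definition reflect :: "real \<Rightarrow> complex mat" where
  "reflect x = map_mat complex_of_real
     (mat_of_rows_list 2 [[x, sqrt (1 - x\<^sup>2)], [sqrt (1 - x\<^sup>2), - x]])"

fun qsp_product :: "nat \<Rightarrow> (nat \<Rightarrow> real) \<Rightarrow> real \<Rightarrow> complex mat" where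
  "qsp_product 0 \<Phi> x = 1\<^sub>m 2"
| "qsp_product (Suc k) \<Phi> x = zrot (\<Phi> (Suc k)) * reflect x * qsp_product k \<Phi> x"

(* only the entries 1..d of \<Phi> are used *)
definition qsp_phases :: "real poly \<Rightarrow> nat \<Rightarrow> (nat \<Rightarrow> real) \<Rightarrow> bool" where
  "qsp_phases p d \<Phi> \<longleftrightarrow> (\<exists>P :: complex poly. \<forall>x \<in> {-1..1}.
     Re (poly P (complex_of_real x)) = poly p x \<and>
     qsp_product d \<Phi> x $$ (0, 0) = poly P (complex_of_real x))"


section \<open>Circuits with blackbox queries\<close>

text \<open>The two factors of the product \<open>(1/4) (P\<^sub>1 + P\<^sub>2\<^sup>\<dagger>) O (P\<^sub>3 + P\<^sub>4\<^sup>\<dagger>)\<close>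
  use disjoint ancillas, which are tagged by the side of the factor.\<close>

datatype side = Lft | Rgt

datatype reg =
    Ctl         \<comment> \<open>control qubit of the Hadamard test\<close>
  | Lcu side    \<comment> \<open>selection qubit of the linear combination of two unitaries\<close>
  | Rot side    \<comment> \<open>rotation ancilla\<close>
  | AncA side   \<comment> \<open>ancillas of the block-encoding of A\<close>
  | AncO        \<comment> \<open>ancillas of the block-encoding of O\<close>
  | Sys

fun reg_dim :: "nat \<Rightarrow> nat \<Rightarrow> nat \<Rightarrow> reg \<Rightarrow> nat" where
  "reg_dim n a b (AncA s) = 2 ^ a"
| "reg_dim n a b AncO = 2 ^ b"
| "reg_dim n a b Sys = n"
| "reg_dim n a b _ = 2"

datatype blackbox = OrA | OrO | OrPsi

datatype oper =
    Query blackbox bool   \<comment> \<open>the flag selects the inverse of the blackbox\<close>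
  | Fixed "complex mat"   \<comment> \<open>gate that makes no query\<close>

text \<open>A gate is applied to its target registers provided each control register holds the
  prescribed basis value.\<close>

datatype gate = Gate (ctrls: "(reg \<times> nat) list") (oper_of: oper) (targets: "reg list")

fun adj_oper :: "oper \<Rightarrow> oper" where
  "adj_oper (Query q dg) = Query q (\<not> dg)"
| "adj_oper (Fixed M) = Fixed (mat_adjoint M)"

fun adj_gate :: "gate \<Rightarrow> gate" where
  "adj_gate (Gate cs u ts) = Gate cs (adj_oper u) ts"

definition adj_circuit :: "gate list \<Rightarrow> gate list" where
  "adj_circuit c = rev (map adj_gate c)"

fun ctrl_gate :: "reg \<Rightarrow> nat \<Rightarrow> gate \<Rightarrow> gate" where
  "ctrl_gate r v (Gate cs u ts) = Gate ((r, v) # cs) u ts"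

definition ctrl_circuit :: "reg \<Rightarrow> nat \<Rightarrow> gate list \<Rightarrow> gate list" where
  "ctrl_circuit r v c = map (ctrl_gate r v) c"

definition queries :: "blackbox \<Rightarrow> gate list \<Rightarrow> nat" where
  "queries q c = length (filter (\<lambda>g. \<exists>dg. oper_of g = Query q dg) c)"

text \<open>States are amplitude functions on basis labels; a label assigns to each register its
  basis value.\<close>

type_synonym label = "reg \<Rightarrow> nat"
type_synonym state = "label \<Rightarrow> complex"

definition basis :: "(reg \<Rightarrow> nat) \<Rightarrow> label set" where
  "basis ds = (\<Pi>\<^sub>E r \<in> UNIV. {..<ds r})"

fun oper_mat :: "(blackbox \<Rightarrow> complex mat) \<Rightarrow> oper \<Rightarrow> complex mat" where
  "oper_mat I (Query q dg) = (if dg then mat_adjoint (I q) else I q)"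
| "oper_mat I (Fixed M) = M"

(* mixed-radix index of the targets, first register most significant, as in kron *)
definition reg_index :: "(reg \<Rightarrow> nat) \<Rightarrow> reg list \<Rightarrow> label \<Rightarrow> nat" where
  "reg_index ds ts x = foldl (\<lambda>k r. k * ds r + x r) 0 ts"

definition apply_gate ::
  "(blackbox \<Rightarrow> complex mat) \<Rightarrow> (reg \<Rightarrow> nat) \<Rightarrow> gate \<Rightarrow> state \<Rightarrow> state" where
  "apply_gate I ds g st = (\<lambda>x.
     if \<forall>(r, v) \<in> set (ctrls g). x r = v
     then \<Sum>y \<in> {y \<in> basis ds. \<forall>r. r \<notin> set (targets g) \<longrightarrow> y r = x r}.
            oper_mat I (oper_of g) $$ (reg_index ds (targets g) x, reg_index ds (targets g) y) * st y
     else st x)"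

(* the head of the list acts first *)
definition run_circuit ::
  "(blackbox \<Rightarrow> complex mat) \<Rightarrow> (reg \<Rightarrow> nat) \<Rightarrow> gate list \<Rightarrow> state \<Rightarrow> state" where
  "run_circuit I ds c st = fold (apply_gate I ds) c st"

definition init_state :: state where
  "init_state = (\<lambda>x. if x = (\<lambda>_. 0) then 1 else 0)"

(* Born rule for measuring the registers W in the computational basis *)
definition measure_regs :: "(reg \<Rightarrow> nat) \<Rightarrow> reg set \<Rightarrow> state \<Rightarrow> label measure" where
  "measure_regs ds W st = point_measure (\<Pi>\<^sub>E r \<in> W. {..<ds r})
     (\<lambda>m. ennreal (\<Sum>x \<in> {x \<in> basis ds. restrict x W = m}. (cmod (st x))\<^sup>2))"


section \<open>The noisy-QSP observable estimation algorithm\<close>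

definition not_mat :: "complex mat" where
  "not_mat = mat_of_rows_list 2 [[0, 1], [1, 0]]"

definition hadamard_mat :: "complex mat" where
  "hadamard_mat = mat_of_rows_list 2
     [[1 / sqrt 2, 1 / sqrt 2], [1 / sqrt 2, - (1 / sqrt 2)]]"

definition qsp_circuit :: "side \<Rightarrow> nat \<Rightarrow> (nat \<Rightarrow> real) \<Rightarrow> gate list" where
  "qsp_circuit s d \<Phi> = concat (map (\<lambda>j.
     [Gate [] (Query OrA (even j)) [AncA s, Sys],
      Gate [(AncA s, 0)] (Fixed not_mat) [Rot s],
      Gate [] (Fixed (zrot (- \<Phi> j))) [Rot s],
      Gate [(AncA s, 0)] (Fixed not_mat) [Rot s]]) [1..<Suc d])"

(* block-encodes half the sum of the two block-encoded matrices *)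
definition lcu_circuit :: "side \<Rightarrow> gate list \<Rightarrow> gate list \<Rightarrow> gate list" where
  "lcu_circuit s c1 c2 =
     [Gate [] (Fixed hadamard_mat) [Lcu s]] @
     ctrl_circuit (Lcu s) 0 c1 @ ctrl_circuit (Lcu s) 1 c2 @
     [Gate [] (Fixed hadamard_mat) [Lcu s]]"

(* e (k, j) is the error of the j-th phase in the k-th noisy sample *)
definition noisy_qsp_circuit ::
  "side \<Rightarrow> nat \<Rightarrow> (nat \<Rightarrow> real) \<Rightarrow> (nat \<times> nat \<Rightarrow> real) \<Rightarrow> nat \<Rightarrow> gate list" where
  "noisy_qsp_circuit s d \<Phi> e k = qsp_circuit s d (\<lambda>j. \<Phi> j + e (k, j))"

definition observable_circuit ::
  "nat \<Rightarrow> (nat \<Rightarrow> real) \<Rightarrow> (nat \<times> nat \<Rightarrow> real) \<Rightarrow> gate list" where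
  "observable_circuit d \<Phi> e =
     lcu_circuit Rgt (noisy_qsp_circuit Rgt d \<Phi> e 3) (adj_circuit (noisy_qsp_circuit Rgt d \<Phi> e 4)) @
     [Gate [] (Query OrO False) [AncO, Sys]] @
     lcu_circuit Lft (noisy_qsp_circuit Lft d \<Phi> e 1) (adj_circuit (noisy_qsp_circuit Lft d \<Phi> e 2))"

definition hadamard_test_circuit ::
  "nat \<Rightarrow> (nat \<Rightarrow> real) \<Rightarrow> (nat \<times> nat \<Rightarrow> real) \<Rightarrow> gate list" where
  "hadamard_test_circuit d \<Phi> e =
     [Gate [] (Query OrPsi False) [Sys], Gate [] (Fixed hadamard_mat) [Ctl]] @
     ctrl_circuit Ctl 1 (observable_circuit d \<Phi> e) @
     [Gate [] (Fixed hadamard_mat) [Ctl]]"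

definition test_record :: "label \<Rightarrow> int" where
  "test_record m = (if \<forall>r. r \<noteq> Ctl \<and> r \<noteq> Sys \<longrightarrow> m r = 0
     then (if m Ctl = 0 then 1 else - 1) else 0)"

text \<open>\<open>\<mu> j\<close> is the law of the phase error \<open>e\<^sub>j\<close>.\<close>

definition noise_law :: "nat \<Rightarrow> (nat \<Rightarrow> real measure) \<Rightarrow> (nat \<times> nat \<Rightarrow> real) measure" where
  "noise_law d \<mu> = (\<Pi>\<^sub>M (k, j) \<in> {1..4} \<times> {1..d}. \<mu> j)"

definition run_law ::
  "(blackbox \<Rightarrow> complex mat) \<Rightarrow> (reg \<Rightarrow> nat) \<Rightarrow> nat \<Rightarrow> (nat \<Rightarrow> real) \<Rightarrow> (nat \<Rightarrow> real measure) \<Rightarrow> int measure"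
where
  "run_law I ds d \<Phi> \<mu> = noise_law d \<mu> \<bind> (\<lambda>e.
     distr (measure_regs ds (- {Sys}) (run_circuit I ds (hadamard_test_circuit d \<Phi> e) init_state))
       (count_space UNIV) test_record)"

definition mean_cos :: "nat \<Rightarrow> (nat \<Rightarrow> real measure) \<Rightarrow> real" where
  "mean_cos d \<mu> = (\<Prod>j = 1..d. \<integral>x. cos x \<partial>\<mu> j)"

(* law of the output after N independent runs *)
definition estimator_law ::
  "nat \<Rightarrow> (blackbox \<Rightarrow> complex mat) \<Rightarrow> (reg \<Rightarrow> nat) \<Rightarrow> nat \<Rightarrow> (nat \<Rightarrow> real) \<Rightarrow> (nat \<Rightarrow> real measure)
    \<Rightarrow> real measure" where
  "estimator_law N I ds d \<Phi> \<mu> = distr (\<Pi>\<^sub>M i \<in> {..<N}. run_law I ds d \<Phi> \<mu>) borel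
     (\<lambda>\<omega>. ((\<Sum>i<N. real_of_int (\<omega> i)) / real N) / (mean_cos d \<mu>)\<^sup>2)"

fun oracles :: "complex mat \<Rightarrow> complex mat \<Rightarrow> complex mat \<Rightarrow> blackbox \<Rightarrow> complex mat" where
  "oracles UA UO Upsi OrA = UA"
| "oracles UA UO Upsi OrO = UO"
| "oracles UA UO Upsi OrPsi = Upsi"

definition symmetric_law :: "real measure \<Rightarrow> bool" where
  "symmetric_law M \<longleftrightarrow> prob_space M \<and> sets M = sets borel \<and> distr M borel uminus = M"

(* Accuracy \<epsilon>, failure probability \<delta> and \<kappa> = \<Prod>\<^sub>j E cos e\<^sub>j. Since log (1 / \<delta>) vanishes as
   \<delta> tends to 1 while the number of runs cannot, asymptotic bounds are taken with \<delta>
   bounded away from 1. *)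
definition param_range :: "real \<Rightarrow> (real \<times> real \<times> real) set" where
  "param_range \<delta>0 = {(\<epsilon>, \<delta>, \<kappa>). 0 < \<epsilon> \<and> \<epsilon> < 1 \<and> 0 < \<delta> \<and> \<delta> \<le> \<delta>0 \<and> \<kappa> \<noteq> 0 \<and> \<bar>\<kappa>\<bar> \<le> 1}"

end

theory Submission
  imports Defs "HOL-Computational_Algebra.Fundamental_Theorem_Algebra"
begin

text \<open>Phase factors exist because \<open>1 - p\<^sup>2\<close> is a nonnegative polynomial in \<open>x\<^sup>2\<close> on the unit interval, hence of
  the form \<open>B\<^sup>2 + (1 - x\<^sup>2) C\<^sup>2\<close> (Lukacs), so that \<open>P = p + i B\<close> and \<open>Q = C\<close> form a unit vector from which
  the rotations are stripped one by one.

  The QSP circuit keeps the state in the form \<open>V P(A) v + W Q(A) v\<close>, where \<open>V\<close> inserts zero ancillas and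
  \<open>W = U V - V A\<close> or \<open>W = U\<^sup>\<dagger> V - V A\<close> maps into their complement; the pair \<open>(P, Q)\<close> obeys the recursion
  of the first column of the QSP product. Hence a run records \<open>Re \<langle>\<psi>| O' |\<psi>\<rangle>\<close> on average, where \<open>O'\<close> is
  the noisy observable.

  The entries of a noisy sample are affine in \<open>(cos e\<^sub>j, sin e\<^sub>j)\<close> for every \<open>j\<close>. By symmetry of the errors
  the expectation of a product of entries of two independent samples is the noiseless value times
  \<open>(\<Prod>\<^sub>j E cos e\<^sub>j)\<^sup>2\<close>, which the final division removes. Hoeffding's inequality bounds the
  number of runs.\<close>

section \<open>Existence of phase factors\<close>

text \<open>The QSP product ends on the right with a reflection, whereas stripping leaves one more
  rotation there. Only the upper left entry is prescribed, and for it this rotation may as well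
  stand on the left, where the last phase absorbs it; for that a phase has to exist, hence the
  restriction to \<open>d > 0\<close>. The phases handed to the algorithm are arbitrary solutions of
  \<open>qsp_phases\<close>, not the constructed ones. All that is known of them is the real part of
  the upper left entry on [-1, 1], and this already fixes the sum of P and its conjugate as a
  polynomial. The two factors of the observable have no noisy sample in common. In a product of two
  entries of one sample the squares of cos e and sin e would appear, whose means are not determined
  by E cos e; across samples every error occurs linearly. Amplitudes with a nonzero ancilla are
  never computed: such outcomes are recorded as 0, and their total probability is known by
  normalization, which also suffices for the measurability of the law of a run.\<close>

text \<open>The bound \<open>m\<close> serves as degree bound and as parity at once. For the second component \<open>Q\<close> of a
  pair, the condition is imposed on \<open>pCons 0 Q\<close>: this expresses degree at most \<open>m - 1\<close> and forces
  \<open>Q = 0\<close> when \<open>m = 0\<close>, without truncated subtraction.\<close>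

definition parity :: "nat \<Rightarrow> 'a::zero poly \<Rightarrow> bool" where
  "parity m P \<longleftrightarrow> (\<forall>i. coeff P i \<noteq> 0 \<longrightarrow> i \<le> m \<and> even (m + i))"

lemma parity_0 [simp]: "parity m 0"
  by (simp add: parity_def)

lemma parity_add: "parity m P \<Longrightarrow> parity m Q \<Longrightarrow> parity m (P + Q)"
  for P Q :: "'a::comm_monoid_add poly"
  unfolding parity_def by (metis add.right_neutral coeff_add)

lemma parity_diff: "parity m P \<Longrightarrow> parity m Q \<Longrightarrow> parity m (P - Q)"
  for P Q :: "'a::ab_group_add poly"
  unfolding parity_def by (metis diff_zero diff_self coeff_diff)

lemma parity_smult: "parity m P \<Longrightarrow> parity m (Polynomial.smult c P)"
  for P :: "'a::comm_semiring_0 poly"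
  unfolding parity_def by (metis coeff_smult mult_zero_right)

lemma parity_mult:
  fixes P Q :: "'a::comm_semiring_0 poly"
  assumes "parity m P" "parity k Q"
  shows "parity (m + k) (P * Q)"
  unfolding parity_def
proof (intro allI impI)
  fix i assume "coeff (P * Q) i \<noteq> 0"
  then obtain j where j: "j \<le> i" "coeff P j * coeff Q (i - j) \<noteq> 0"
    by (auto simp: coeff_mult elim: sum.not_neutral_contains_not_neutral)
  then have "coeff P j \<noteq> 0" "coeff Q (i - j) \<noteq> 0" by auto
  then have "j \<le> m" "even (m + j)" "i - j \<le> k" "even (k + (i - j))"
    using assms by (auto simp: parity_def)
  with j(1) show "i \<le> m + k \<and> even (m + k + i)" by presburger
qed

lemma parity_2_pCons: "parity (Suc (Suc m)) (pCons 0 (pCons 0 P)) \<longleftrightarrow> parity m P"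
  unfolding parity_def coeff_pCons by (auto split: nat.split)

lemma parity_pCons_Suc: "parity (Suc m) (pCons 0 P) \<longleftrightarrow> parity m P"
  unfolding parity_def coeff_pCons by (auto split: nat.split)

lemma parity_Suc_Suc: "parity m P \<Longrightarrow> parity (Suc (Suc m)) P"
  unfolding parity_def by fastforce

text \<open>In the product of two weighted forms only x^2 C E is controlled directly, as the product
  of x C and x E; this lemma passes to C E itself. For \<open>m < 2\<close> the degree bound forces
  \<open>P = 0\<close>.\<close>

lemma parity_weaken: "parity m (pCons 0 (pCons 0 P)) \<Longrightarrow> parity m P"
proof (cases "m < 2")
  case True
  assume p: "parity m (pCons 0 (pCons 0 P))"
  have "coeff P i = 0" for i
    using p[unfolded parity_def, rule_format, of "i + 2"] True by (auto simp: coeff_pCons)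
  then have "P = 0" by (simp add: poly_eq_iff)
  then show ?thesis by simp
next
  case False
  then obtain k where "m = Suc (Suc k)" by (metis add_2_eq_Suc le_add_diff_inverse not_less)
  then show "parity m (pCons 0 (pCons 0 P)) \<Longrightarrow> parity m P"
    using parity_2_pCons parity_Suc_Suc by metis
qed

section \<open>Lukacs representation of polynomials that are nonnegative on the unit
  interval\<close>

abbreviation wpoly :: "'a::comm_ring_1 poly" where "wpoly \<equiv> [:1, 0, -1:]"

text \<open>These are the norms \<open>\<bar>B + i sqrt (1 - x\<^sup>2) C\<bar>\<^sup>2\<close>; being norms, they are closed under products.\<close>

definition wsos :: "nat \<Rightarrow> real poly \<Rightarrow> bool" where
  "wsos m G \<longleftrightarrow> (\<exists>B C. parity m B \<and> parity m (pCons 0 C) \<and> G = B * B + wpoly * (C * C))"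

text \<open>Brahmagupta's identity: the product of B + sqrt(-w) C and D + sqrt(-w) E has the
  components on the right.\<close>

lemma norm_form_mult:
  fixes B C D E w :: "'a::comm_ring_1"
  shows "(B * B + w * (C * C)) * (D * D + w * (E * E)) =
    (B * D - w * (C * E)) * (B * D - w * (C * E)) + w * ((B * E + C * D) * (B * E + C * D))"
  by (simp add: algebra_simps)

lemma wsos_mult:
  assumes "wsos m G" "wsos k H"
  shows "wsos (m + k) (G * H)"
proof -
  obtain B C where 1: "parity m B" "parity m (pCons 0 C)" "G = B * B + wpoly * (C * C)"
    using assms(1) by (auto simp: wsos_def)
  obtain D E where 2: "parity k D" "parity k (pCons 0 E)" "H = D * D + wpoly * (E * E)"
    using assms(2) by (auto simp: wsos_def)
  let ?X = "B * D - wpoly * (C * E)" and ?Y = "B * E + C * D"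
  have xx: "parity (m + k) (pCons 0 (pCons 0 (C * E)))"
    using parity_mult[OF 1(2) 2(2)] by simp
  have w: "wpoly * (C * E) = C * E - pCons 0 (pCons 0 (C * E))" by simp
  have X: "parity (m + k) ?X"
    unfolding w by (intro parity_diff parity_mult 1 2 xx parity_weaken[OF xx])
  have Y: "parity (m + k) (pCons 0 ?Y)"
    using parity_add[OF parity_mult[OF 1(1) 2(2)] parity_mult[OF 1(2) 2(1)]] by simp
  have "G * H = ?X * ?X + wpoly * (?Y * ?Y)"
    unfolding 1(3) 2(3) by (rule norm_form_mult)
  with X Y show ?thesis unfolding wsos_def by blast
qed

lemma wsos_const: "c \<ge> 0 \<Longrightarrow> wsos 0 [:c:]"
  unfolding wsos_def
  by (rule exI[of _ "[:sqrt c:]"], rule exI[of _ 0]) (auto simp: parity_def coeff_pCons split: nat.splits)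

text \<open>x^2 - r = (1 - r) x^2 + (-r) (1 - x^2), and both weights have real square roots.\<close>

lemma wsos_linear_left: "r \<le> 0 \<Longrightarrow> wsos 1 [:-r, 0, 1:]"
  unfolding wsos_def
  by (rule exI[of _ "[:0, sqrt (1-r):]"], rule exI[of _ "[:sqrt (-r):]"])
     (auto simp: parity_def coeff_pCons split: nat.splits)

text \<open>r - x^2 = (r - 1) x^2 + r (1 - x^2), and both weights have real square roots.\<close>

lemma wsos_linear_right: "r \<ge> 1 \<Longrightarrow> wsos 1 [:r, 0, -1:]"
  unfolding wsos_def
  by (rule exI[of _ "[:0, sqrt (r-1):]"], rule exI[of _ "[:sqrt r:]"])
     (auto simp: parity_def coeff_pCons split: nat.splits)

lemma wsos_square: "wsos 2 ([:-r, 0, 1:] * [:-r, 0, 1:])"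
  unfolding wsos_def
  by (rule exI[of _ "[:-r, 0, 1:]"], rule exI[of _ 0])
     (auto simp: parity_def coeff_pCons split: nat.splits)

text \<open>The ansatz B = \<alpha> x^2 - |z|, C = sqrt(\<alpha>^2 - 1) x matches the outer
  coefficients for every \<alpha>; the middle one demands \<alpha>^2 - 2 |z| \<alpha> - 1 = - 2 Re
  z. The solution \<alpha> = |z| + |1 - z| is at least 1 by the triangle inequality, so the square
  root is real.\<close>

lemma wsos_quadratic: "wsos 2 [:(cmod z)\<^sup>2, 0, - 2 * Re z, 0, 1:]"
proof -
  define m where "m = cmod z"
  define k where "k = cmod (1 - z)"
  define \<alpha> where "\<alpha> = m + k"
  have "1 \<le> \<alpha>" using norm_triangle_ineq[of z "1 - z"] by (simp add: \<alpha>_def m_def k_def)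
  then have g: "\<alpha>\<^sup>2 - 1 \<ge> 0" by simp
  have k2: "k\<^sup>2 = m\<^sup>2 - 2 * Re z + 1"
    by (simp add: k_def m_def cmod_power2 power2_diff)
  let ?B = "[:-m, 0, \<alpha>:]" and ?C = "[:0, sqrt (\<alpha>\<^sup>2 - 1):]"
  have s: "sqrt (\<alpha>\<^sup>2 - 1) * sqrt (\<alpha>\<^sup>2 - 1) = \<alpha>\<^sup>2 - 1" using g by simp
  have "?B * ?B + wpoly * (?C * ?C) = [:m\<^sup>2, 0, - 2 * Re z, 0, 1:]"
    using k2 unfolding mult_pCons_left mult_pCons_right
    by (simp add: s del: real_sqrt_mult_self) (simp add: power2_eq_square \<alpha>_def algebra_simps)
  moreover have "parity 2 ?B" "parity 2 (pCons 0 ?C)"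
    by (auto simp: parity_def coeff_pCons split: nat.splits)
  ultimately show ?thesis unfolding wsos_def m_def by metis
qed

text \<open>Where \<open>w\<close> is positive, the sign of \<open>H\<close> follows by division. If
  \<open>H\<close> were negative at a remaining point, it would by continuity be negative on a whole
  interval, which contains points where \<open>w\<close> is positive.\<close>

lemma poly_nonneg_factor:
  fixes w H :: "real poly"
  assumes "\<And>y. y \<in> {0..1} \<Longrightarrow> poly w y * poly H y \<ge> 0"
    and "finite {y \<in> {0..1}. poly w y \<le> 0}" "y \<in> {0..1}"
  shows "poly H y \<ge> 0"
proof (rule ccontr)
  assume "\<not> poly H y \<ge> 0"
  then have "poly H y < 0" by simp
  then have "\<forall>\<^sub>F t in at y. poly H t < 0"
    using order_tendstoD(2)[OF poly_isCont[of y H, unfolded isCont_def]] by blast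
  then obtain e where e: "e > 0" "\<And>t. t \<noteq> y \<Longrightarrow> dist t y < e \<Longrightarrow> poly H t < 0"
    by (auto simp: eventually_at)
  let ?I = "{max 0 (y - e)<..<min 1 (y + e)} - {y}"
  have "max 0 (y - e) < min 1 (y + e)" using e(1) assms(3) by auto
  then have "infinite ?I" by (simp add: infinite_Ioo)
  then obtain t where t: "t \<in> ?I" "\<not> poly w t \<le> 0"
  proof -
    have "\<not> ?I \<subseteq> {y \<in> {0..1}. poly w y \<le> 0}"
      using \<open>infinite ?I\<close> assms(2) finite_subset by blast
    then show ?thesis using that by fastforce
  qed
  then have "poly H t < 0" using e(2)[of t] by (auto simp: dist_real_def)
  moreover have "poly w t * poly H t \<ge> 0" using assms(1) t(1) by auto
  ultimately show False using t(2) by (simp add: zero_le_mult_iff)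
qed

lemma poly_map_poly_of_real:
  "poly (map_poly complex_of_real G) (complex_of_real x) = complex_of_real (poly G x)"
  by (induction G) (simp_all add: map_poly_pCons)

text \<open>The remainder modulo the quadratic is a + b y with real a and b; as it vanishes at the
  nonreal \<open>z\<close>, it is zero.\<close>

lemma real_quadratic_dvd:
  fixes G :: "real poly"
  assumes "poly (map_poly complex_of_real G) z = 0" "Im z \<noteq> 0"
  shows "[:(cmod z)\<^sup>2, - 2 * Re z, 1:] dvd G"
proof -
  let ?q = "[:(cmod z)\<^sup>2, - 2 * Re z, 1:]"
  let ?c = "map_poly complex_of_real"
  have mult: "?c (a * b) = ?c a * ?c b" for a b
    by (rule poly_eqI) (simp add: coeff_map_poly coeff_mult)
  have add: "?c (a + b) = ?c a + ?c b" for a b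
    by (rule poly_eqI) (simp add: coeff_map_poly)
  have qz: "poly (?c ?q) z = 0"
    by (simp add: map_poly_pCons complex_eq_iff cmod_power2) (simp add: power2_eq_square algebra_simps)
  have "degree (G mod ?q) < 2"
    using degree_mod_less[of ?q G] by auto
  then obtain a b where ab: "G mod ?q = [:a, b:]"
    by (metis One_nat_def Suc_1 degree_pCons_eq degree_0_id less_2_cases
        less_Suc_eq_0_disj not_less_eq pCons_cases pCons_0_0 Suc_less_eq degree_eq_zeroE)
  have ev: "poly (?c [:a, b:]) z = of_real a + z * of_real b"
    by (cases "b = 0"; cases "a = 0") (simp_all add: map_poly_pCons)
  have "poly (?c (G mod ?q)) z = 0"
    using assms(1) qz div_mult_mod_eq[of G ?q] by (metis add mult poly_add poly_mult mult_zero_right add_0)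
  then have "of_real a + z * of_real b = 0"
    unfolding ab ev .
  then have "b = 0" "a = 0"
    using assms(2) by (auto simp: complex_eq_iff)
  then show ?thesis using ab by (simp add: mod_eq_0_iff_dvd)
qed

text \<open>Induction on the degree: a complex root of \<open>G\<close> yields a real factor
  \<open>q\<close> that is positive on [0, 1] up to finitely many points, so the cofactor is again
  nonnegative there. The representations of factor and cofactor multiply.\<close>

lemma wsos_nonneg:
  fixes G :: "real poly"
  assumes "\<And>y. y \<in> {0..1} \<Longrightarrow> poly G y \<ge> 0"
  shows "wsos (degree G) (G \<circ>\<^sub>p [:0, 0, 1:])"
  using assms
proof (induction "degree G" arbitrary: G rule: less_induct)
  case less
  show ?case
  proof (cases "degree G = 0")
    case True
    then obtain c where "G = [:c:]" by (auto elim: degree_eq_zeroE)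
    then show ?thesis using less.prems[of 0] wsos_const[of c] by simp
  next
    case False
    have step: "wsos (degree G) (G \<circ>\<^sub>p [:0, 0, 1:])"
      if "G = q * H" "degree q > 0" "wsos (degree q) (q \<circ>\<^sub>p [:0, 0, 1:])"
        "finite {y \<in> {0..1}. poly q y \<le> 0}" for q H
    proof -
      have nz: "q \<noteq> 0" "H \<noteq> 0" using that(1,2) False by auto
      then have deg: "degree G = degree q + degree H"
        by (simp add: that(1) degree_mult_eq)
      have "poly H y \<ge> 0" if "y \<in> {0..1}" for y
        using less.prems \<open>G = q * H\<close> \<open>finite _\<close> that by (intro poly_nonneg_factor[of q H]) auto
      then have "wsos (degree H) (H \<circ>\<^sub>p [:0, 0, 1:])"
        using deg that(2) by (intro less.hyps) auto
      from wsos_mult[OF that(3) this] show ?thesis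
        unfolding deg by (simp add: that(1) pcompose_mult)
    qed
    have nc: "\<not> constant (poly (map_poly complex_of_real G))"
    proof -
      have "degree (map_poly complex_of_real G) = degree G"
        by (intro degree_map_poly) simp
      then show ?thesis using False by (simp add: constant_degree)
    qed
    then obtain z where z: "poly (map_poly complex_of_real G) z = 0"
      using fundamental_theorem_of_algebra by blast
    show ?thesis
    proof (cases "Im z = 0")
      case False
      let ?q = "[:(cmod z)\<^sup>2, - 2 * Re z, 1:]"
      obtain H where H: "G = ?q * H" using real_quadratic_dvd[OF z False] by (auto elim: dvdE)
      have "poly ?q y = (y - Re z)\<^sup>2 + (Im z)\<^sup>2" for y
        by (simp add: cmod_power2) (simp add: power2_eq_square algebra_simps)
      then have "poly ?q y > 0" for y
        using False by (metis add_nonneg_pos zero_le_power2 zero_less_power2)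
      then have "{y \<in> {0..1}. poly ?q y \<le> 0} = {}" by (auto simp: not_le)
      then have "finite {y \<in> {0..1}. poly ?q y \<le> 0}" by (metis finite.emptyI)
      moreover have "?q \<circ>\<^sub>p [:0, 0, 1:] = [:(cmod z)\<^sup>2, 0, - 2 * Re z, 0, 1:]"
        by (simp add: pcompose_pCons)
      ultimately show ?thesis
        using wsos_quadratic[of z] by (intro step[OF H]) (auto simp: numeral_2_eq_2)
    next
      case True
      define r where "r = Re z"
      have "z = of_real r" using True by (simp add: r_def complex_eq_iff)
      then have r: "poly G r = 0"
        using z poly_map_poly_of_real[of G r] by simp
      then obtain H where H: "G = [:-r, 1:] * H" using poly_eq_0_iff_dvd by (metis dvdE)
      consider "r \<le> 0" | "r \<ge> 1" | "0 < r" "r < 1" by linarith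
      then show ?thesis
      proof cases
        case 1
        have "finite {y \<in> {0..1}. poly [:-r, 1:] y \<le> 0}"
          using 1 by (intro finite_subset[OF _ finite.insertI[OF finite.emptyI, of 0]]) auto
        then show ?thesis
          using wsos_linear_left[OF 1] by (intro step[OF H]) (auto simp: pcompose_pCons)
      next
        case 2
        \<comment> \<open>Here y - r is nonpositive on the unit interval, so the sign is moved to
          the cofactor.\<close>
        have "G = [:r, -1:] * (- H)" using H by (simp add: algebra_simps)
        moreover have "finite {y \<in> {0..1}. poly [:r, -1:] y \<le> 0}"
          using 2 by (intro finite_subset[OF _ finite.insertI[OF finite.emptyI, of 1]]) auto
        ultimately show ?thesis
          using wsos_linear_right[OF 2] by (intro step[of "[:r, -1:]" "- H"]) (auto simp: pcompose_pCons)
      next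
        case 3
        have fin: "finite {y. poly ([:-r, 1:] * [:-r, 1:]) y \<le> 0}"
        proof (rule finite_subset)
          show "{y. poly ([:-r, 1:] * [:-r, 1:]) y \<le> 0} \<subseteq> {r}"
            by (auto simp: mult_le_0_iff simp del: mult_pCons_left mult_pCons_right)
        qed simp
        \<comment> \<open>A single factor y - r would change sign inside the interval. But a zero of
          \<open>G\<close> in the interior is a local minimum, hence a double root, and (y - r)^2
          can be split off.\<close>
        have "poly (pderiv G) r = 0"
        proof (rule DERIV_local_min[OF poly_DERIV])
          show "0 < min r (1 - r)" using 3 by simp
          show "\<forall>y. \<bar>r - y\<bar> < min r (1 - r) \<longrightarrow> poly G r \<le> poly G y"
            using less.prems r by (auto simp: abs_less_iff)
        qed
        then have "poly H r = 0"
          unfolding H pderiv_mult by (simp add: pderiv_pCons del: mult_pCons_left)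
        then obtain K where K: "H = [:-r, 1:] * K" using poly_eq_0_iff_dvd by (metis dvdE)
        have "finite {y \<in> {0..1}. poly ([:-r, 1:] * [:-r, 1:]) y \<le> 0}"
          by (rule finite_subset[OF _ fin]) auto
        moreover have "degree ([:-r, 1:] * [:-r, 1:]) = 2" by (subst degree_mult_eq) auto
        moreover have "([:-r, 1:] * [:-r, 1:]) \<circ>\<^sub>p [:0, 0, 1:] = [:-r, 0, 1:] * [:-r, 0, 1:]"
          by (simp only: pcompose_mult) (simp add: pcompose_pCons)
        moreover have "G = ([:-r, 1:] * [:-r, 1:]) * K" using H K by (simp only: mult.assoc)
        ultimately show ?thesis
          using wsos_square[of r] by (intro step[of "[:-r, 1:] * [:-r, 1:]" K]) (auto simp del: mult_pCons_left mult_pCons_right)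
      qed
    qed
  qed
qed

lemma parity_coeff:
  fixes p :: "real poly"
  assumes "degree p = d" "\<And>x. poly p (- x) = (- 1) ^ d * poly p x"
  shows "parity d p"
  unfolding parity_def
proof (intro allI impI)
  fix i assume i: "coeff p i \<noteq> 0"
  have "poly (p \<circ>\<^sub>p [:0, -1:]) x = poly (Polynomial.smult ((-1) ^ d) p) x" for x
    using assms(2)[of x] by (simp add: poly_pcompose)
  then have eq: "p \<circ>\<^sub>p [:0, -1:] = Polynomial.smult ((-1) ^ d) p" by (intro poly_ext) auto
  have "(-1) ^ i * coeff p i = (-1) ^ d * coeff p i"
    using arg_cong[OF eq, of "\<lambda>q. coeff q i"] by (simp add: coeff_pcompose_linear)
  then have "(-1::real) ^ i = (-1) ^ d" using i by simp
  then have "even i = even d" by (cases "even i"; cases "even d") auto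
  then show "i \<le> d \<and> even (d + i)" using i assms(1) le_degree by auto
qed

section \<open>Stripping rotations off a polynomial unit vector\<close>

definition cnj_poly :: "complex poly \<Rightarrow> complex poly" where
  "cnj_poly P = map_poly cnj P"

lemma coeff_cnj_poly [simp]: "coeff (cnj_poly P) i = cnj (coeff P i)"
  by (simp add: cnj_poly_def coeff_map_poly)

lemma cnj_poly_add [simp]: "cnj_poly (P + Q) = cnj_poly P + cnj_poly Q"
  and cnj_poly_diff [simp]: "cnj_poly (P - Q) = cnj_poly P - cnj_poly Q"
  and cnj_poly_smult [simp]: "cnj_poly (Polynomial.smult c P) = Polynomial.smult (cnj c) (cnj_poly P)"
  and cnj_poly_pCons [simp]: "cnj_poly (pCons c P) = pCons (cnj c) (cnj_poly P)"
  and cnj_poly_0 [simp]: "cnj_poly 0 = 0"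
  by (rule poly_eqI, simp add: coeff_pCons split: nat.splits)+

lemma coeff_mult_top:
  fixes P Q :: "'a::comm_semiring_0 poly"
  assumes "parity m P" "parity k Q"
  shows "coeff (P * Q) (m + k) = coeff P m * coeff Q k"
proof -
  have "coeff P i * coeff Q (m + k - i) = (if i = m then coeff P m * coeff Q k else 0)"
    if "i \<le> m + k" for i
  proof (cases i m rule: linorder_cases)
    case less
    then have "coeff Q (m + k - i) = 0" using assms(2) by (auto simp: parity_def)
    then show ?thesis using less by simp
  next
    case greater
    then have "coeff P i = 0" using assms(1) by (auto simp: parity_def)
    then show ?thesis using greater by simp
  qed simp
  then show ?thesis by (simp add: coeff_mult)
qed

lemma parity_cnj_poly: "parity m P \<Longrightarrow> parity m (cnj_poly P)"
  by (simp add: parity_def)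

text \<open>With \<open>P'\<close> and \<open>Q'\<close> as the conjugates, this is the invariance
  of the norm of the row (P, sqrt(1 - x^2) Q) under right multiplication by the reflection matrix.
  It is stated in a ring so that it applies to polynomials.\<close>

lemma strip_identity:
  fixes P Q P' Q' :: "'a::comm_ring_1"
  assumes "P * P' + (1 - x * x) * (Q * Q') = 1"
  shows "(x * P + (1 - x * x) * Q) * (x * P' + (1 - x * x) * Q') +
    (1 - x * x) * ((P - x * Q) * (P' - x * Q')) = 1" (is "?L = 1")
proof -
  have "?L = P * P' + (1 - x * x) * (Q * Q')"
    by (simp add: algebra_simps)
  then show ?thesis using assms by simp
qed

text \<open>Multiplication by the reflection raises the degree bound from d + 1 to d + 2. The terms
  of degree d + 2 cancel because the leading coefficients agree, and by parity the next admissible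
  exponent is d.\<close>

lemma parity_strip:
  fixes P Q :: "'a::comm_ring_1 poly"
  assumes "parity (Suc d) P" "parity (Suc d) (pCons 0 Q)" "coeff P (Suc d) = coeff Q d"
  shows "parity d (pCons 0 P + Q - pCons 0 (pCons 0 Q))" "parity d (pCons 0 P - pCons 0 (pCons 0 Q))"
proof -
  have c: "coeff (pCons 0 P) (Suc (Suc d)) = coeff (pCons 0 (pCons 0 Q)) (Suc (Suc d))"
    using assms(3) by simp
  have p1: "parity (Suc (Suc d)) (pCons 0 P)" "parity (Suc (Suc d)) (pCons 0 (pCons 0 Q))"
    using assms(1,2) by (simp_all add: parity_pCons_Suc)
  have q: "parity d Q" using assms(2) by (simp add: parity_pCons_Suc)
  have reduce: "parity d R" if "parity (Suc (Suc d)) R" "coeff R (Suc (Suc d)) = 0" for R :: "'a poly"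
    unfolding parity_def
  proof (intro allI impI)
    fix i assume "coeff R i \<noteq> 0"
    then have "i \<noteq> Suc (Suc d)" "i \<le> Suc (Suc d)" "even (Suc (Suc d) + i)"
      using that by (auto simp: parity_def)
    then show "i \<le> d \<and> even (d + i)" by presburger
  qed
  show 1: "parity d (pCons 0 P - pCons 0 (pCons 0 Q))"
    using c by (intro reduce parity_diff p1) simp
  have "parity d (Q + (pCons 0 P - pCons 0 (pCons 0 Q)))" by (rule parity_add[OF q 1])
  then show "parity d (pCons 0 P + Q - pCons 0 (pCons 0 Q))" by (simp only: algebra_simps)
qed

lemma zrot_carrier [simp]: "zrot \<phi> \<in> carrier_mat 2 2"
  and reflect_carrier [simp]: "reflect x \<in> carrier_mat 2 2"
  by (auto simp: zrot_def reflect_def mat_of_rows_list_def)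

lemma zrot_dim [simp]: "dim_row (zrot \<phi>) = 2" "dim_col (zrot \<phi>) = 2"
  and reflect_dim [simp]: "dim_row (reflect x) = 2" "dim_col (reflect x) = 2"
  by (auto simp: zrot_def reflect_def mat_of_rows_list_def)

lemma zrot_index [simp]: "zrot \<phi> $$ (0, 0) = cis \<phi>" "zrot \<phi> $$ (0, Suc 0) = 0"
  "zrot \<phi> $$ (Suc 0, 0) = 0" "zrot \<phi> $$ (Suc 0, Suc 0) = cis (- \<phi>)"
  by (auto simp: zrot_def mat_of_rows_list_def)

lemma reflect_index [simp]: "reflect x $$ (0, 0) = of_real x"
  "reflect x $$ (0, Suc 0) = of_real (sqrt (1 - x\<^sup>2))"
  "reflect x $$ (Suc 0, 0) = of_real (sqrt (1 - x\<^sup>2))" "reflect x $$ (Suc 0, Suc 0) = - of_real x"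
  by (auto simp: reflect_def mat_of_rows_list_def)

lemma qsp_carrier [simp]: "qsp_product k \<Phi> x \<in> carrier_mat 2 2"
  by (induction k) (simp_all add: mult_carrier_mat[of _ 2 2])

lemma mult_2_index:
  assumes "A \<in> carrier_mat 2 2" "B \<in> carrier_mat 2 2" "i < 2" "j < 2"
  shows "(A * B) $$ (i, j) = A $$ (i, 0) * B $$ (0, j) + A $$ (i, Suc 0) * B $$ (Suc 0, j :: nat)"
  using assms by (auto simp: scalar_prod_def numeral_2_eq_2)

lemma zrot_reflect_carrier: "zrot \<phi> * reflect x \<in> carrier_mat 2 2"
  by (rule mult_carrier_mat[OF zrot_carrier reflect_carrier])

lemma zrot_reflect_index:
  "(zrot \<phi> * reflect x) $$ (0, 0) = cis \<phi> * of_real x"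
  "(zrot \<phi> * reflect x) $$ (0, Suc 0) = cis \<phi> * of_real (sqrt (1 - x\<^sup>2))"
  "(zrot \<phi> * reflect x) $$ (Suc 0, 0) = cis (- \<phi>) * of_real (sqrt (1 - x\<^sup>2))"
  "(zrot \<phi> * reflect x) $$ (Suc 0, Suc 0) = - cis (- \<phi>) * of_real x"
  by (simp_all add: mult_2_index[OF zrot_carrier reflect_carrier] del: index_mult_mat(1))

text \<open>The product grows on the left by definition, whereas layer stripping removes factors on
  the right.\<close>

lemma qsp_product_shift:
  "qsp_product (Suc k) \<Phi> x = qsp_product k (\<lambda>j. \<Phi> (Suc j)) x * (zrot (\<Phi> (Suc 0)) * reflect x)"
proof (induction k)
  case (Suc k)
  have "qsp_product (Suc (Suc k)) \<Phi> x = zrot (\<Phi> (Suc (Suc k))) * reflect x * qsp_product (Suc k) \<Phi> x"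
    by simp
  also have "\<dots> = zrot (\<Phi> (Suc (Suc k))) * reflect x * qsp_product k (\<lambda>j. \<Phi> (Suc j)) x
      * (zrot (\<Phi> (Suc 0)) * reflect x)"
    unfolding Suc.IH by (rule assoc_mult_mat[symmetric, OF zrot_reflect_carrier qsp_carrier zrot_reflect_carrier])
  finally show ?case by simp
next
  case 0
  show ?case
    using right_mult_one_mat[OF zrot_reflect_carrier[of "\<Phi> (Suc 0)" x]]
      left_mult_one_mat[OF zrot_reflect_carrier[of "\<Phi> (Suc 0)" x]] by simp
qed

lemma qsp_product_cong:
  "(\<And>j. 1 \<le> j \<Longrightarrow> j \<le> k \<Longrightarrow> \<Phi> j = \<Psi> j) \<Longrightarrow> qsp_product k \<Phi> x = qsp_product k \<Psi> x"
  by (induction k) auto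

lemma sqrt_complement:
  assumes "x \<in> {-1..1}"
  shows "complex_of_real (sqrt (1 - x\<^sup>2)) * of_real (sqrt (1 - x\<^sup>2)) = 1 - of_real x * of_real x"
proof -
  have "x\<^sup>2 \<le> 1" using assms by (simp add: abs_square_le_1 abs_le_iff)
  then have "sqrt (1 - x\<^sup>2) * sqrt (1 - x\<^sup>2) = 1 - x * x" by (simp add: power2_eq_square)
  then show ?thesis unfolding of_real_mult[symmetric] by simp
qed

text \<open>The leading coefficients of \<open>P\<close> and \<open>Q\<close> have equal modulus by the norm identity, so a rotation makes them
  equal, and then multiplication by the reflection on the right lowers the degree.\<close>

lemma layer_stripping:
  assumes "parity d P" "parity d (pCons 0 Q)"
    and "P * cnj_poly P + wpoly * (Q * cnj_poly Q) = 1"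
  shows "\<exists>\<Phi> \<theta>. \<forall>x\<in>{-1..1}.
    qsp_product d \<Phi> x $$ (0, 0) * cis \<theta> = poly P (of_real x) \<and>
    qsp_product d \<Phi> x $$ (0, 1) * cis (- \<theta>) = of_real (sqrt (1 - x\<^sup>2)) * poly Q (of_real x)"
  using assms
proof (induction d arbitrary: P Q)
  case 0
  have "coeff P i = 0" if "i > 0" for i using 0(1) that by (auto simp: parity_def)
  then have "degree P = 0" by (metis bot_nat_0.extremum_uniqueI leading_coeff_0_iff degree_0 gr0I)
  then obtain c where c: "P = [:c:]" by (auto elim: degree_eq_zeroE)
  have "coeff Q i = 0" for i
    using 0(2)[unfolded parity_def, rule_format, of "Suc i"] by auto
  then have q: "Q = 0" by (simp add: poly_eq_iff)
  have "cnj c * c = 1" using 0(3) by (simp add: c q one_pCons)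
  then have "(cmod c)\<^sup>2 = 1"
    by (metis complex_norm_square mult.commute of_real_eq_1_iff of_real_power)
  then have "cmod c = 1" using norm_ge_zero[of c] unfolding power2_eq_1_iff by linarith
  then have "c = cis (Arg c)" using rcis_cmod_Arg[of c] by (simp add: rcis_def)
  then show ?case by (intro exI[of _ "\<lambda>_. 0"] exI[of _ "Arg c"]) (simp add: c q)
next
  case (Suc d)
  let ?p = "coeff P (Suc d)" and ?q = "coeff Q d"
  have "coeff (P * cnj_poly P + wpoly * (Q * cnj_poly Q)) (Suc d + Suc d) = 0"
    unfolding Suc.prems(3) by simp
  moreover have "coeff (P * cnj_poly P) (Suc d + Suc d) = ?p * cnj ?p"
    using coeff_mult_top[OF Suc.prems(1) parity_cnj_poly[OF Suc.prems(1)]] by simp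
  moreover have "parity d Q" using Suc.prems(2) by (simp add: parity_pCons_Suc)
  then have "coeff (Q * cnj_poly Q) (d + d) = ?q * cnj ?q" "parity (d + d) (Q * cnj_poly Q)"
    using coeff_mult_top[of d Q d "cnj_poly Q"] parity_mult[of d Q d "cnj_poly Q"] parity_cnj_poly[of d Q] by auto
  moreover have "coeff (wpoly * R) (Suc d + Suc d) = - coeff R (d + d)" if "parity (d + d) R" for R :: "complex poly"
  proof -
    have "coeff R (Suc (Suc (d + d))) = 0" using that by (auto simp: parity_def)
    then show ?thesis by simp
  qed
  ultimately have "?p * cnj ?p = ?q * cnj ?q" by (simp del: mult_pCons_left)
  then have "cmod ?p = cmod ?q"
    by (metis complex_norm_square of_real_eq_iff norm_ge_zero power2_eq_iff_nonneg)
  \<comment> \<open>Half the difference of the arguments: rotating \<open>P\<close> by -\<phi> and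
    \<open>Q\<close> by \<phi> moves the arguments of both leading coefficients to their
    mean.\<close>
  define \<phi> where "\<phi> = (Arg ?p - Arg ?q) / 2"
  have rot: "cis (- \<phi>) * ?p = cis \<phi> * ?q"
  proof -
    have "cis (- \<phi>) * ?p = of_real (cmod ?p) * (cis (- \<phi>) * cis (Arg ?p))"
      by (metis mult.left_commute rcis_cmod_Arg rcis_def)
    also have "\<dots> = of_real (cmod ?q) * (cis \<phi> * cis (Arg ?q))"
      unfolding \<open>cmod ?p = cmod ?q\<close> cis_mult by (simp add: \<phi>_def field_simps)
    also have "\<dots> = cis \<phi> * ?q"
      by (metis mult.left_commute rcis_cmod_Arg rcis_def)
    finally show ?thesis .
  qed
  define P1 where "P1 = Polynomial.smult (cis (- \<phi>)) P"
  define Q1 where "Q1 = Polynomial.smult (cis \<phi>) Q"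
  define P2 where "P2 = pCons 0 P1 + Q1 - pCons 0 (pCons 0 Q1)"
  define Q2 where "Q2 = P1 - pCons 0 Q1"
  have par1: "parity (Suc d) P1" "parity (Suc d) (pCons 0 Q1)" "coeff P1 (Suc d) = coeff Q1 d"
    using parity_smult[OF Suc.prems(1), of "cis (- \<phi>)"] parity_smult[OF Suc.prems(2), of "cis \<phi>"] rot
    by (simp_all add: P1_def Q1_def)
  have par2: "parity d P2" "parity d (pCons 0 Q2)"
    using parity_strip[OF par1] by (simp_all add: P2_def Q2_def)
  let ?x = "[:0, 1:] :: complex poly"
  have w: "wpoly = 1 - ?x * ?x" by (simp add: one_pCons)
  have id1: "P1 * cnj_poly P1 + (1 - ?x * ?x) * (Q1 * cnj_poly Q1) = 1"
    using Suc.prems(3) unfolding w[symmetric] by (simp add: P1_def Q1_def cis_cnj cis_mult del: mult_pCons_left)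
  have P2: "P2 = ?x * P1 + (1 - ?x * ?x) * Q1" and cP2: "cnj_poly P2 = ?x * cnj_poly P1 + (1 - ?x * ?x) * cnj_poly Q1"
    and Q2: "Q2 = P1 - ?x * Q1" and cQ2: "cnj_poly Q2 = cnj_poly P1 - ?x * cnj_poly Q1"
    by (simp_all add: P2_def Q2_def algebra_simps)
  have "P2 * cnj_poly P2 + wpoly * (Q2 * cnj_poly Q2) = 1"
    unfolding w P2 cP2[unfolded P2] unfolding Q2 cQ2[unfolded Q2] by (rule strip_identity[OF id1])
  from Suc.IH[OF par2 this] obtain \<Phi> \<theta> where
    IH: "\<And>x. x\<in>{-1..1} \<Longrightarrow> qsp_product d \<Phi> x $$ (0, 0) * cis \<theta> = poly P2 (of_real x)"
    "\<And>x. x\<in>{-1..1} \<Longrightarrow> qsp_product d \<Phi> x $$ (0, 1) * cis (- \<theta>) = of_real (sqrt (1 - x\<^sup>2)) * poly Q2 (of_real x)"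
    by blast
  \<comment> \<open>The rotation \<open>\<theta>\<close> left over by the induction hypothesis
    becomes the first phase, the old phases move up by one, and \<open>\<phi>\<close> is left over
    in turn. The value at 0 is never read.\<close>
  define \<Phi>' where "\<Phi>' j = (case j of 0 \<Rightarrow> 0 | Suc 0 \<Rightarrow> \<theta> | Suc (Suc k) \<Rightarrow> \<Phi> (Suc k))" for j
  have "qsp_product (Suc d) \<Phi>' x $$ (0, 0) * cis \<phi> = poly P (of_real x) \<and>
    qsp_product (Suc d) \<Phi>' x $$ (0, 1) * cis (- \<phi>) = of_real (sqrt (1 - x\<^sup>2)) * poly Q (of_real x)"
    if x: "x\<in>{-1..1}" for x
  proof -
    let ?M = "qsp_product d \<Phi> x" and ?N = "qsp_product (Suc d) \<Phi>' x"
    define s where "s = complex_of_real (sqrt (1 - x\<^sup>2))"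
    have s2: "s * s = 1 - of_real x * of_real x"
      unfolding s_def by (rule sqrt_complement[OF x])
    have N: "?N = ?M * (zrot \<theta> * reflect x)"
      unfolding qsp_product_shift
      by (subst qsp_product_cong[of d _ \<Phi>]) (auto simp: \<Phi>'_def split: nat.splits)
    have "?N $$ (0, 0) = ?M $$ (0,0) * cis \<theta> * of_real x + ?M $$ (0, 1) * cis (- \<theta>) * s"
      unfolding N by (simp add: mult_2_index[OF qsp_carrier zrot_reflect_carrier] zrot_reflect_index s_def del: index_mult_mat(1))
    also have "\<dots> = poly P1 (of_real x)"
    proof -
      have "poly P2 X * X + (s * poly Q2 X) * s = poly P1 X" if "s * s = 1 - X * X" for X
      proof -
        have "(s * poly Q2 X) * s = (1 - X * X) * poly Q2 X" using that by (metis mult.commute mult.left_commute)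
        then show ?thesis by (simp add: P2_def Q2_def algebra_simps)
      qed
      from this[OF s2] show ?thesis using IH[OF x] by (simp only: s_def)
    qed
    finally have 1: "?N $$ (0, 0) = poly P1 (of_real x)" .
    have "?N $$ (0, 1) = ?M $$ (0,0) * cis \<theta> * s - ?M $$ (0, 1) * cis (- \<theta>) * of_real x"
      unfolding N by (simp add: mult_2_index[OF qsp_carrier zrot_reflect_carrier] zrot_reflect_index s_def del: index_mult_mat(1))
    also have "\<dots> = s * poly Q1 (of_real x)"
      using IH[OF x] by (simp only: s_def[symmetric]) (simp add: P2_def Q2_def algebra_simps)
    finally have 2: "?N $$ (0, 1) = s * poly Q1 (of_real x)" .
    show ?thesis using 1 2 unfolding s_def[symmetric]
      by (simp add: P1_def Q1_def cis_mult mult.commute mult.left_commute flip: mult.assoc)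
  qed
  then show ?case by blast
qed

lemma coeff_pcompose_square:
  fixes G :: "'a::comm_ring_1 poly"
  shows "coeff (G \<circ>\<^sub>p [:0, 0, 1:]) i = (if even i then coeff G (i div 2) else 0)"
proof (induction G arbitrary: i)
  case (pCons a G)
  show ?case
  proof (cases i)
    case 0
    then show ?thesis by (simp add: pcompose_pCons)
  next
    case (Suc j)
    then show ?thesis
      by (cases j) (simp_all add: pcompose_pCons pCons.IH)
  qed
qed simp

lemma qsp_phases_exist:
  assumes "degree p = d" "\<And>x. poly p (- x) = (- 1) ^ d * poly p x"
    and "\<And>x. x \<in> {-1..1} \<Longrightarrow> \<bar>poly p x\<bar> \<le> 1" "d > 0"
  shows "\<exists>\<Phi>. qsp_phases p d \<Phi>"
proof -
  have parp: "parity d p" by (rule parity_coeff[OF assms(1,2)])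
  \<comment> \<open>\<open>G\<close> collects the coefficients of even index, so that G(x^2) = 1 -
    p^2; by parity there are no others.\<close>
  define G where "G = (\<Sum>i\<le>d. monom (coeff (1 - p * p) (2 * i)) i)"
  have cG: "coeff G i = (if i \<le> d then coeff (1 - p * p) (2 * i) else 0)" for i
    by (simp add: G_def coeff_sum)
  have pp: "parity (d + d) (1 - p * p)"
    by (intro parity_diff parity_mult parp) (auto simp: parity_def one_pCons coeff_pCons split: nat.splits)
  have G: "G \<circ>\<^sub>p [:0, 0, 1:] = 1 - p * p"
  proof (rule poly_eqI)
    fix i
    have "coeff (1 - p * p) i \<noteq> 0 \<Longrightarrow> i \<le> d + d \<and> even i"
      using pp by (auto simp: parity_def)
    then show "coeff (G \<circ>\<^sub>p [:0, 0, 1:]) i = coeff (1 - p * p) i"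
      unfolding coeff_pcompose_square cG by (cases "coeff (1 - p * p) i = 0") (auto elim!: evenE)
  qed
  \<comment> \<open>\<open>wsos_nonneg\<close> uses the degree of \<open>G\<close> as the parity
    index of \<open>B\<close> and \<open>C\<close>, so it has to be exactly \<open>d\<close>. The
    top coefficient is minus the square of that of \<open>p\<close>; for \<open>d > 0\<close> the
    constant 1 does not interfere.\<close>
  have "degree G = d"
  proof (rule antisym)
    show "degree G \<le> d" by (rule degree_le) (simp add: cG)
    have "coeff (p * p) (d + d) = coeff p d * coeff p d" by (rule coeff_mult_top[OF parp parp])
    moreover have "coeff p d \<noteq> 0" using assms(1,4) by (metis degree_0 leading_coeff_0_iff less_irrefl)
    ultimately have "coeff G d \<noteq> 0" using assms(4) by (simp add: cG mult_2)
    then show "d \<le> degree G" by (rule le_degree)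
  qed
  have "poly G y \<ge> 0" if "y \<in> {0..1}" for y
  proof -
    have "poly G y = poly (G \<circ>\<^sub>p [:0, 0, 1:]) (sqrt y)" using that by (simp add: poly_pcompose)
    also have "\<dots> = 1 - (poly p (sqrt y))\<^sup>2" by (simp add: G power2_eq_square)
    also have "\<dots> \<ge> 0"
    proof -
      have "sqrt y \<in> {-1..1}" using that by (auto intro: order_trans[of _ 0])
      then show ?thesis using assms(3)[of "sqrt y"] by (simp add: abs_square_le_1)
    qed
    finally show ?thesis .
  qed
  then have "wsos d (1 - p * p)" using wsos_nonneg[of G] by (simp add: \<open>degree G = d\<close> G)
  then obtain B C where BC: "parity d B" "parity d (pCons 0 C)" "1 - p * p = B * B + wpoly * (C * C)"
    unfolding wsos_def by blast
  let ?c = "map_poly complex_of_real"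
  define P where "P = ?c p + Polynomial.smult \<i> (?c B)"
  have cmul: "?c (a * b) = ?c a * ?c b" and cadd: "?c (a + b) = ?c a + ?c b"
    and cdiff: "?c (a - b) = ?c a - ?c b" and ccsq: "cnj_poly (?c a) = ?c a" for a b
    by (rule poly_eqI, simp add: coeff_map_poly coeff_mult)+
  have parc: "parity m a \<Longrightarrow> parity m (?c a)" for m a by (simp add: parity_def coeff_map_poly)
  have "parity d P" unfolding P_def by (intro parity_add parity_smult parc parp BC)
  moreover have "parity d (pCons 0 (?c C))" proof -
    have "?c (pCons 0 C) = pCons 0 (?c C)" by (rule poly_eqI) (simp add: coeff_map_poly coeff_pCons split: nat.split)
    then show ?thesis using parc[OF BC(2)] by simp
  qed
  moreover have "P * cnj_poly P + wpoly * (?c C * cnj_poly (?c C)) = 1"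
  proof -
    have "P * cnj_poly P = ?c (p * p + B * B)"
      by (simp add: P_def ccsq cmul cadd algebra_simps)
    moreover have "wpoly = ?c wpoly" by (simp add: map_poly_pCons)
    ultimately have "P * cnj_poly P + wpoly * (?c C * cnj_poly (?c C)) = ?c (p * p + (B * B + wpoly * (C * C)))"
      unfolding ccsq by (simp only: cmul[symmetric] cadd[symmetric] add.assoc)
    then show ?thesis unfolding BC(3)[symmetric] by (simp add: map_poly_1)
  qed
  ultimately obtain \<Phi> \<theta> where entry: "\<And>x. x\<in>{-1..1} \<Longrightarrow> qsp_product d \<Phi> x $$ (0, 0) * cis \<theta> = poly P (of_real x)"
    using layer_stripping[of d P "?c C"] by blast
  obtain k where k: "d = Suc k" using assms(4) by (cases d) auto
  define \<Psi> where "\<Psi> = \<Phi>(d := \<Phi> d + \<theta>)"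
  have "qsp_product d \<Psi> x $$ (0, 0) = poly P (of_real x)" if "x\<in>{-1..1}" for x
  proof -
    have "qsp_product k \<Psi> x = qsp_product k \<Phi> x"
      by (rule qsp_product_cong) (auto simp: \<Psi>_def k)
    moreover have "cis (\<Psi> (Suc k)) = cis (\<Phi> (Suc k)) * cis \<theta>" by (simp add: \<Psi>_def k cis_mult)
    ultimately have "qsp_product d \<Psi> x $$ (0, 0) = qsp_product d \<Phi> x $$ (0, 0) * cis \<theta>"
      unfolding k
      by (simp add: mult_2_index[OF zrot_reflect_carrier qsp_carrier] zrot_reflect_index distrib_right distrib_left mult_ac
          del: index_mult_mat(1))
    then show ?thesis using entry[OF that] by simp
  qed
  moreover have "Re (poly P (of_real x)) = poly p x" for x
    by (simp add: P_def poly_map_poly_of_real)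
  ultimately show ?thesis unfolding qsp_phases_def by blast
qed

section \<open>Circuits as linear maps\<close>

lemma mat_adjoint_dim [simp]: "dim_row (mat_adjoint A) = dim_col A" "dim_col (mat_adjoint A) = dim_row A"
  by (auto simp: mat_adjoint_def)

lemma mat_adjoint_carrier [simp]: "A \<in> carrier_mat m n \<Longrightarrow> mat_adjoint A \<in> carrier_mat n m"
  by (intro carrier_matI) auto

lemma mat_adjoint_index [simp]:
  "i < dim_col A \<Longrightarrow> j < dim_row A \<Longrightarrow> mat_adjoint A $$ (i, j) = conjugate (A $$ (j, i))"
  by (simp add: mat_adjoint_def mat_of_rows_index)

lemma mat_adjoint_adjoint [simp]: "mat_adjoint (mat_adjoint A) = A"
  by (rule eq_matI) auto

lemma unitary_mat_adjoint: "unitary_mat m U \<Longrightarrow> unitary_mat m (mat_adjoint U)"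
  by (auto simp: unitary_mat_def)

lemma UNIV_reg: "(UNIV :: reg set) = {Ctl, Lcu Lft, Lcu Rgt, Rot Lft, Rot Rgt, AncA Lft, AncA Rgt, AncO, Sys}"
proof -
  have "r \<in> {Ctl, Lcu Lft, Lcu Rgt, Rot Lft, Rot Rgt, AncA Lft, AncA Rgt, AncO, Sys}" for r
  proof (cases r)
    case (Lcu s) then show ?thesis by (cases s) simp_all
  next
    case (Rot s) then show ?thesis by (cases s) simp_all
  next
    case (AncA s) then show ?thesis by (cases s) simp_all
  qed simp_all
  then show ?thesis by blast
qed

lemma finite_reg [simp]: "finite (S :: reg set)"
  by (rule finite_subset[OF subset_UNIV]) (simp add: UNIV_reg)

lemma mem_basis: "x \<in> basis ds \<longleftrightarrow> (\<forall>r. x r < ds r)"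
  by (auto simp: basis_def PiE_def Pi_def)

lemma finite_basis [simp]: "finite (basis ds)"
  unfolding basis_def by (rule finite_PiE) auto

section \<open>Slices of basis labels and the mixed-radix index\<close>

definition slice :: "(reg \<Rightarrow> nat) \<Rightarrow> reg set \<Rightarrow> label \<Rightarrow> label set" where
  "slice ds T x = {y \<in> basis ds. \<forall>r. r \<notin> T \<longrightarrow> y r = x r}"

lemma finite_slice [simp]: "finite (slice ds T x)"
  by (simp add: slice_def)

definition total_dim :: "(reg \<Rightarrow> nat) \<Rightarrow> reg list \<Rightarrow> nat" where
  "total_dim ds ts = prod_list (map ds ts)"

lemma reg_index_Nil [simp]: "reg_index ds [] x = 0"
  by (simp add: reg_index_def)

lemma reg_index_snoc [simp]: "reg_index ds (ts @ [r]) x = reg_index ds ts x * ds r + x r"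
  by (simp add: reg_index_def)

lemma reg_index_single [simp]: "reg_index ds [r] x = x r"
  by (simp add: reg_index_def)

lemma reg_index_pair [simp]: "reg_index ds [r, s] x = x r * ds s + x s"
  by (simp add: reg_index_def)

lemma reg_index_cong: "(\<And>r. r \<in> set ts \<Longrightarrow> x r = y r) \<Longrightarrow> reg_index ds ts x = reg_index ds ts y"
  by (induction ts rule: rev_induct) auto

lemma mixed_radix_less: "i < m \<Longrightarrow> j < n \<Longrightarrow> i * n + j < m * (n :: nat)"
proof -
  assume "i < m" "j < n"
  then have "i * n + j < Suc i * n" by simp
  also have "\<dots> \<le> m * n" using \<open>i < m\<close> by (intro mult_le_mono1) simp
  finally show ?thesis .
qed

lemma reg_index_less: "x \<in> basis ds \<Longrightarrow> reg_index ds ts x < total_dim ds ts"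
  by (induction ts rule: rev_induct) (auto simp: total_dim_def mem_basis intro!: mixed_radix_less)

lemma reg_index_inj:
  assumes "x \<in> basis ds" "y \<in> basis ds" "\<And>r. r \<notin> set ts \<Longrightarrow> y r = x r"
    and "reg_index ds ts x = reg_index ds ts y"
  shows "x = y"
  using assms(3,4)
proof (induction ts rule: rev_induct)
  case (snoc r ts)
  have lt: "x r < ds r" "y r < ds r" using assms(1,2) by (auto simp: mem_basis)
  have eq: "reg_index ds ts x * ds r + x r = reg_index ds ts y * ds r + y r" using snoc.prems(2) by simp
  have "(reg_index ds ts x * ds r + x r) mod ds r = x r" "(reg_index ds ts y * ds r + y r) mod ds r = y r"
    "(reg_index ds ts x * ds r + x r) div ds r = reg_index ds ts x"
    "(reg_index ds ts y * ds r + y r) div ds r = reg_index ds ts y" using lt by auto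
  then have "x r = y r" "reg_index ds ts x = reg_index ds ts y" using eq by metis+
  then show ?case using snoc by force
qed (auto simp: fun_eq_iff)

lemma reg_index_surj:
  assumes "x \<in> basis ds" "distinct ts" "k < total_dim ds ts"
  shows "\<exists>y \<in> slice ds (set ts) x. reg_index ds ts y = k"
  using assms(2,3)
proof (induction ts arbitrary: k rule: rev_induct)
  case Nil
  then show ?case using assms(1) by (auto simp: slice_def total_dim_def)
next
  case (snoc r ts)
  have pos: "ds r > 0" using assms(1) by (metis mem_basis not_less_zero gr0I)
  have "k div ds r < total_dim ds ts"
    using snoc.prems(2) by (auto simp: total_dim_def less_mult_imp_div_less)
  then obtain y where y: "y \<in> slice ds (set ts) x" "reg_index ds ts y = k div ds r"
    using snoc by (auto simp del: reg_index_snoc)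
  let ?z = "y(r := k mod ds r)"
  have "reg_index ds ts ?z = k div ds r"
    using y(2) snoc.prems(1) by (subst reg_index_cong[of _ _ y]) auto
  then have "reg_index ds (ts @ [r]) ?z = k" by simp
  moreover have "?z \<in> slice ds (set (ts @ [r])) x"
    using y(1) pos by (auto simp: slice_def mem_basis)
  ultimately show ?case by blast
qed

text \<open>Turns the sums over labels in the semantics of a gate into sums over matrix
  indices.\<close>

lemma bij_betw_reg_index:
  assumes "x \<in> basis ds" "distinct ts"
  shows "bij_betw (reg_index ds ts) (slice ds (set ts) x) {..<total_dim ds ts}"
proof (rule bij_betwI')
  fix y z assume "y \<in> slice ds (set ts) x" "z \<in> slice ds (set ts) x"
  then show "(reg_index ds ts y = reg_index ds ts z) = (y = z)"
    using reg_index_inj[of y ds z ts] by (auto simp: slice_def)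
next
  fix y assume "y \<in> slice ds (set ts) x"
  then show "reg_index ds ts y \<in> {..<total_dim ds ts}"
    using reg_index_less[of y ds ts] by (simp add: slice_def)
next
  fix k assume "k \<in> {..<total_dim ds ts}"
  then show "\<exists>y\<in>slice ds (set ts) x. k = reg_index ds ts y"
    using reg_index_surj[OF assms, of k] by auto
qed

definition controls_ok :: "label \<Rightarrow> gate \<Rightarrow> bool" where
  "controls_ok x g \<longleftrightarrow> (\<forall>(r, v) \<in> set (ctrls g). x r = v)"

lemma apply_gate_slice:
  "apply_gate I ds g st x = (if controls_ok x g
     then \<Sum>y \<in> slice ds (set (targets g)) x.
       oper_mat I (oper_of g) $$ (reg_index ds (targets g) x, reg_index ds (targets g) y) * st y
     else st x)"
  by (simp add: apply_gate_def slice_def controls_ok_def)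

section \<open>Adjoints and unitarity of gates and circuits\<close>

definition wf_gate :: "gate \<Rightarrow> bool" where
  "wf_gate g \<longleftrightarrow> distinct (targets g) \<and> (\<forall>(r, v) \<in> set (ctrls g). r \<notin> set (targets g))"

definition unitary_gate :: "(blackbox \<Rightarrow> complex mat) \<Rightarrow> (reg \<Rightarrow> nat) \<Rightarrow> gate \<Rightarrow> bool" where
  "unitary_gate I ds g \<longleftrightarrow> wf_gate g \<and> unitary_mat (total_dim ds (targets g)) (oper_mat I (oper_of g))"

definition iprod :: "(reg \<Rightarrow> nat) \<Rightarrow> state \<Rightarrow> state \<Rightarrow> complex" where
  "iprod ds a b = (\<Sum>x \<in> basis ds. cnj (a x) * b x)"

text \<open>Controls are never targets, so the control condition is constant on a slice and a
  controlled gate acts on each slice separately.\<close>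

lemma controls_ok_slice:
  "wf_gate g \<Longrightarrow> y \<in> slice ds (set (targets g)) x \<Longrightarrow> controls_ok y g = controls_ok x g"
  unfolding wf_gate_def slice_def controls_ok_def by fastforce

lemma slice_basis: "y \<in> slice ds T x \<Longrightarrow> y \<in> basis ds"
  by (auto simp: slice_def)

lemma slice_self: "x \<in> basis ds \<Longrightarrow> x \<in> slice ds T x"
  by (auto simp: slice_def)

lemma slice_eq: "y \<in> slice ds T x \<Longrightarrow> slice ds T y = slice ds T x"
  by (auto simp: slice_def)

lemma adj_gate_simps [simp]: "ctrls (adj_gate g) = ctrls g" "targets (adj_gate g) = targets g"
  "controls_ok x (adj_gate g) = controls_ok x g" "wf_gate (adj_gate g) = wf_gate g"
  "oper_of (adj_gate g) = adj_oper (oper_of g)"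
  by (cases g; simp add: controls_ok_def wf_gate_def)+

lemma oper_mat_adj [simp]: "oper_mat I (adj_oper u) = mat_adjoint (oper_mat I u)"
  by (cases u) auto

text \<open>The matrix of the gate on the whole label space. Its sums run over all of
  \<open>basis ds\<close> and not over a slice that depends on the output label, so the order of
  summation can be exchanged.\<close>

definition gate_kernel ::
  "(blackbox \<Rightarrow> complex mat) \<Rightarrow> (reg \<Rightarrow> nat) \<Rightarrow> gate \<Rightarrow> label \<Rightarrow> label \<Rightarrow> complex" where
  "gate_kernel I ds g x y = (if controls_ok x g
     then if y \<in> slice ds (set (targets g)) x
       then oper_mat I (oper_of g) $$ (reg_index ds (targets g) x, reg_index ds (targets g) y) else 0
     else if y = x then 1 else 0)"

lemma apply_gate_kernel:
  assumes "x \<in> basis ds"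
  shows "apply_gate I ds g st x = (\<Sum>y\<in>basis ds. gate_kernel I ds g x y * st y)"
proof (cases "controls_ok x g")
  case True
  let ?S = "slice ds (set (targets g)) x"
  have "(\<Sum>y\<in>basis ds. gate_kernel I ds g x y * st y) = (\<Sum>y\<in>?S. gate_kernel I ds g x y * st y)"
    using True by (intro sum.mono_neutral_right) (auto simp: gate_kernel_def dest: slice_basis)
  then show ?thesis using True by (simp add: apply_gate_slice gate_kernel_def)
next
  case False
  have "(\<Sum>y\<in>basis ds. gate_kernel I ds g x y * st y) = (\<Sum>y\<in>{x}. gate_kernel I ds g x y * st y)"
    using False assms by (intro sum.mono_neutral_right) (auto simp: gate_kernel_def)
  then show ?thesis using False by (simp add: apply_gate_slice gate_kernel_def)
qed

lemma gate_kernel_adj: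
  assumes "wf_gate g" "oper_mat I (oper_of g) \<in> carrier_mat (total_dim ds (targets g)) (total_dim ds (targets g))"
    and "x \<in> basis ds" "y \<in> basis ds"
  shows "gate_kernel I ds (adj_gate g) y x = cnj (gate_kernel I ds g x y)"
proof (cases "y \<in> slice ds (set (targets g)) x")
  case True
  then have xy: "x \<in> slice ds (set (targets g)) y" using assms(3) by (auto simp: slice_def)
  let ?M = "oper_mat I (oper_of g)" and ?i = "reg_index ds (targets g)"
  have "?i x < dim_row ?M" "?i y < dim_col ?M"
    unfolding carrier_matD[OF assms(2)] by (rule reg_index_less[OF assms(3)], rule reg_index_less[OF assms(4)])
  then have "mat_adjoint ?M $$ (?i y, ?i x) = cnj (?M $$ (?i x, ?i y))" by simp
  moreover note controls_ok_slice[OF assms(1) True]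
  ultimately show ?thesis
    unfolding gate_kernel_def adj_gate_simps oper_mat_adj if_P[OF True] if_P[OF xy]
    by (cases "controls_ok x g") (simp_all only: if_True if_False, auto)
next
  case False
  then have "x \<notin> slice ds (set (targets g)) y" "x \<noteq> y" using assms(3,4) by (auto simp: slice_def)
  then show ?thesis using False by (simp add: gate_kernel_def)
qed

lemma iprod_apply_gate:
  assumes "wf_gate g" "oper_mat I (oper_of g) \<in> carrier_mat (total_dim ds (targets g)) (total_dim ds (targets g))"
  shows "iprod ds (apply_gate I ds g a) b = iprod ds a (apply_gate I ds (adj_gate g) b)"
proof -
  let ?B = "basis ds" and ?K = "gate_kernel I ds g"
  have "iprod ds (apply_gate I ds g a) b = (\<Sum>x\<in>?B. \<Sum>y\<in>?B. cnj (a y) * (cnj (?K x y) * b x))"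
    unfolding iprod_def
    by (rule sum.cong) (simp_all add: apply_gate_kernel sum_distrib_right mult.assoc mult.left_commute)
  also have "\<dots> = (\<Sum>y\<in>?B. \<Sum>x\<in>?B. cnj (a y) * (cnj (?K x y) * b x))" by (rule sum.swap)
  also have "\<dots> = iprod ds a (apply_gate I ds (adj_gate g) b)"
    unfolding iprod_def
    by (rule sum.cong) (simp_all add: apply_gate_kernel gate_kernel_adj[OF assms] sum_distrib_left)
  finally show ?thesis .
qed

lemma apply_adj_gate:
  assumes "unitary_gate I ds g" "x \<in> basis ds"
  shows "apply_gate I ds (adj_gate g) (apply_gate I ds g a) x = a x"
proof (cases "controls_ok x g")
  case True
  let ?M = "oper_mat I (oper_of g)" and ?i = "reg_index ds (targets g)" and ?S = "slice ds (set (targets g)) x"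
  let ?D = "total_dim ds (targets g)"
  have wf: "wf_gate g" and M: "?M \<in> carrier_mat ?D ?D" "mat_adjoint ?M * ?M = 1\<^sub>m ?D"
    using assms(1) by (auto simp: unitary_gate_def unitary_mat_def)
  have ix: "?i x < ?D" using reg_index_less[OF assms(2)] .
  have "apply_gate I ds (adj_gate g) (apply_gate I ds g a) x
    = (\<Sum>y\<in>?S. mat_adjoint ?M $$ (?i x, ?i y) * (\<Sum>z\<in>?S. ?M $$ (?i y, ?i z) * a z))"
    using True by (subst apply_gate_slice)
      (auto simp: apply_gate_slice slice_eq controls_ok_slice[OF wf] cong: sum.cong)
  also have "\<dots> = (\<Sum>z\<in>?S. (\<Sum>y\<in>?S. mat_adjoint ?M $$ (?i x, ?i y) * ?M $$ (?i y, ?i z)) * a z)"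
    by (simp add: sum_distrib_left sum_distrib_right mult.assoc) (rule sum.swap)
  also have "\<dots> = (\<Sum>z\<in>?S. (if z = x then 1 else 0) * a z)"
  proof (rule sum.cong)
    fix z assume z: "z \<in> ?S"
    then have iz: "?i z < ?D" by (intro reg_index_less slice_basis)
    have "(\<Sum>y\<in>?S. mat_adjoint ?M $$ (?i x, ?i y) * ?M $$ (?i y, ?i z))
      = (\<Sum>k<?D. mat_adjoint ?M $$ (?i x, k) * ?M $$ (k, ?i z))"
      using wf by (intro sum.reindex_bij_betw bij_betw_reg_index assms) (auto simp: wf_gate_def)
    also have "\<dots> = (mat_adjoint ?M * ?M) $$ (?i x, ?i z)"
      using M(1) ix iz by (auto simp: scalar_prod_def lessThan_atLeast0)
    also have "\<dots> = (if ?i x = ?i z then 1 else 0)" unfolding M(2) using ix iz by simp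
    also have "\<dots> = (if z = x then 1 else 0)"
      using reg_index_inj[OF assms(2) slice_basis[OF z], of "targets g"] z by (auto simp: slice_def)
    finally show "(\<Sum>y\<in>?S. mat_adjoint ?M $$ (?i x, ?i y) * ?M $$ (?i y, ?i z)) * a z = (if z = x then 1 else 0) * a z"
      by simp
  qed simp
  also have "\<dots> = (\<Sum>z\<in>?S. if z = x then a z else 0)" by (rule sum.cong) auto
  also have "\<dots> = a x" using slice_self[OF assms(2)] by simp
  finally show ?thesis .
qed (simp add: apply_gate_slice)

lemma run_circuit_Nil [simp]: "run_circuit I ds [] st = st"
  and run_circuit_Cons [simp]: "run_circuit I ds (g # c) st = run_circuit I ds c (apply_gate I ds g st)"
  and run_circuit_append [simp]: "run_circuit I ds (c @ c') st = run_circuit I ds c' (run_circuit I ds c st)"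
  by (auto simp: run_circuit_def)

definition unitary_circuit :: "(blackbox \<Rightarrow> complex mat) \<Rightarrow> (reg \<Rightarrow> nat) \<Rightarrow> gate list \<Rightarrow> bool" where
  "unitary_circuit I ds c \<longleftrightarrow> (\<forall>g\<in>set c. unitary_gate I ds g)"

lemma unitary_circuit_simps [simp]: "unitary_circuit I ds []"
  "unitary_circuit I ds (g # c) \<longleftrightarrow> unitary_gate I ds g \<and> unitary_circuit I ds c"
  "unitary_circuit I ds (c @ c') \<longleftrightarrow> unitary_circuit I ds c \<and> unitary_circuit I ds c'"
  by (auto simp: unitary_circuit_def)

lemma unitary_gateD: "unitary_gate I ds g \<Longrightarrow> wf_gate g"
  "unitary_gate I ds g \<Longrightarrow> oper_mat I (oper_of g) \<in> carrier_mat (total_dim ds (targets g)) (total_dim ds (targets g))"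
  by (auto simp: unitary_gate_def unitary_mat_def)

lemma iprod_run_circuit:
  assumes "unitary_circuit I ds c"
  shows "iprod ds (run_circuit I ds c a) b = iprod ds a (run_circuit I ds (adj_circuit c) b)"
  using assms
proof (induction c arbitrary: a b)
  case (Cons g c)
  then have g: "wf_gate g" "oper_mat I (oper_of g) \<in> carrier_mat (total_dim ds (targets g)) (total_dim ds (targets g))"
    using unitary_gateD by auto
  show ?case
    using Cons by (simp add: adj_circuit_def iprod_apply_gate[OF g])
qed (simp add: adj_circuit_def)

lemma norm_run_circuit:
  assumes "unitary_circuit I ds c"
  shows "iprod ds (run_circuit I ds c a) (run_circuit I ds c a) = iprod ds a a"
  using assms
proof (induction c arbitrary: a)
  case (Cons g c)
  then have "iprod ds (run_circuit I ds (g # c) a) (run_circuit I ds (g # c) a)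
    = iprod ds (apply_gate I ds g a) (apply_gate I ds g a)" by simp
  also have "\<dots> = iprod ds a (apply_gate I ds (adj_gate g) (apply_gate I ds g a))"
    using Cons.prems by (intro iprod_apply_gate) (auto dest: unitary_gateD)
  also have "\<dots> = iprod ds a a"
    unfolding iprod_def using Cons.prems by (intro sum.cong refl) (simp only: apply_adj_gate unitary_circuit_simps)
  finally show ?case .
qed simp

section \<open>Locality of circuits and controlled circuits\<close>

definition touched :: "gate list \<Rightarrow> reg set" where
  "touched c = (\<Union>g\<in>set c. set (targets g))"

lemma touched_simps [simp]: "touched [] = {}" "touched (g # c) = set (targets g) \<union> touched c"
  "touched (c @ c') = touched c \<union> touched c'"
  by (auto simp: touched_def)

lemma apply_gate_cong:
  assumes "\<And>y. y \<in> slice ds T x \<Longrightarrow> st y = st' y" "set (targets g) \<subseteq> T" "x \<in> basis ds"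
  shows "apply_gate I ds g st x = apply_gate I ds g st' x"
proof -
  have "st y = st' y" if "y \<in> slice ds (set (targets g)) x" for y
    using that assms(1,2) by (auto simp: slice_def)
  then show ?thesis using assms(1)[OF slice_self[OF assms(3)]] by (simp add: apply_gate_slice cong: sum.cong)
qed

text \<open>A gate reads only labels that differ from the output label on its targets; hence an
  output amplitude depends on the input within one slice. This locality does the work of tensor
  product arguments.\<close>

lemma run_circuit_cong:
  assumes "\<And>y. y \<in> slice ds T x \<Longrightarrow> st y = st' y" "touched c \<subseteq> T" "x \<in> basis ds"
  shows "run_circuit I ds c st x = run_circuit I ds c st' x"
  using assms
proof (induction c arbitrary: st st')
  case (Cons g c)
  have "apply_gate I ds g st y = apply_gate I ds g st' y" if "y \<in> slice ds T x" for y
    using Cons.prems(1,2) slice_eq[OF that] slice_basis[OF that] by (intro apply_gate_cong[of ds T]) auto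
  then show ?case using Cons.IH[of "apply_gate I ds g st" "apply_gate I ds g st'"] Cons.prems(2,3) by simp
qed (auto simp: slice_self)

lemma run_circuit_slice_zero:
  assumes "\<And>y. y \<in> slice ds T x \<Longrightarrow> st y = 0" "touched c \<subseteq> T" "x \<in> basis ds"
  shows "run_circuit I ds c st x = 0"
proof -
  have "run_circuit I ds c st x = run_circuit I ds c (\<lambda>_. 0) x"
    using assms by (intro run_circuit_cong[of ds T]) auto
  also have "run_circuit I ds c (\<lambda>_. 0) = (\<lambda>_. 0)"
  proof (induction c)
    case (Cons g c)
    have "apply_gate I ds g (\<lambda>_. 0) = (\<lambda>_. 0)"
      by (rule ext) (simp add: apply_gate_slice)
    then show ?case using Cons by simp
  qed simp
  finally show ?thesis .
qed

lemma touched_ctrl_circuit [simp]: "touched (ctrl_circuit r v c) = touched c"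
proof -
  have "targets (ctrl_gate r v g) = targets g" for g by (cases g) auto
  then show ?thesis by (simp add: touched_def ctrl_circuit_def)
qed

lemma touched_adj_circuit [simp]: "touched (adj_circuit c) = touched c"
  by (simp add: touched_def adj_circuit_def)

lemma apply_ctrl_gate:
  "apply_gate I ds (ctrl_gate r v g) st x = (if x r = v then apply_gate I ds g st x else st x)"
  by (cases g) (simp add: apply_gate_def)

text \<open>As \<open>r\<close> is never a target, all labels that contribute to the amplitude at
  \<open>x\<close> agree with \<open>x\<close> on \<open>r\<close>: the control is decided once for
  the whole circuit.\<close>

lemma run_ctrl_circuit:
  assumes "r \<notin> touched c" "x \<in> basis ds"
  shows "run_circuit I ds (ctrl_circuit r v c) st x = (if x r = v then run_circuit I ds c st x else st x)"
  using assms
proof (induction c arbitrary: st)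
  case (Cons g c)
  have "run_circuit I ds c (apply_gate I ds (ctrl_gate r v g) st) x = run_circuit I ds c (apply_gate I ds g st) x"
    if "x r = v"
    using Cons.prems that by (intro run_circuit_cong[of ds "touched c"]) (auto simp: apply_ctrl_gate slice_def)
  then show ?case using Cons by (simp add: ctrl_circuit_def apply_ctrl_gate)
qed (simp add: ctrl_circuit_def)

lemma slice_single:
  assumes "x \<in> basis ds"
  shows "bij_betw (\<lambda>i. x(r := i)) {..<ds r} (slice ds {r} x)"
proof (rule bij_betwI')
  fix y assume y: "y \<in> slice ds {r} x"
  then have "y = x(r := y r)" by (auto simp: slice_def fun_eq_iff)
  then show "\<exists>i\<in>{..<ds r}. y = x(r := i)" using y by (auto simp: slice_def mem_basis)
next
  fix i j
  show "(x(r := i) = x(r := j)) = (i = j)" by (metis fun_upd_same)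
qed (use assms in \<open>auto simp: slice_def mem_basis\<close>)

lemma apply_gate_single:
  assumes "x \<in> basis ds"
  shows "apply_gate I ds (Gate cs u [r]) st x = (if \<forall>(r, v) \<in> set cs. x r = v
     then \<Sum>i<ds r. oper_mat I u $$ (x r, i) * st (x(r := i)) else st x)"
proof -
  have "(\<Sum>y\<in>slice ds {r} x. oper_mat I u $$ (x r, y r) * st y) = (\<Sum>i<ds r. oper_mat I u $$ (x r, i) * st (x(r := i)))"
    by (subst sum.reindex_bij_betw[OF slice_single[OF assms, of r], symmetric]) simp
  then show ?thesis by (simp add: apply_gate_slice controls_ok_def)
qed

lemma apply_gate_index:
  assumes "x \<in> basis ds" "distinct ts" "\<And>y. y \<in> slice ds (set ts) x \<Longrightarrow> st y = f (reg_index ds ts y)"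
  shows "apply_gate I ds (Gate [] u ts) st x = (\<Sum>k<total_dim ds ts. oper_mat I u $$ (reg_index ds ts x, k) * f k)"
proof -
  have "apply_gate I ds (Gate [] u ts) st x =
    (\<Sum>y\<in>slice ds (set ts) x. oper_mat I u $$ (reg_index ds ts x, reg_index ds ts y) * f (reg_index ds ts y))"
    by (simp add: apply_gate_slice controls_ok_def assms(3))
  also have "\<dots> = (\<Sum>k<total_dim ds ts. oper_mat I u $$ (reg_index ds ts x, k) * f k)"
    by (rule sum.reindex_bij_betw[OF bij_betw_reg_index[OF assms(1,2)]])
  finally show ?thesis .
qed

section \<open>Block-encoding circuits\<close>

abbreviation act :: "(reg \<Rightarrow> nat) \<Rightarrow> complex mat \<Rightarrow> state \<Rightarrow> state" where
  "act ds M st x \<equiv> \<Sum>i<ds Sys. M $$ (x Sys, i) * st (x(Sys := i))"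

text \<open>A purely local form of block-encoding: it speaks about one amplitude and the labels that differ from
  it on the system and the ancillas \<open>T\<close> only, so it composes without tensor products.\<close>

definition encodes ::
  "(blackbox \<Rightarrow> complex mat) \<Rightarrow> (reg \<Rightarrow> nat) \<Rightarrow> gate list \<Rightarrow> reg set \<Rightarrow> complex mat \<Rightarrow> bool" where
  "encodes I ds c T M \<longleftrightarrow> touched c \<subseteq> insert Sys T \<and> Sys \<notin> T \<and> M \<in> carrier_mat (ds Sys) (ds Sys) \<and>
    (\<forall>st. \<forall>x \<in> basis ds. (\<forall>r\<in>T. x r = 0) \<longrightarrow>
      (\<forall>y \<in> slice ds (insert Sys T) x. (\<exists>r\<in>T. y r \<noteq> 0) \<longrightarrow> st y = 0) \<longrightarrow>
      run_circuit I ds c st x = act ds M st x)"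

lemma encodesD:
  assumes "encodes I ds c T M" "x \<in> basis ds" "\<And>r. r \<in> T \<Longrightarrow> x r = 0"
    and "\<And>y r. y \<in> slice ds (insert Sys T) x \<Longrightarrow> r \<in> T \<Longrightarrow> y r \<noteq> 0 \<Longrightarrow> st y = 0"
  shows "run_circuit I ds c st x = act ds M st x"
  using assms unfolding encodes_def by blast

lemma basis_upd: "x \<in> basis ds \<Longrightarrow> i < ds r \<Longrightarrow> x(r := i) \<in> basis ds"
  by (auto simp: mem_basis)

lemma mult_mat_index:
  assumes "A \<in> carrier_mat m k" "B \<in> carrier_mat k n" "i < m" "j < n"
  shows "(A * B) $$ (i, j) = (\<Sum>l<k. A $$ (i, l) * B $$ (l, j))"
  using assms by (auto simp: scalar_prod_def lessThan_atLeast0)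

text \<open>After \<open>c1\<close> the ancillas \<open>T1\<close> may be nonzero, but
  \<open>c2\<close> does not touch them. So the final amplitudes with \<open>T1\<close> zero come
  only from intermediate ones with \<open>T1\<close> zero, and there \<open>c1\<close> acts as
  \<open>M1\<close>.\<close>

lemma encodes_append:
  assumes 1: "encodes I ds c1 T1 M1" and 2: "encodes I ds c2 T2 M2" and "T1 \<inter> T2 = {}"
  shows "encodes I ds (c1 @ c2) (T1 \<union> T2) (M2 * M1)"
  unfolding encodes_def
proof (intro conjI allI ballI impI)
  have M: "M1 \<in> carrier_mat (ds Sys) (ds Sys)" "M2 \<in> carrier_mat (ds Sys) (ds Sys)"
    using 1 2 by (auto simp: encodes_def)
  then show "M2 * M1 \<in> carrier_mat (ds Sys) (ds Sys)" by auto
  show "touched (c1 @ c2) \<subseteq> insert Sys (T1 \<union> T2)" "Sys \<notin> T1 \<union> T2"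
    using 1 2 by (auto simp: encodes_def)
  fix st :: state and x assume x: "x \<in> basis ds" "\<forall>r\<in>T1 \<union> T2. x r = 0"
    and z: "\<forall>y\<in>slice ds (insert Sys (T1 \<union> T2)) x. (\<exists>r\<in>T1 \<union> T2. y r \<noteq> 0) \<longrightarrow> st y = 0"
  have n: "x Sys < ds Sys" using x by (simp add: mem_basis)
  have st1: "run_circuit I ds c1 st y = (\<Sum>i<ds Sys. M1 $$ (y Sys, i) * st (y(Sys := i)))"
    if "y \<in> slice ds (insert Sys T2) x" for y
  proof (rule encodesD[OF 1])
    show "y \<in> basis ds" using that by (rule slice_basis)
    have "r \<notin> insert Sys T2" if "r \<in> T1" for r
      using that \<open>T1 \<inter> T2 = {}\<close> 1 by (auto simp: encodes_def)
    then show "y r = 0" if "r \<in> T1" for r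
      using that \<open>y \<in> slice ds (insert Sys T2) x\<close> x(2) by (simp add: slice_def)
    fix w r assume w: "w \<in> slice ds (insert Sys T1) y" "r \<in> T1" "w r \<noteq> 0"
    have "w \<in> slice ds (insert Sys (T1 \<union> T2)) x" using w(1) that by (auto simp: slice_def)
    then show "st w = 0" using z w by auto
  qed
  have "run_circuit I ds (c1 @ c2) st x = (\<Sum>i<ds Sys. M2 $$ (x Sys, i) * run_circuit I ds c1 st (x(Sys := i)))"
    unfolding run_circuit_append
  proof (rule encodesD[OF 2 x(1)])
    show "x r = 0" if "r \<in> T2" for r using x(2) that by simp
    fix y r assume y: "y \<in> slice ds (insert Sys T2) x" "r \<in> T2" "y r \<noteq> 0"
    have "st (y(Sys := i)) = 0" if "i < ds Sys" for i
    proof -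
      have "y(Sys := i) \<in> slice ds (insert Sys (T1 \<union> T2)) x"
        using y(1) that by (auto simp: slice_def mem_basis)
      moreover have "(y(Sys := i)) r \<noteq> 0" using y 2 by (auto simp: encodes_def)
      ultimately show ?thesis using z y(2) by blast
    qed
    then show "run_circuit I ds c1 st y = 0" using st1[OF y(1)] by simp
  qed
  also have "\<dots> = (\<Sum>i<ds Sys. M2 $$ (x Sys, i) * (\<Sum>j<ds Sys. M1 $$ (i, j) * st (x(Sys := j))))"
  proof (rule sum.cong)
    fix i assume "i \<in> {..<ds Sys}"
    then have "x(Sys := i) \<in> slice ds (insert Sys T2) x" using x by (auto simp: slice_def mem_basis)
    from st1[OF this] show "M2 $$ (x Sys, i) * run_circuit I ds c1 st (x(Sys := i)) =
      M2 $$ (x Sys, i) * (\<Sum>j<ds Sys. M1 $$ (i, j) * st (x(Sys := j)))" by simp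
  qed simp
  also have "\<dots> = (\<Sum>j<ds Sys. (\<Sum>i<ds Sys. M2 $$ (x Sys, i) * M1 $$ (i, j)) * st (x(Sys := j)))"
    by (simp add: sum_distrib_left sum_distrib_right mult.assoc) (rule sum.swap)
  also have "\<dots> = (\<Sum>j<ds Sys. (M2 * M1) $$ (x Sys, j) * st (x(Sys := j)))"
    using n by (intro sum.cong) (simp_all add: mult_mat_index[OF M(2,1)] del: index_mult_mat)
  finally show "run_circuit I ds (c1 @ c2) st x = (\<Sum>i<ds Sys. (M2 * M1) $$ (x Sys, i) * st (x(Sys := i)))" .
qed

lemma iprod_delta:
  assumes "x \<in> basis ds"
  shows "iprod ds (\<lambda>y. if y = x then 1 else 0) b = b x"
proof -
  have "iprod ds (\<lambda>y. if y = x then 1 else 0) b = (\<Sum>y\<in>basis ds. if y = x then b y else 0)"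
    unfolding iprod_def by (intro sum.cong) auto
  then show ?thesis using assms by simp
qed

text \<open>The amplitude of the adjoint circuit at \<open>x\<close> is the inner product of the input with the image of the
  basis state \<open>x\<close>.\<close>

lemma encodes_adj:
  assumes 1: "encodes I ds c T M" and u: "unitary_circuit I ds c"
  shows "encodes I ds (adj_circuit c) T (mat_adjoint M)"
  unfolding encodes_def
proof (intro conjI allI ballI impI)
  have M: "M \<in> carrier_mat (ds Sys) (ds Sys)" and t: "touched c \<subseteq> insert Sys T" and sys: "Sys \<notin> T"
    using 1 by (auto simp: encodes_def)
  then show "mat_adjoint M \<in> carrier_mat (ds Sys) (ds Sys)" "touched (adj_circuit c) \<subseteq> insert Sys T" "Sys \<notin> T"
    by auto
  fix st :: state and x assume x: "x \<in> basis ds" "\<forall>r\<in>T. x r = 0"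
    and z: "\<forall>y\<in>slice ds (insert Sys T) x. (\<exists>r\<in>T. y r \<noteq> 0) \<longrightarrow> st y = 0"
  have n: "x Sys < ds Sys" using x by (simp add: mem_basis)
  let ?\<delta> = "\<lambda>y. if y = x then 1 else 0 :: complex"
  have "run_circuit I ds (adj_circuit c) st x = iprod ds ?\<delta> (run_circuit I ds (adj_circuit c) st)"
    using iprod_delta[OF x(1)] by simp
  also have "\<dots> = iprod ds (run_circuit I ds c ?\<delta>) st"
    using iprod_run_circuit[OF u] by simp
  also have "\<dots> = (\<Sum>y\<in>slice ds {Sys} x. cnj (run_circuit I ds c ?\<delta> y) * st y)"
    unfolding iprod_def
  proof (rule sum.mono_neutral_right)
    show "slice ds {Sys} x \<subseteq> basis ds" by (auto simp: slice_def)
    show "\<forall>y\<in>basis ds - slice ds {Sys} x. cnj (run_circuit I ds c ?\<delta> y) * st y = 0"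
    proof
      fix y assume y: "y \<in> basis ds - slice ds {Sys} x"
      show "cnj (run_circuit I ds c ?\<delta> y) * st y = 0"
      proof (cases "y \<in> slice ds (insert Sys T) x")
        case True
        then obtain r where "r \<noteq> Sys" "y r \<noteq> x r" using y by (auto simp: slice_def)
        then have "r \<in> T" "y r \<noteq> 0" using True x(2) by (auto simp: slice_def)
        then show ?thesis using z True by auto
      next
        case False
        have "run_circuit I ds c ?\<delta> y = 0"
        proof (rule run_circuit_slice_zero[OF _ t])
          fix w assume "w \<in> slice ds (insert Sys T) y"
          then have "w \<noteq> x" using False y by (auto simp: slice_def)
          then show "?\<delta> w = 0" by simp
        qed (use y in auto)
        then show ?thesis by simp
      qed
    qed
  qed simp
  also have "\<dots> = (\<Sum>i<ds Sys. cnj (run_circuit I ds c ?\<delta> (x(Sys := i))) * st (x(Sys := i)))"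
    by (rule sum.reindex_bij_betw[OF slice_single[OF x(1)], symmetric])
  also have "\<dots> = act ds (mat_adjoint M) st x"
  proof (rule sum.cong)
    fix i assume "i \<in> {..<ds Sys}"
    then have i: "i < ds Sys" by simp
    have "run_circuit I ds c ?\<delta> (x(Sys := i)) = (\<Sum>j<ds Sys. M $$ ((x(Sys := i)) Sys, j) * ?\<delta> ((x(Sys := i))(Sys := j)))"
    proof (rule encodesD[OF 1])
      show "x(Sys := i) \<in> basis ds" using x i by (auto simp: mem_basis)
      show "(x(Sys := i)) r = 0" if "r \<in> T" for r using that x(2) sys by auto
      show "?\<delta> y = 0" if "r \<in> T" "y r \<noteq> 0" for y r using that x(2) by auto
    qed
    also have "\<dots> = (\<Sum>j<ds Sys. if j = x Sys then M $$ (i, j) else 0)"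
      by (intro sum.cong) (auto simp: fun_eq_iff)
    also have "\<dots> = M $$ (i, x Sys)" using n by simp
    finally show "cnj (run_circuit I ds c ?\<delta> (x(Sys := i))) * st (x(Sys := i)) = mat_adjoint M $$ (x Sys, i) * st (x(Sys := i))"
      using i n M by simp
  qed simp
  finally show "run_circuit I ds (adj_circuit c) st x = act ds (mat_adjoint M) st x" .
qed

lemma hadamard_index [simp]: "hadamard_mat $$ (0, 0) = 1 / sqrt 2" "hadamard_mat $$ (0, Suc 0) = 1 / sqrt 2"
  "hadamard_mat $$ (Suc 0, 0) = 1 / sqrt 2" "hadamard_mat $$ (Suc 0, Suc 0) = - (1 / sqrt 2)"
  by (auto simp: hadamard_mat_def mat_of_rows_list_def)

lemma apply_hadamard:
  fixes st :: state
  assumes "x \<in> basis ds" "ds r = 2"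
  shows "apply_gate I ds (Gate [] (Fixed hadamard_mat) [r]) st x =
    complex_of_real (1 / sqrt 2) * (st (x(r := 0)) + (if x r = 0 then 1 else -1) * st (x(r := 1)))"
proof -
  have "x r < 2" using assms by (metis mem_basis)
  then consider "x r = 0" | "x r = Suc 0" by linarith
  then show ?thesis
    using assms by cases (simp_all add: apply_gate_single numeral_2_eq_2 algebra_simps)
qed

text \<open>Each of the two Hadamard gates contributes 1 / sqrt 2. Both circuits may share the
  ancillas \<open>T\<close>, since only one of them acts in each branch of the selection
  qubit.\<close>

lemma encodes_lcu:
  assumes 1: "encodes I ds c1 T M1" and 2: "encodes I ds c2 T M2" and s: "Lcu s \<notin> T" "ds (Lcu s) = 2"
  shows "encodes I ds (lcu_circuit s c1 c2) (insert (Lcu s) T) ((1 / 2) \<cdot>\<^sub>m (M1 + M2))"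
  unfolding encodes_def
proof (intro conjI allI ballI impI)
  have M: "M1 \<in> carrier_mat (ds Sys) (ds Sys)" "M2 \<in> carrier_mat (ds Sys) (ds Sys)"
    and sys: "Sys \<notin> T" and t: "touched c1 \<subseteq> insert Sys T" "touched c2 \<subseteq> insert Sys T"
    using 1 2 by (auto simp: encodes_def)
  then show "(1 / 2) \<cdot>\<^sub>m (M1 + M2) \<in> carrier_mat (ds Sys) (ds Sys)"
    "touched (lcu_circuit s c1 c2) \<subseteq> insert Sys (insert (Lcu s) T)" "Sys \<notin> insert (Lcu s) T"
    by (auto simp: lcu_circuit_def)
  fix st :: state and x assume x: "x \<in> basis ds" "\<forall>r\<in>insert (Lcu s) T. x r = 0"
    and z: "\<forall>y\<in>slice ds (insert Sys (insert (Lcu s) T)) x. (\<exists>r\<in>insert (Lcu s) T. y r \<noteq> 0) \<longrightarrow> st y = 0"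
  let ?H = "Gate [] (Fixed hadamard_mat) [Lcu s]"
  define st1 where "st1 = apply_gate I ds ?H st"
  define st2 where "st2 = run_circuit I ds (ctrl_circuit (Lcu s) 0 c1) st1"
  define st3 where "st3 = run_circuit I ds (ctrl_circuit (Lcu s) 1 c2) st2"
  have L: "Lcu s \<notin> touched c1" "Lcu s \<notin> touched c2" using t s by auto
  have n: "x Sys < ds Sys" using x by (simp add: mem_basis)
  have st1: "st1 y = 1 / sqrt 2 * st (y(Lcu s := 0))"
    if "y \<in> slice ds (insert Sys (insert (Lcu s) T)) x" for y
  proof -
    have "y(Lcu s := 1) \<in> slice ds (insert Sys (insert (Lcu s) T)) x"
      using that s by (auto simp: slice_def mem_basis)
    then have "st (y(Lcu s := 1)) = 0" using z by auto
    then show ?thesis unfolding st1_def using apply_hadamard[where r = "Lcu s", OF slice_basis[OF that] s(2), of I st] by simp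
  qed
  have b: "run_circuit I ds c st1 (x(Lcu s := v)) = 1 / sqrt 2 * act ds M st x"
    if "v < 2" "encodes I ds c T M" for v c M
  proof -
    have "run_circuit I ds c st1 (x(Lcu s := v)) = (\<Sum>i<ds Sys. M $$ ((x(Lcu s := v)) Sys, i) * st1 ((x(Lcu s := v))(Sys := i)))"
    proof (rule encodesD[OF that(2)])
      show "x(Lcu s := v) \<in> basis ds" using x s that by (auto simp: mem_basis)
      show "(x(Lcu s := v)) r = 0" if "r \<in> T" for r using x s that by auto
      fix y r assume y: "y \<in> slice ds (insert Sys T) (x(Lcu s := v))" "r \<in> T" "y r \<noteq> 0"
      have y': "y \<in> slice ds (insert Sys (insert (Lcu s) T)) x" using y by (auto simp: slice_def split: if_splits)
      moreover have "y(Lcu s := 0) \<in> slice ds (insert Sys (insert (Lcu s) T)) x"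
        using y' s by (auto simp: slice_def mem_basis)
      moreover have "(y(Lcu s := 0)) r \<noteq> 0" using y s by auto
      ultimately show "st1 y = 0" using z y(2) st1 by auto
    qed
    also have "\<dots> = (\<Sum>i<ds Sys. M $$ (x Sys, i) * (1 / sqrt 2 * st (x(Sys := i))))"
    proof (rule sum.cong)
      fix i assume i: "i \<in> {..<ds Sys}"
      have "(x(Lcu s := v))(Sys := i) \<in> slice ds (insert Sys (insert (Lcu s) T)) x"
        using x i that s by (auto simp: slice_def mem_basis)
      moreover have "(x(Lcu s := v, Sys := i))(Lcu s := 0) = x(Sys := i)"
        using x(2) by (auto simp: fun_eq_iff)
      ultimately show "M $$ ((x(Lcu s := v)) Sys, i) * st1 ((x(Lcu s := v))(Sys := i)) = M $$ (x Sys, i) * (1 / sqrt 2 * st (x(Sys := i)))"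
        using st1 by simp
    qed simp
    finally show ?thesis by (simp add: sum_distrib_left mult_ac)
  qed
  have bas: "x(Lcu s := v) \<in> basis ds" if "v < 2" for v
    using that x s by (auto simp: mem_basis)
  have 30: "st3 (x(Lcu s := 0)) = 1 / sqrt 2 * act ds M1 st x"
    unfolding st3_def st2_def using bas[of 0] b[of 0, OF _ 1] by (simp add: run_ctrl_circuit[OF L(2)] run_ctrl_circuit[OF L(1)])
  \<comment> \<open>In branch 1 the circuit \<open>c1\<close> has not acted, so its input
    \<open>st1\<close> is still in place there.\<close>
  have "run_circuit I ds c2 st2 (x(Lcu s := 1)) = run_circuit I ds c2 st1 (x(Lcu s := 1))"
  proof (rule run_circuit_cong[OF _ t(2)])
    fix y assume y: "y \<in> slice ds (insert Sys T) (x(Lcu s := 1))"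
    then have "y (Lcu s) = 1" using s by (auto simp: slice_def)
    then show "st2 y = st1 y" unfolding st2_def using slice_basis[OF y] by (simp add: run_ctrl_circuit[OF L(1)])
  qed (use bas in simp)
  then have 31: "st3 (x(Lcu s := 1)) = 1 / sqrt 2 * act ds M2 st x"
    unfolding st3_def using bas[of 1] b[of 1, OF _ 2] by (simp add: run_ctrl_circuit[OF L(2)])
  have "run_circuit I ds (lcu_circuit s c1 c2) st x = apply_gate I ds ?H st3 x"
    by (simp add: lcu_circuit_def st1_def st2_def st3_def)
  also have "\<dots> = 1 / sqrt 2 * (st3 (x(Lcu s := 0)) + st3 (x(Lcu s := 1)))"
    using x(2) apply_hadamard[where r = "Lcu s", OF x(1) s(2), of I st3] by simp
  also have "\<dots> = complex_of_real (1 / sqrt 2 * (1 / sqrt 2)) * (act ds M1 st x + act ds M2 st x)"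
    unfolding 30 31 of_real_mult by (simp only: of_real_divide of_real_1 algebra_simps)
  also have "1 / sqrt 2 * (1 / sqrt 2) = 1 / 2" by simp
  also have "complex_of_real (1 / 2) * (act ds M1 st x + act ds M2 st x)
    = (\<Sum>i<ds Sys. ((1 / 2) \<cdot>\<^sub>m (M1 + M2)) $$ (x Sys, i) * st (x(Sys := i)))"
    unfolding sum.distrib[symmetric] sum_distrib_left
    using n M by (intro sum.cong) (auto simp: algebra_simps)
  finally show "run_circuit I ds (lcu_circuit s c1 c2) st x = (\<Sum>i<ds Sys. ((1 / 2) \<cdot>\<^sub>m (M1 + M2)) $$ (x Sys, i) * st (x(Sys := i)))" .
qed

definition top_block :: "nat \<Rightarrow> complex mat \<Rightarrow> complex mat" where
  "top_block n U = mat n n (\<lambda>(i, j). U $$ (i, j))"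

text \<open>The ancilla is the more significant digit of the index, so its value 0 selects the first
  \<open>n\<close> rows and columns of the blackbox.\<close>

lemma encodes_query:
  assumes "ds Sys = n" "n > 0" "r \<noteq> Sys"
  shows "encodes I ds [Gate [] (Query q False) [r, Sys]] {r} (top_block n (I q))"
  unfolding encodes_def
proof (intro conjI allI ballI impI)
  fix st :: state and x assume x: "x \<in> basis ds" "\<forall>r\<in>{r}. x r = 0"
    and z: "\<forall>y\<in>slice ds (insert Sys {r}) x. (\<exists>r\<in>{r}. y r \<noteq> 0) \<longrightarrow> st y = 0"
  have n: "x Sys < n" using x assms by (auto simp: mem_basis)
  define f where "f k = (if k < n then st (x(Sys := k)) else 0)" for k
  have "apply_gate I ds (Gate [] (Query q False) [r, Sys]) st x =
    (\<Sum>k<total_dim ds [r, Sys]. oper_mat I (Query q False) $$ (reg_index ds [r, Sys] x, k) * f k)"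
  proof (rule apply_gate_index[OF x(1)])
    fix y assume y: "y \<in> slice ds (set [r, Sys]) x"
    then have lt: "y Sys < n" using assms by (auto simp: slice_def mem_basis)
    show "st y = f (reg_index ds [r, Sys] y)"
    proof (cases "y r = 0")
      case True
      have "y r' = x r'" if "r' \<noteq> Sys" for r'
        using True that y x(2) by (cases "r' = r") (auto simp: slice_def)
      then have "y = x(Sys := y Sys)" by (auto simp: fun_eq_iff)
      then show ?thesis using True lt by (simp add: f_def)
    next
      case False
      then have "n \<le> y r * n" by simp
      then have "\<not> y r * n + y Sys < n" by linarith
      moreover have "st y = 0" using z y False by (auto simp: insert_commute)
      ultimately show ?thesis using assms by (simp add: f_def)
    qed
  qed (use assms in auto)
  also have "\<dots> = (\<Sum>k<ds r * n. I q $$ (x Sys, k) * f k)"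
    using x assms by (simp add: total_dim_def)
  also have "\<dots> = (\<Sum>k<n. I q $$ (x Sys, k) * f k)"
  proof (rule sum.mono_neutral_right)
    have "ds r > 0" using x(1) by (metis mem_basis not_less_zero gr0I)
    then show "{..<n} \<subseteq> {..<ds r * n}" by (cases "ds r") auto
  qed (auto simp: f_def)
  finally show "run_circuit I ds [Gate [] (Query q False) [r, Sys]] st x =
    (\<Sum>i<ds Sys. top_block n (I q) $$ (x Sys, i) * st (x(Sys := i)))"
    using n assms by (simp add: top_block_def f_def)
qed (use assms in \<open>auto simp: top_block_def\<close>)

section \<open>The QSP circuit as a recursion of matrices\<close>

lemma not_index [simp]: "not_mat $$ (0, 0) = 0" "not_mat $$ (0, Suc 0) = 1"
  "not_mat $$ (Suc 0, 0) = 1" "not_mat $$ (Suc 0, Suc 0) = 0"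
  by (auto simp: not_mat_def mat_of_rows_list_def)

lemma bit_cases: "x \<in> basis ds \<Longrightarrow> ds r = 2 \<Longrightarrow> x r = 0 \<or> x r = Suc 0"
  by (metis mem_basis less_2_cases One_nat_def)

lemma apply_not:
  assumes "x \<in> basis ds" "ds r = 2"
  shows "apply_gate I ds (Gate [(q, 0)] (Fixed not_mat) [r]) st x = (if x q = 0 then st (x(r := 1 - x r)) else st x)"
  using bit_cases[OF assms] assms by (auto simp: apply_gate_single numeral_2_eq_2)

lemma apply_zrot:
  assumes "x \<in> basis ds" "ds r = 2"
  shows "apply_gate I ds (Gate [] (Fixed (zrot \<phi>)) [r]) st x = cis (if x r = 0 then \<phi> else - \<phi>) * st x"
proof -
  have "x(r := 0) = x" if "x r = 0" using that by auto
  moreover have "x(r := Suc 0) = x" if "x r = Suc 0" using that by auto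
  ultimately show ?thesis
    using bit_cases[OF assms] assms by (auto simp: apply_gate_single numeral_2_eq_2)
qed

text \<open>Conjugation by the controlled NOT turns the rotation of \<open>r\<close> into a phase:
  with \<open>r\<close> at zero, it is \<phi> where \<open>q\<close> is zero and -\<phi> elsewhere.
  The flip also explains the negated angle in the circuit.\<close>

lemma apply_phase:
  assumes "x \<in> basis ds" "ds r = 2" "q \<noteq> r"
  shows "run_circuit I ds [Gate [(q, 0)] (Fixed not_mat) [r], Gate [] (Fixed (zrot (- \<phi>))) [r],
      Gate [(q, 0)] (Fixed not_mat) [r]] st x = cis (if (x q = 0) = (x r = 0) then \<phi> else - \<phi>) * st x"
proof -
  have b: "x(r := 1 - x r) \<in> basis ds" using assms by (auto simp: mem_basis)
  have e: "x(r := v) = x" if "x r = v" for v using that by auto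
  show ?thesis
    using bit_cases[OF assms(1,2)] assms b
    by (auto simp: e apply_not[where r = r] apply_zrot[where r = r])
qed

text \<open>Here \<open>D = 2 ^ a * n\<close> is the joint dimension of ancillas and system. The system is the less significant
  factor, so the ancillas are zero exactly at the indices below \<open>n\<close>.\<close>

definition anc_embed :: "nat \<Rightarrow> nat \<Rightarrow> complex mat" where
  "anc_embed D n = mat D n (\<lambda>(i, j). if i = j then 1 else 0)"

definition phase_mat :: "nat \<Rightarrow> nat \<Rightarrow> real \<Rightarrow> complex mat" where
  "phase_mat D n \<phi> = mat D D (\<lambda>(i, j). if i = j then (if i < n then cis \<phi> else cis (- \<phi>)) else 0)"

text \<open>The first \<open>n\<close> columns of the circuit unitary, that is, its action on inputs
  with zero ancillas. For odd \<open>k\<close> the step \<open>Suc k\<close> is even, hence the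
  adjoint.\<close>

fun qsp_state :: "nat \<Rightarrow> nat \<Rightarrow> complex mat \<Rightarrow> (nat \<Rightarrow> real) \<Rightarrow> nat \<Rightarrow> complex mat" where
  "qsp_state D n U \<Phi> 0 = anc_embed D n"
| "qsp_state D n U \<Phi> (Suc k) = phase_mat D n (\<Phi> (Suc k)) * ((if odd k then mat_adjoint U else U) * qsp_state D n U \<Phi> k)"

lemma anc_embed_carrier [simp]: "anc_embed D n \<in> carrier_mat D n"
  by (simp add: anc_embed_def)

lemma phase_mat_carrier [simp]: "phase_mat D n \<phi> \<in> carrier_mat D D"
  by (simp add: phase_mat_def)

lemma qsp_state_carrier [simp]: "U \<in> carrier_mat D D \<Longrightarrow> qsp_state D n U \<Phi> k \<in> carrier_mat D n"
  by (induction k) (auto intro!: mult_carrier_mat[of _ D D])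

lemma phase_mult_index:
  assumes "M \<in> carrier_mat D m" "i < D" "j < m"
  shows "(phase_mat D n \<phi> * M) $$ (i, j) = (if i < n then cis \<phi> else cis (- \<phi>)) * M $$ (i, j)"
proof -
  have "(phase_mat D n \<phi> * M) $$ (i, j) = (\<Sum>l<D. phase_mat D n \<phi> $$ (i, l) * M $$ (l, j))"
    by (rule mult_mat_index[OF phase_mat_carrier assms])
  also have "\<dots> = (\<Sum>l<D. if l = i then (if i < n then cis \<phi> else cis (- \<phi>)) * M $$ (l, j) else 0)"
    using assms(2) by (intro sum.cong) (auto simp: phase_mat_def)
  finally show ?thesis using assms(2) by simp
qed

lemma qsp_circuit_0 [simp]: "qsp_circuit s 0 \<Phi> = []"
  by (simp add: qsp_circuit_def)

lemma qsp_circuit_Suc [simp]: "qsp_circuit s (Suc k) \<Phi> = qsp_circuit s k \<Phi> @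
     [Gate [] (Query OrA (odd k)) [AncA s, Sys],
      Gate [(AncA s, 0)] (Fixed not_mat) [Rot s],
      Gate [] (Fixed (zrot (- \<Phi> (Suc k)))) [Rot s],
      Gate [(AncA s, 0)] (Fixed not_mat) [Rot s]]"
  by (simp add: qsp_circuit_def)

text \<open>The label \<open>x\<close> with zero ancillas stays fixed while \<open>y\<close> runs
  over its slice: the induction has to track the amplitudes with nonzero block-encoding ancillas as
  well, because the next query mixes them in. The rotation ancilla remains zero after each
  step.\<close>

lemma run_qsp_circuit:
  assumes ds: "ds Sys = n" "ds (Rot s) = 2" and D: "ds (AncA s) * n = D"
    and U: "I OrA \<in> carrier_mat D D"
    and x: "x \<in> basis ds" "x (Rot s) = 0" "x (AncA s) = 0"
    and z: "\<And>y. y \<in> slice ds {Rot s, AncA s, Sys} x \<Longrightarrow> y (Rot s) \<noteq> 0 \<or> y (AncA s) \<noteq> 0 \<Longrightarrow> st y = 0"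
    and y: "y \<in> slice ds {Rot s, AncA s, Sys} x"
  shows "run_circuit I ds (qsp_circuit s k \<Phi>) st y = (if y (Rot s) = 0
    then \<Sum>i<n. qsp_state D n (I OrA) \<Phi> k $$ (y (AncA s) * n + y Sys, i) * st (x(Sys := i)) else 0)"
  using y
proof (induction k arbitrary: y)
  case 0
  have lt: "y Sys < n" "y (AncA s) < ds (AncA s)" using slice_basis[OF 0] ds by (auto simp: mem_basis)
  have bd: "y (AncA s) * n + y Sys < D" using mixed_radix_less[OF lt(2,1)] D by simp
  have *: "(\<Sum>i<n. anc_embed D n $$ (y (AncA s) * n + y Sys, i) * st (x(Sys := i)))
    = (\<Sum>i<n. if i = y (AncA s) * n + y Sys then st (x(Sys := i)) else 0)"
    using bd by (intro sum.cong) (auto simp: anc_embed_def)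
  show ?case
  proof (cases "y (Rot s) = 0 \<and> y (AncA s) = 0")
    case True
    have "y r = x r" if "r \<noteq> Sys" for r
      using 0 True x that by (cases "r = Rot s \<or> r = AncA s") (auto simp: slice_def)
    then have "y = x(Sys := y Sys)" by (auto simp: fun_eq_iff)
    then show ?thesis using True lt * by simp
  next
    case False
    then have "st y = 0" using z[OF 0] by auto
    moreover have "(\<Sum>i<n. if i = y (AncA s) * n + y Sys then st (x(Sys := i)) else 0) = 0" if "y (AncA s) \<noteq> 0"
    proof -
      have "n \<le> y (AncA s) * n" using that by simp
      then have "\<not> y (AncA s) * n + y Sys < n" by linarith
      then show ?thesis by simp
    qed
    ultimately show ?thesis using False * by auto
  qed
next
  case (Suc k)
  let ?S = "qsp_state D n (I OrA) \<Phi> k" and ?B = "if odd k then mat_adjoint (I OrA) else I OrA"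
  let ?st = "run_circuit I ds (qsp_circuit s k \<Phi>) st"
  let ?q = "apply_gate I ds (Gate [] (Query OrA (odd k)) [AncA s, Sys]) ?st"
  let ?T = "{Rot s, AncA s, Sys}" and ?i = "y (AncA s) * n + y Sys"
  have lt: "y Sys < n" "y (AncA s) < ds (AncA s)" using slice_basis[OF Suc.prems] ds by (auto simp: mem_basis)
  have bd: "?i < D" using mixed_radix_less[OF lt(2,1)] D by simp
  have B: "?B \<in> carrier_mat D D" using U by simp
  have S: "?S \<in> carrier_mat D n" using U by simp
  have td: "total_dim ds [AncA s, Sys] = D" using ds D by (simp add: total_dim_def)
  have "?q y =
     (\<Sum>l<D. ?B $$ (?i, l) * (if y (Rot s) = 0 then \<Sum>i<n. ?S $$ (l, i) * st (x(Sys := i)) else 0))"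
  proof -
    have "?q y =
     (\<Sum>l<total_dim ds [AncA s, Sys]. oper_mat I (Query OrA (odd k)) $$ (reg_index ds [AncA s, Sys] y, l) * (if y (Rot s) = 0 then \<Sum>i<n. ?S $$ (l, i) * st (x(Sys := i)) else 0))"
    proof (rule apply_gate_index[OF slice_basis[OF Suc.prems]])
      fix w assume w: "w \<in> slice ds (set [AncA s, Sys]) y"
      then have "w \<in> slice ds ?T x" using Suc.prems by (auto simp: slice_def)
      from Suc.IH[OF this] w show "?st w = (if y (Rot s) = 0
        then \<Sum>i<n. ?S $$ (reg_index ds [AncA s, Sys] w, i) * st (x(Sys := i)) else 0)"
        using ds by (simp add: slice_def)
    qed simp
    then show ?thesis unfolding td using ds by simp
  qed
  also have "\<dots> = (if y (Rot s) = 0 then \<Sum>i<n. (?B * ?S) $$ (?i, i) * st (x(Sys := i)) else 0)"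
  proof (cases "y (Rot s) = 0")
    case True
    have "(\<Sum>l<D. ?B $$ (?i, l) * (\<Sum>i<n. ?S $$ (l, i) * st (x(Sys := i))))
      = (\<Sum>i<n. (\<Sum>l<D. ?B $$ (?i, l) * ?S $$ (l, i)) * st (x(Sys := i)))"
      unfolding sum_distrib_left sum_distrib_right mult.assoc by (rule sum.swap)
    also have "\<dots> = (\<Sum>i<n. (?B * ?S) $$ (?i, i) * st (x(Sys := i)))"
      using bd by (intro sum.cong) (simp_all add: mult_mat_index[OF B S] del: index_mult_mat)
    finally show ?thesis using True by simp
  qed simp
  finally have q: "?q y =
    (if y (Rot s) = 0 then \<Sum>i<n. (?B * ?S) $$ (?i, i) * st (x(Sys := i)) else 0)" .
  have BS: "?B * ?S \<in> carrier_mat D n" using B S by (rule mult_carrier_mat)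
  have top: "?i < n \<longleftrightarrow> y (AncA s) = 0"
    using lt by (cases "y (AncA s)") auto
  have "run_circuit I ds (qsp_circuit s (Suc k) \<Phi>) st y = cis (if (y (AncA s) = 0) = (y (Rot s) = 0) then \<Phi> (Suc k) else - \<Phi> (Suc k)) *
     ?q y"
    using apply_phase[OF slice_basis[OF Suc.prems], of "Rot s" "AncA s" I "\<Phi> (Suc k)"
      "?q"] ds
    by simp
  also have "\<dots> = (if y (Rot s) = 0 then \<Sum>i<n. (phase_mat D n (\<Phi> (Suc k)) * (?B * ?S)) $$ (?i, i) * st (x(Sys := i)) else 0)"
    unfolding q using bd
    by (auto simp: phase_mult_index[OF BS] sum_distrib_left top mult.assoc simp del: index_mult_mat intro!: sum.cong)
  finally show ?case by (simp only: qsp_state.simps)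
qed

lemma touched_qsp_circuit: "touched (qsp_circuit s k \<Phi>) \<subseteq> {Rot s, AncA s, Sys}"
  by (induction k) auto

lemma encodes_qsp:
  assumes "ds Sys = n" "ds (Rot s) = 2" "ds (AncA s) * n = D" "I OrA \<in> carrier_mat D D"
  shows "encodes I ds (qsp_circuit s k \<Phi>) {Rot s, AncA s} (top_block n (qsp_state D n (I OrA) \<Phi> k))"
  unfolding encodes_def
proof (intro conjI allI ballI impI)
  show "touched (qsp_circuit s k \<Phi>) \<subseteq> insert Sys {Rot s, AncA s}"
    using touched_qsp_circuit by auto
  fix st :: state and x assume x: "x \<in> basis ds" "\<forall>r\<in>{Rot s, AncA s}. x r = 0"
    and z: "\<forall>y\<in>slice ds (insert Sys {Rot s, AncA s}) x. (\<exists>r\<in>{Rot s, AncA s}. y r \<noteq> 0) \<longrightarrow> st y = 0"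
  have "insert Sys {Rot s, AncA s} = {Rot s, AncA s, Sys}" by auto
  with z have z': "st y = 0" if "y \<in> slice ds {Rot s, AncA s, Sys} x" "y (Rot s) \<noteq> 0 \<or> y (AncA s) \<noteq> 0" for y
    using that by auto
  have "x Sys < n" using x assms by (auto simp: mem_basis)
  then show "run_circuit I ds (qsp_circuit s k \<Phi>) st x =
    (\<Sum>i<ds Sys. top_block n (qsp_state D n (I OrA) \<Phi> k) $$ (x Sys, i) * st (x(Sys := i)))"
    using run_qsp_circuit[where s = s and I = I and k = k and \<Phi> = \<Phi>, OF assms x(1) _ _ _ slice_self[OF x(1)], of st] z' x(2) assms(1)
    by (auto simp: top_block_def)
qed (use assms in \<open>auto simp: top_block_def\<close>)

section \<open>The polynomial implemented by the QSP circuit\<close>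

definition cmat_poly :: "complex poly \<Rightarrow> complex mat \<Rightarrow> complex mat" where
  "cmat_poly P A = mat (dim_row A) (dim_row A) (\<lambda>(i, j). \<Sum>k\<le>degree P. coeff P k * (A ^\<^sub>m k) $$ (i, j))"

lemma cmat_poly_carrier [simp]: "A \<in> carrier_mat n n \<Longrightarrow> cmat_poly P A \<in> carrier_mat n n"
  by (simp add: cmat_poly_def)

lemma cmat_poly_dim [simp]: "dim_row (cmat_poly P A) = dim_row A" "dim_col (cmat_poly P A) = dim_row A"
  by (simp_all add: cmat_poly_def)

lemma cmat_poly_index:
  assumes "i < dim_row A" "j < dim_row A" "degree P \<le> N"
  shows "cmat_poly P A $$ (i, j) = (\<Sum>k\<le>N. coeff P k * (A ^\<^sub>m k) $$ (i, j))"
proof -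
  have "cmat_poly P A $$ (i, j) = (\<Sum>k\<le>degree P. coeff P k * (A ^\<^sub>m k) $$ (i, j))"
    using assms by (simp add: cmat_poly_def)
  also have "\<dots> = (\<Sum>k\<le>N. coeff P k * (A ^\<^sub>m k) $$ (i, j))"
    using assms(3) by (intro sum.mono_neutral_left) (auto simp: coeff_eq_0)
  finally show ?thesis .
qed

lemma pow_mat_comm: "A \<in> carrier_mat n n \<Longrightarrow> A * A ^\<^sub>m k = A ^\<^sub>m k * (A :: 'a::semiring_1 mat)"
proof (induction k)
  case 0
  then show ?case by (simp add: right_mult_one_mat left_mult_one_mat)
next
  case (Suc k)
  then have p: "A ^\<^sub>m k \<in> carrier_mat n n" by (simp add: pow_carrier_mat)
  have "A * (A ^\<^sub>m k * A) = (A * A ^\<^sub>m k) * A" by (rule assoc_mult_mat[symmetric, OF Suc.prems p Suc.prems])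
  then show ?case using Suc by simp
qed

lemma cmat_poly_pCons_0:
  assumes A: "A \<in> carrier_mat n n"
  shows "cmat_poly (pCons 0 P) A = A * cmat_poly P A"
proof (rule eq_matI)
  fix i j assume "i < dim_row (A * cmat_poly P A)" "j < dim_col (A * cmat_poly P A)"
  then have ij: "i < n" "j < n" using A by auto
  have dr: "dim_row A = n" using A by auto
  have d: "degree (pCons 0 P) \<le> Suc (degree P)" by (simp add: degree_pCons_le)
  have p: "A ^\<^sub>m k \<in> carrier_mat n n" for k using A by (simp add: pow_carrier_mat)
  have "cmat_poly (pCons 0 P) A $$ (i, j) = (\<Sum>k\<le>Suc (degree P). coeff (pCons 0 P) k * (A ^\<^sub>m k) $$ (i, j))"
    using ij dr d by (intro cmat_poly_index) auto
  also have "\<dots> = (\<Sum>k\<le>degree P. coeff P k * (A ^\<^sub>m Suc k) $$ (i, j))"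
    by (subst sum.atMost_Suc_shift) simp
  also have "\<dots> = (\<Sum>k\<le>degree P. coeff P k * (\<Sum>l<n. A $$ (i, l) * (A ^\<^sub>m k) $$ (l, j)))"
    using ij by (simp add: pow_mat_comm[OF A, symmetric] mult_mat_index[OF A p] del: index_mult_mat)
  also have "\<dots> = (\<Sum>l<n. A $$ (i, l) * (\<Sum>k\<le>degree P. coeff P k * (A ^\<^sub>m k) $$ (l, j)))"
    unfolding sum_distrib_left by (subst sum.swap) (simp add: mult_ac)
  also have "\<dots> = (\<Sum>l<n. A $$ (i, l) * cmat_poly P A $$ (l, j))"
    using ij dr by (intro sum.cong) (auto simp: cmat_poly_def)
  also have "\<dots> = (A * cmat_poly P A) $$ (i, j)"
    using ij A by (simp add: mult_mat_index[OF A cmat_poly_carrier[OF A]] del: index_mult_mat)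
  finally show "cmat_poly (pCons 0 P) A $$ (i, j) = (A * cmat_poly P A) $$ (i, j)" .
qed (use A in auto)

lemma cmat_poly_add: "cmat_poly (P + Q) A = cmat_poly P A + cmat_poly Q A"
proof (rule eq_matI)
  fix i j assume "i < dim_row (cmat_poly P A + cmat_poly Q A)" "j < dim_col (cmat_poly P A + cmat_poly Q A)"
  then have ij: "i < dim_row A" "j < dim_row A" by auto
  let ?N = "max (degree P) (degree Q)"
  show "cmat_poly (P + Q) A $$ (i, j) = (cmat_poly P A + cmat_poly Q A) $$ (i, j)"
    using ij by (simp add: cmat_poly_index[OF ij, of _ ?N] degree_add_le sum.distrib distrib_right)
qed auto

lemma cmat_poly_smult: "cmat_poly (Polynomial.smult c P) A = c \<cdot>\<^sub>m cmat_poly P A"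
proof (rule eq_matI)
  fix i j assume "i < dim_row (c \<cdot>\<^sub>m cmat_poly P A)" "j < dim_col (c \<cdot>\<^sub>m cmat_poly P A)"
  then have ij: "i < dim_row A" "j < dim_row A" by auto
  show "cmat_poly (Polynomial.smult c P) A $$ (i, j) = (c \<cdot>\<^sub>m cmat_poly P A) $$ (i, j)"
    using ij by (simp add: cmat_poly_index[OF ij, of _ "degree P"] degree_smult_le sum_distrib_left mult.assoc)
qed auto

lemma cmat_poly_diff: "cmat_poly (P - Q) A = cmat_poly P A - cmat_poly Q A"
proof (rule eq_matI)
  fix i j assume "i < dim_row (cmat_poly P A - cmat_poly Q A)" "j < dim_col (cmat_poly P A - cmat_poly Q A)"
  then have ij: "i < dim_row A" "j < dim_row A" by auto
  let ?N = "max (degree P) (degree Q)"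
  show "cmat_poly (P - Q) A $$ (i, j) = (cmat_poly P A - cmat_poly Q A) $$ (i, j)"
    using ij by (simp add: cmat_poly_index[OF ij, of _ ?N] degree_diff_le sum_subtractf left_diff_distrib)
qed auto

lemma cmat_poly_0: "A \<in> carrier_mat n n \<Longrightarrow> cmat_poly 0 A = 0\<^sub>m n n"
  by (rule eq_matI) (auto simp: cmat_poly_def)

lemma cmat_poly_1: "A \<in> carrier_mat n n \<Longrightarrow> cmat_poly 1 A = 1\<^sub>m n"
  by (rule eq_matI) (auto simp: cmat_poly_def)

lemma mat_adjoint_mult:
  assumes "A \<in> carrier_mat m k" "B \<in> carrier_mat k (n :: nat)"
  shows "mat_adjoint (A * B) = mat_adjoint B * mat_adjoint (A :: complex mat)"
proof (rule eq_matI)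
  fix i j assume "i < dim_row (mat_adjoint B * mat_adjoint A)" "j < dim_col (mat_adjoint B * mat_adjoint A)"
  then have ij: "i < n" "j < m" using assms by auto
  have "mat_adjoint (A * B) $$ (i, j) = cnj (\<Sum>l<k. A $$ (j, l) * B $$ (l, i))"
    using ij assms by (subst mult_mat_index[OF assms, symmetric]) (auto simp del: index_mult_mat(1))
  also have "\<dots> = (\<Sum>l<k. mat_adjoint B $$ (i, l) * mat_adjoint A $$ (l, j))"
    using ij assms by (auto simp: mult.commute intro!: sum.cong)
  also have "\<dots> = (mat_adjoint B * mat_adjoint A) $$ (i, j)"
    using ij assms by (intro mult_mat_index[symmetric]) auto
  finally show "mat_adjoint (A * B) $$ (i, j) = (mat_adjoint B * mat_adjoint A) $$ (i, j)" .
qed (use assms in auto)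

lemma hermitian_pow:
  assumes "A \<in> carrier_mat n n" "mat_adjoint A = (A :: complex mat)"
  shows "mat_adjoint (A ^\<^sub>m k) = A ^\<^sub>m k"
proof (induction k)
  case 0
  show ?case by (rule eq_matI) auto
next
  case (Suc k)
  have "mat_adjoint (A ^\<^sub>m k * A) = A * A ^\<^sub>m k"
    using mat_adjoint_mult[of "A ^\<^sub>m k" n n A n] assms Suc by (simp add: pow_carrier_mat)
  then show ?case using pow_mat_comm[OF assms(1)] by simp
qed

lemma degree_cnj_poly [simp]: "degree (cnj_poly P) = degree P"
  unfolding cnj_poly_def by (rule degree_map_poly) auto

lemma cmat_poly_adjoint:
  assumes A: "A \<in> carrier_mat n n" "mat_adjoint A = A"
  shows "mat_adjoint (cmat_poly P A) = cmat_poly (cnj_poly P) A"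
proof (rule eq_matI)
  fix i j assume "i < dim_row (cmat_poly (cnj_poly P) A)" "j < dim_col (cmat_poly (cnj_poly P) A)"
  then have ij: "i < n" "j < n" "i < dim_row A" "j < dim_row A" using A by auto
  have "cnj ((A ^\<^sub>m k) $$ (j, i)) = (A ^\<^sub>m k) $$ (i, j)" for k
  proof -
    have p: "A ^\<^sub>m k \<in> carrier_mat n n" using A by (simp add: pow_carrier_mat)
    have "(A ^\<^sub>m k) $$ (i, j) = mat_adjoint (A ^\<^sub>m k) $$ (i, j)" using hermitian_pow[OF A] by simp
    then show ?thesis using carrier_matD[OF p] ij by simp
  qed
  then show "mat_adjoint (cmat_poly P A) $$ (i, j) = cmat_poly (cnj_poly P) A $$ (i, j)"
    using ij by (simp add: cmat_poly_index[OF ij(3,4), of _ "degree P"] cmat_poly_index[OF ij(4,3), of _ "degree P"])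
qed (use A in auto)

text \<open>The factor sqrt(1 - x^2) of the lower entry is left out of the second component, which
  keeps both components polynomial.\<close>

fun qsp_polys :: "(nat \<Rightarrow> real) \<Rightarrow> nat \<Rightarrow> complex poly \<times> complex poly" where
  "qsp_polys \<Phi> 0 = (1, 0)"
| "qsp_polys \<Phi> (Suc k) = (case qsp_polys \<Phi> k of (P, Q) \<Rightarrow>
     (Polynomial.smult (cis (\<Phi> (Suc k))) (pCons 0 P + (Q - pCons 0 (pCons 0 Q))),
      Polynomial.smult (cis (- \<Phi> (Suc k))) (P - pCons 0 Q)))"

lemma mat_rearrange:
  assumes "p \<in> carrier_mat D n" "q \<in> carrier_mat D n" "r \<in> carrier_mat D n" "s \<in> carrier_mat D n" "t \<in> carrier_mat D n"
  shows "p + q + (r - (s + t)) = q + (r - t) + (p - (s :: complex mat))"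
  by (rule eq_matI) (use assms in auto)

text \<open>One step of the recursion for \<open>state = V P(A) + W Q(A)\<close>, where \<open>W = G V - V A\<close> is the part that leaves
  the ancilla-zero space. Only \<open>B G = 1\<close> enters, so no spectral decomposition of \<open>A\<close> is needed.\<close>

lemma mat_cancel_aux:
  assumes B: "B \<in> carrier_mat D D" and G: "G \<in> carrier_mat D D" and inv: "B * G = 1\<^sub>m D"
    and V: "V \<in> carrier_mat D n" and A: "A \<in> carrier_mat n n" and X: "X \<in> carrier_mat n n" and Y: "Y \<in> carrier_mat n (n::nat)"
  shows "B * (V * X + (G * V - V * A) * Y) = V * (A * X + (Y - A * (A * Y))) + (B * V - V * A) * (X - A * (Y :: complex mat))"
proof -
  define W where "W = B * V - V * A"
  note m = mult_carrier_mat
  have VA: "V * A \<in> carrier_mat D n" by (rule m[OF V A])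
  have W: "W \<in> carrier_mat D n" unfolding W_def by (rule minus_carrier_mat[OF VA])
  have BVc: "B * V \<in> carrier_mat D n" by (rule m[OF B V])
  have BV: "B * V = W + V * A" unfolding W_def
    by (rule eq_matI) (use carrier_matD[OF BVc] carrier_matD[OF VA] in \<open>auto simp del: index_mult_mat\<close>)
  note GV = m[OF G V] and AX = m[OF A X] and AY = m[OF A Y] and VX = m[OF V X] and VY = m[OF V Y]
  note AAY = m[OF A AY] and WX = m[OF W X] and WAY = m[OF W AY] and VAY = m[OF V AY] and VAX = m[OF V AX]
  note VAAY = m[OF V AAY] and GVY = m[OF GV Y]
  have GVA: "G * V - V * A \<in> carrier_mat D n" by (rule minus_carrier_mat[OF VA])
  have "B * (V * X + (G * V - V * A) * Y) = B * (V * X) + B * ((G * V - V * A) * Y)"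
    by (rule mult_add_distrib_mat[OF B VX m[OF GVA Y]])
  also have "B * (V * X) = W * X + V * (A * X)"
    unfolding assoc_mult_mat[OF B V X, symmetric] BV add_mult_distrib_mat[OF W VA X] assoc_mult_mat[OF V A X] ..
  also have "B * ((G * V - V * A) * Y) = V * Y - (W * (A * Y) + V * (A * (A * Y)))"
  proof -
    have "(G * V - V * A) * Y = G * V * Y - V * (A * Y)"
      unfolding minus_mult_distrib_mat[OF GV VA Y] assoc_mult_mat[OF V A Y] ..
    also have "B * (G * V * Y - V * (A * Y)) = B * (G * V * Y) - B * (V * (A * Y))"
      by (rule mult_minus_distrib_mat[OF B GVY VAY])
    also have "B * (G * V * Y) = V * Y"
      unfolding assoc_mult_mat[OF B GV Y, symmetric] assoc_mult_mat[OF B G V, symmetric] inv left_mult_one_mat[OF V] ..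
    also have "B * (V * (A * Y)) = W * (A * Y) + V * (A * (A * Y))"
      unfolding assoc_mult_mat[OF B V AY, symmetric] BV add_mult_distrib_mat[OF W VA AY] assoc_mult_mat[OF V A AY] ..
    finally show ?thesis .
  qed
  also have "W * X + V * (A * X) + (V * Y - (W * (A * Y) + V * (A * (A * Y)))) =
    V * (A * X) + (V * Y - V * (A * (A * Y))) + (W * X - W * (A * Y))"
    by (rule mat_rearrange[OF WX VAX VY WAY VAAY])
  also have "V * Y - V * (A * (A * Y)) = V * (Y - A * (A * Y))"
    by (rule mult_minus_distrib_mat[OF V Y AAY, symmetric])
  also have "V * (A * X) + V * (Y - A * (A * Y)) = V * (A * X + (Y - A * (A * Y)))"
    by (rule mult_add_distrib_mat[OF V AX minus_carrier_mat[OF AAY], symmetric])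
  also have "W * X - W * (A * Y) = W * (X - A * Y)"
    by (rule mult_minus_distrib_mat[OF W X AY, symmetric])
  finally show ?thesis by (simp only: W_def)
qed

lemma embed_mult_index:
  assumes "M \<in> carrier_mat n m" "i < D" "j < m" "n \<le> D"
  shows "(anc_embed D n * M) $$ (i, j) = (if i < n then M $$ (i, j) else 0)"
proof -
  have "(anc_embed D n * M) $$ (i, j) = (\<Sum>l<n. anc_embed D n $$ (i, l) * M $$ (l, j))"
    by (rule mult_mat_index[OF anc_embed_carrier assms(1-3)])
  also have "\<dots> = (\<Sum>l<n. if l = i then M $$ (l, j) else 0)"
    using assms by (intro sum.cong) (auto simp: anc_embed_def)
  finally show ?thesis by simp
qed

lemma mult_embed_index:
  assumes "B \<in> carrier_mat m D" "i < m" "j < n" "n \<le> D"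
  shows "(B * anc_embed D n) $$ (i, j) = B $$ (i, j)"
proof -
  have "(B * anc_embed D n) $$ (i, j) = (\<Sum>l<D. B $$ (i, l) * anc_embed D n $$ (l, j))"
    by (rule mult_mat_index[OF assms(1) anc_embed_carrier assms(2,3)])
  also have "\<dots> = (\<Sum>l<D. if l = j then B $$ (i, l) else 0)"
    using assms by (intro sum.cong) (auto simp: anc_embed_def)
  finally show ?thesis using assms by simp
qed

lemma zero_rows_mult:
  assumes "W \<in> carrier_mat D n" "Z \<in> carrier_mat n n" "n \<le> D" "i < n" "j < n"
    and "\<And>i j. i < n \<Longrightarrow> j < n \<Longrightarrow> W $$ (i, j) = 0"
  shows "(W * Z) $$ (i, j) = 0"
  using assms by (simp add: mult_mat_index[OF assms(1,2)] del: index_mult_mat)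

text \<open>The first summand lives where the ancillas are zero and the second one, by the vanishing
  rows of \<open>W\<close>, where they are not; the phase matrix therefore multiplies them by
  opposite phases.\<close>

lemma phase_split:
  assumes "X \<in> carrier_mat n n" "W \<in> carrier_mat D n" "Y \<in> carrier_mat n n" "n \<le> D"
    and "\<And>i j. i < n \<Longrightarrow> j < n \<Longrightarrow> W $$ (i, j) = 0"
  shows "phase_mat D n \<phi> * (anc_embed D n * X + W * Y) = anc_embed D n * (cis \<phi> \<cdot>\<^sub>m X) + W * (cis (- \<phi>) \<cdot>\<^sub>m Y)"
proof (rule eq_matI)
  fix i j assume "i < dim_row (anc_embed D n * (cis \<phi> \<cdot>\<^sub>m X) + W * (cis (- \<phi>) \<cdot>\<^sub>m Y))"
    "j < dim_col (anc_embed D n * (cis \<phi> \<cdot>\<^sub>m X) + W * (cis (- \<phi>) \<cdot>\<^sub>m Y))"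
  then have ij: "i < D" "j < n" using assms by auto
  have c: "anc_embed D n * X + W * Y \<in> carrier_mat D n" using assms by auto
  have Y: "cis (- \<phi>) \<cdot>\<^sub>m Y \<in> carrier_mat n n" and X: "cis \<phi> \<cdot>\<^sub>m X \<in> carrier_mat n n" using assms by auto
  have w0: "(W * Z) $$ (i, j) = 0" if "Z \<in> carrier_mat n n" "i < n" for Z
    by (rule zero_rows_mult[OF assms(2) that(1) assms(4) that(2) ij(2) assms(5)])
  have wc: "(W * (cis (- \<phi>) \<cdot>\<^sub>m Y)) $$ (i, j) = cis (- \<phi>) * (W * Y) $$ (i, j)"
    using ij assms(2,3) by (simp add: mult_smult_distrib[OF assms(2,3)])
  show "(phase_mat D n \<phi> * (anc_embed D n * X + W * Y)) $$ (i, j) =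
    (anc_embed D n * (cis \<phi> \<cdot>\<^sub>m X) + W * (cis (- \<phi>) \<cdot>\<^sub>m Y)) $$ (i, j)"
  proof (cases "i < n")
    case True
    then show ?thesis using ij assms(1-4)
      by (simp add: phase_mult_index[OF c] embed_mult_index[OF assms(1)] embed_mult_index[OF X] w0[OF assms(3)] w0[OF Y] del: index_mult_mat(1))
  next
    case False
    then show ?thesis using ij assms(1-4) wc
      by (simp add: phase_mult_index[OF c] embed_mult_index[OF assms(1)] embed_mult_index[OF X] del: index_mult_mat(1))
  qed
qed (use assms carrier_matD[OF phase_mat_carrier[of D n \<phi>]] in auto)

text \<open>The top block of \<open>U\<close> is \<open>A\<close>, and that of its adjoint is
  \<open>A\<close> again because \<open>A\<close> is Hermitian. This is what permits the circuit to
  alternate between the two.\<close>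

lemma offblock_zero:
  assumes U: "unitary_mat D U" and A: "A \<in> carrier_mat n n" "mat_adjoint A = A" "top_block n U = A" and n: "n \<le> D"
    and ij: "i < n" "j < n" and G: "G = U \<or> G = mat_adjoint U"
  shows "(G * anc_embed D n - anc_embed D n * A) $$ (i, j) = 0"
proof -
  have Uc: "U \<in> carrier_mat D D" using U by (auto simp: unitary_mat_def)
  then have Gc: "G \<in> carrier_mat D D" using G by auto
  have blk: "U $$ (i, j) = A $$ (i, j)" if "i < n" "j < n" for i j
    using that unfolding A(3)[symmetric] by (simp add: top_block_def)
  have "G $$ (i, j) = A $$ (i, j)"
  proof (cases "G = U")
    case False
    then have "G $$ (i, j) = cnj (U $$ (j, i))" using G ij Uc n by auto
    also have "\<dots> = mat_adjoint A $$ (i, j)" using blk[OF ij(2,1)] ij A(1) by simp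
    finally show ?thesis using A(2) by simp
  qed (use blk ij in simp)
  moreover have "(G * anc_embed D n - anc_embed D n * A) $$ (i, j) = (G * anc_embed D n) $$ (i, j) - (anc_embed D n * A) $$ (i, j)"
    using ij n A(1) carrier_matD[OF anc_embed_carrier[of D n]] by (intro index_minus_mat(1)) auto
  ultimately show ?thesis
    using mult_embed_index[OF Gc _ ij(2) n, of i] embed_mult_index[OF A(1) _ ij(2) n, of i] ij n by simp
qed

text \<open>The gate in front of \<open>anc_embed\<close> is the one applied last: \<open>U\<close>
  for odd \<open>k\<close>, its adjoint for even \<open>k\<close>. The next gate is its inverse, as
  \<open>mat_cancel_aux\<close> requires. For \<open>k = 0\<close> the second polynomial is
  zero.\<close>

lemma qsp_state_polys:
  assumes U: "unitary_mat D U" and A: "A \<in> carrier_mat n n" "mat_adjoint A = A" "top_block n U = A" and n: "n \<le> D"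
  shows "qsp_state D n U \<Phi> k = anc_embed D n * cmat_poly (fst (qsp_polys \<Phi> k)) A
    + ((if odd k then U else mat_adjoint U) * anc_embed D n - anc_embed D n * A) * cmat_poly (snd (qsp_polys \<Phi> k)) A"
proof (induction k)
  case 0
  have Uc: "U \<in> carrier_mat D D" using U by (simp add: unitary_mat_def)
  have "(mat_adjoint U * anc_embed D n - anc_embed D n * A) * 0\<^sub>m n n = 0\<^sub>m D n"
    by (rule right_mult_zero_mat[OF minus_carrier_mat[OF mult_carrier_mat[OF anc_embed_carrier A(1)]]])
  then show ?case using A by (simp add: cmat_poly_0[OF A(1)] cmat_poly_1[OF A(1)] right_mult_one_mat[OF anc_embed_carrier] right_add_zero_mat[OF anc_embed_carrier])
next
  case (Suc k)
  let ?G = "if odd k then U else mat_adjoint U" and ?B = "if odd k then mat_adjoint U else U"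
  obtain P Q where PQ: "qsp_polys \<Phi> k = (P, Q)" by fastforce
  have Uc: "U \<in> carrier_mat D D" and inv: "?B * ?G = 1\<^sub>m D" using U by (auto simp: unitary_mat_def)
  have B: "?B \<in> carrier_mat D D" and G: "?G \<in> carrier_mat D D" using Uc by auto
  note X = cmat_poly_carrier[OF A(1), of P] and Y = cmat_poly_carrier[OF A(1), of Q]
  let ?X = "A * cmat_poly P A + (cmat_poly Q A - A * (A * cmat_poly Q A))" and ?Y = "cmat_poly P A - A * cmat_poly Q A"
  let ?W = "?B * anc_embed D n - anc_embed D n * A"
  have X': "?X \<in> carrier_mat n n" and Y': "?Y \<in> carrier_mat n n" using X Y A by auto
  have W: "?W \<in> carrier_mat D n" using B A anc_embed_carrier by (intro minus_carrier_mat mult_carrier_mat) auto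
  have W0: "?W $$ (i, j) = 0" if "i < n" "j < n" for i j
    using that by (intro offblock_zero[OF U A n]) auto
  have "qsp_state D n U \<Phi> (Suc k) = phase_mat D n (\<Phi> (Suc k)) * (?B * qsp_state D n U \<Phi> k)" by simp
  also have "?B * qsp_state D n U \<Phi> k = anc_embed D n * ?X + ?W * ?Y"
    unfolding Suc PQ fst_conv snd_conv
    by (rule mat_cancel_aux[OF B G inv anc_embed_carrier A(1) X Y])
  also have "phase_mat D n (\<Phi> (Suc k)) * \<dots> = anc_embed D n * (cis (\<Phi> (Suc k)) \<cdot>\<^sub>m ?X) + ?W * (cis (- \<Phi> (Suc k)) \<cdot>\<^sub>m ?Y)"
    by (rule phase_split[OF X' W Y' n W0])
  also have "cis (\<Phi> (Suc k)) \<cdot>\<^sub>m ?X = cmat_poly (fst (qsp_polys \<Phi> (Suc k))) A"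
    by (simp add: PQ cmat_poly_smult cmat_poly_add cmat_poly_diff cmat_poly_pCons_0[OF A(1)])
  also have "cis (- \<Phi> (Suc k)) \<cdot>\<^sub>m ?Y = cmat_poly (snd (qsp_polys \<Phi> (Suc k))) A"
    by (simp add: PQ cmat_poly_smult cmat_poly_add cmat_poly_diff cmat_poly_pCons_0[OF A(1)])
  finally show ?case by simp
qed

lemma top_block_qsp_state:
  assumes U: "unitary_mat D U" and A: "A \<in> carrier_mat n n" "mat_adjoint A = A" "top_block n U = A" and n: "n \<le> D"
  shows "top_block n (qsp_state D n U \<Phi> k) = cmat_poly (fst (qsp_polys \<Phi> k)) A"
proof (rule eq_matI)
  let ?P = "fst (qsp_polys \<Phi> k)" and ?Q = "snd (qsp_polys \<Phi> k)"
  let ?G = "if odd k then U else mat_adjoint U"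
  fix i j assume "i < dim_row (cmat_poly ?P A)" "j < dim_col (cmat_poly ?P A)"
  then have ij: "i < n" "j < n" using A by auto
  have Uc: "U \<in> carrier_mat D D" using U by (auto simp: unitary_mat_def)
  then have G: "?G \<in> carrier_mat D D" by auto
  let ?W = "?G * anc_embed D n - anc_embed D n * A"
  have W: "?W \<in> carrier_mat D n" using G A anc_embed_carrier by (intro minus_carrier_mat mult_carrier_mat) auto
  have "(?W * cmat_poly ?Q A) $$ (i, j) = 0"
    by (rule zero_rows_mult[OF W cmat_poly_carrier[OF A(1)] n ij offblock_zero[OF U A n]]) auto
  moreover have "dim_row (?W * cmat_poly ?Q A) = D" "dim_col (?W * cmat_poly ?Q A) = n" using W A by auto
  ultimately have "(anc_embed D n * cmat_poly ?P A + ?W * cmat_poly ?Q A) $$ (i, j) = (anc_embed D n * cmat_poly ?P A) $$ (i, j)"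
    using ij n by simp
  also have "\<dots> = cmat_poly ?P A $$ (i, j)"
    using ij n by (simp add: embed_mult_index[OF cmat_poly_carrier[OF A(1)]] del: index_mult_mat(1))
  finally show "top_block n (qsp_state D n U \<Phi> k) $$ (i, j) = cmat_poly ?P A $$ (i, j)"
    using ij unfolding qsp_state_polys[OF assms] by (simp add: top_block_def del: index_mult_mat(1))
qed (use A in \<open>auto simp: top_block_def\<close>)

text \<open>Scalar counterpart of \<open>qsp_state_polys\<close>, with sqrt(1 - x^2) in the place of
  the part that leaves the zero space. It connects the circuit at \<open>A\<close> with the phases,
  which are specified through numbers x.\<close>

lemma qsp_product_polys:
  assumes "x \<in> {-1..1}"
  shows "qsp_product k \<Phi> x $$ (0, 0) = poly (fst (qsp_polys \<Phi> k)) (of_real x) \<and>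
    qsp_product k \<Phi> x $$ (Suc 0, 0) = of_real (sqrt (1 - x\<^sup>2)) * poly (snd (qsp_polys \<Phi> k)) (of_real x)"
proof (induction k)
  case (Suc k)
  define s where "s = complex_of_real (sqrt (1 - x\<^sup>2))"
  have s2: "s * s = 1 - of_real x * of_real x"
    unfolding s_def by (rule sqrt_complement[OF assms])
  obtain P Q where PQ: "qsp_polys \<Phi> k = (P, Q)" by fastforce
  have e: "s * (s * q) = q - of_real x * (of_real x * q)" for q
    using s2 by (metis (no_types, lifting) left_diff_distrib mult.assoc mult_1)
  show ?case
    using Suc unfolding s_def[symmetric]
    by (simp add: mult_2_index[OF zrot_reflect_carrier qsp_carrier] zrot_reflect_index PQ e s_def[symmetric]
        algebra_simps del: index_mult_mat(1))
qed simp

lemma poly_cnj_poly: "poly (cnj_poly P) (of_real x) = cnj (poly P (of_real x))"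
  by (induction P) simp_all

text \<open>\<open>qsp_phases\<close> speaks of values on [-1, 1] only. Agreement at infinitely many
  points gives an identity of polynomials, which can then be evaluated at a matrix.\<close>

lemma qsp_phases_polys:
  assumes "qsp_phases p d \<Phi>"
  shows "fst (qsp_polys \<Phi> d) + cnj_poly (fst (qsp_polys \<Phi> d)) = Polynomial.smult 2 (map_poly complex_of_real p)"
    (is "?L = ?R")
proof -
  have "poly (?L - ?R) (of_real x) = 0" if "x \<in> {-1..1}" for x
  proof -
    have "Re (poly (fst (qsp_polys \<Phi> d)) (of_real x)) = poly p x"
      using assms that qsp_product_polys[OF that, of d \<Phi>] unfolding qsp_phases_def by metis
    then show ?thesis by (simp add: poly_cnj_poly poly_map_poly_of_real complex_add_cnj)
  qed
  then have "complex_of_real ` {-1..1} \<subseteq> {z. poly (?L - ?R) z = 0}" by auto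
  moreover have "infinite (complex_of_real ` {-1..1})"
    using infinite_Icc[of "-1::real" 1] by (simp add: finite_image_iff inj_on_def)
  ultimately have "infinite {z. poly (?L - ?R) z = 0}" using finite_subset by blast
  then have "?L - ?R = 0" using poly_roots_finite by blast
  then show ?thesis by simp
qed

lemma cmat_poly_of_real: "cmat_poly (map_poly complex_of_real p) A = mat_poly p A"
proof -
  have "degree (map_poly complex_of_real p) = degree p" by (rule degree_map_poly) simp
  then show ?thesis by (simp add: cmat_poly_def mat_poly_def coeff_map_poly)
qed

lemma qsp_noiseless:
  assumes "A \<in> carrier_mat n n" "mat_adjoint A = A" "qsp_phases p d \<Phi>"
  shows "cmat_poly (fst (qsp_polys \<Phi> d)) A + mat_adjoint (cmat_poly (fst (qsp_polys \<Phi> d)) A) = 2 \<cdot>\<^sub>m mat_poly p A"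
  unfolding cmat_poly_adjoint[OF assms(1,2)] cmat_poly_add[symmetric] qsp_phases_polys[OF assms(3)] cmat_poly_smult cmat_poly_of_real ..

section \<open>The Hadamard test\<close>

lemma unitary_hadamard: "unitary_mat 2 hadamard_mat"
proof -
  have c: "hadamard_mat \<in> carrier_mat 2 2" by (auto simp: hadamard_mat_def mat_of_rows_list_def)
  have "mat_adjoint hadamard_mat = hadamard_mat"
    by (rule eq_matI) (use c in \<open>auto simp: numeral_2_eq_2 less_Suc_eq\<close>)
  moreover have "complex_of_real (sqrt 2) * complex_of_real (sqrt 2) = 2"
    by (simp flip: of_real_mult)
  then have "hadamard_mat * hadamard_mat = 1\<^sub>m 2"
    by (intro eq_matI) (use c in \<open>auto simp: numeral_2_eq_2 less_Suc_eq mult_2_index[OF c c, unfolded numeral_2_eq_2] simp del: index_mult_mat(1)\<close>)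
  ultimately show ?thesis using c by (simp add: unitary_mat_def)
qed

lemma unitary_not: "unitary_mat 2 not_mat"
proof -
  have c: "not_mat \<in> carrier_mat 2 2" by (auto simp: not_mat_def mat_of_rows_list_def)
  have "mat_adjoint not_mat = not_mat"
    by (rule eq_matI) (use c in \<open>auto simp: numeral_2_eq_2 less_Suc_eq\<close>)
  moreover have "not_mat * not_mat = 1\<^sub>m 2"
    by (intro eq_matI) (use c in \<open>auto simp: numeral_2_eq_2 less_Suc_eq mult_2_index[OF c c, unfolded numeral_2_eq_2] simp del: index_mult_mat(1)\<close>)
  ultimately show ?thesis using c by (simp add: unitary_mat_def)
qed

lemma unitary_zrot: "unitary_mat 2 (zrot \<phi>)"
proof -
  note c = zrot_carrier
  have a: "mat_adjoint (zrot \<phi>) = zrot (- \<phi>)"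
    by (rule eq_matI) (auto simp: numeral_2_eq_2 less_Suc_eq cis_cnj)
  have "zrot x * zrot (- x) = 1\<^sub>m 2" for x
    by (intro eq_matI) (auto simp: numeral_2_eq_2 less_Suc_eq cis_mult mult_2_index[OF c c, unfolded numeral_2_eq_2] simp del: index_mult_mat(1))
  from this[of \<phi>] this[of "- \<phi>"] show ?thesis using c a by (simp add: unitary_mat_def)
qed

lemma wf_adj_circuit:
  "unitary_circuit I ds c \<Longrightarrow> unitary_circuit I ds (adj_circuit c)"
  by (auto simp: unitary_circuit_def adj_circuit_def unitary_gate_def intro: unitary_mat_adjoint)

lemma unitary_ctrl_circuit:
  assumes "unitary_circuit I ds c" "r \<notin> touched c"
  shows "unitary_circuit I ds (ctrl_circuit r v c)"
proof -
  have "unitary_gate I ds (ctrl_gate r v g)" if "unitary_gate I ds g" "r \<notin> set (targets g)" for g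
    using that by (cases g) (auto simp: unitary_gate_def wf_gate_def)
  then show ?thesis using assms by (auto simp: unitary_circuit_def ctrl_circuit_def touched_def)
qed

lemma unitary_qsp_circuit:
  assumes "ds (Rot s) = 2" "unitary_mat (ds (AncA s) * ds Sys) (I OrA)"
  shows "unitary_circuit I ds (qsp_circuit s k \<Phi>)"
  by (induction k)
    (use assms in \<open>auto simp: unitary_gate_def wf_gate_def total_dim_def unitary_zrot unitary_not intro: unitary_mat_adjoint\<close>)

lemma unitary_lcu_circuit:
  assumes "ds (Lcu s) = 2" "unitary_circuit I ds c1" "unitary_circuit I ds c2"
    "Lcu s \<notin> touched c1" "Lcu s \<notin> touched c2"
  shows "unitary_circuit I ds (lcu_circuit s c1 c2)"
  using assms unfolding lcu_circuit_def
  by (auto simp: unitary_gate_def wf_gate_def total_dim_def unitary_hadamard intro!: unitary_ctrl_circuit)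

lemma kron_ket0:
  assumes "n > 0"
  shows "kron (ket0 a) (1\<^sub>m n) = anc_embed (2 ^ a * n) n"
proof (rule eq_matI)
  have k: "ket0 a \<in> carrier_mat (2 ^ a) 1" by (intro carrier_matI) (auto simp: ket0_def)
  fix i j assume "i < dim_row (anc_embed (2 ^ a * n) n)" "j < dim_col (anc_embed (2 ^ a * n) n)"
  then have ij: "i < 2 ^ a * n" "j < n" by (auto simp: anc_embed_def)
  then have "i div n < 2 ^ a" "i mod n < n" using assms by (auto simp: less_mult_imp_div_less)
  moreover have "ket0 a $$ (p, 0) = (if p = 0 then 1 else 0)" if "p < 2 ^ a" for p
    using that by (simp add: ket0_def mat_of_cols_index)
  moreover have "i div n = 0 \<and> i mod n = j \<longleftrightarrow> i = j"
    using ij assms by (metis div_less mod_less div_eq_0_iff not_gr_zero)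
  ultimately show "kron (ket0 a) (1\<^sub>m n) $$ (i, j) = anc_embed (2 ^ a * n) n $$ (i, j)"
    using ij k by (auto simp: kron_def anc_embed_def)
qed (auto simp: kron_def anc_embed_def ket0_def)

lemma block_encodingD:
  assumes "block_encoding a n U B" "n > 0"
  shows "unitary_mat (2 ^ a * n) U" "top_block n U = B"
proof -
  let ?D = "2 ^ a * n"
  show u: "unitary_mat ?D U" using assms by (simp add: block_encoding_def)
  then have U: "U \<in> carrier_mat ?D ?D" by (simp add: unitary_mat_def)
  have nD: "n \<le> ?D" by simp
  note E = anc_embed_carrier[of ?D n]
  have AU: "mat_adjoint (anc_embed ?D n) * U \<in> carrier_mat n ?D" using E U by (intro mult_carrier_mat) auto
  have B: "B = mat_adjoint (anc_embed ?D n) * U * anc_embed ?D n"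
    using assms by (simp add: block_encoding_def kron_ket0)
  have "B $$ (i, j) = U $$ (i, j)" if ij: "i < n" "j < n" for i j
  proof -
    have "B $$ (i, j) = (mat_adjoint (anc_embed ?D n) * U) $$ (i, j)"
      unfolding B by (rule mult_embed_index[OF AU ij nD])
    also have "\<dots> = (\<Sum>l<?D. mat_adjoint (anc_embed ?D n) $$ (i, l) * U $$ (l, j))"
      using ij order_less_le_trans[OF ij(2) nD] by (intro mult_mat_index[OF mat_adjoint_carrier[OF E] U]) auto
    also have "\<dots> = (\<Sum>l<?D. if l = i then U $$ (l, j) else 0)"
      using ij nD by (intro sum.cong) (auto simp: anc_embed_def)
    finally show ?thesis using ij nD by simp
  qed
  moreover have "B \<in> carrier_mat n n" unfolding B using AU E by (rule mult_carrier_mat)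
  ultimately show "top_block n U = B" by (intro eq_matI) (auto simp: top_block_def)
qed

lemma ds_simps [simp]: "reg_dim n a b Ctl = 2" "reg_dim n a b (Lcu s) = 2" "reg_dim n a b (Rot s) = 2"
  by auto

definition qsp_block :: "nat \<Rightarrow> (nat \<Rightarrow> real) \<Rightarrow> (nat \<times> nat \<Rightarrow> real) \<Rightarrow> complex mat \<Rightarrow> nat \<Rightarrow> complex mat" where
  "qsp_block d \<Phi> e A k = cmat_poly (fst (qsp_polys (\<lambda>j. \<Phi> j + e (k, j)) d)) A"

text \<open>The factor 1/4 of the observable is split into the two factors 1/2 that the linear
  combinations of unitaries produce.\<close>

definition observable_block ::
  "nat \<Rightarrow> (nat \<Rightarrow> real) \<Rightarrow> complex mat \<Rightarrow> complex mat \<Rightarrow> (nat \<times> nat \<Rightarrow> real) \<Rightarrow> complex mat" where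
  "observable_block d \<Phi> A B e =
     ((1 / 2) \<cdot>\<^sub>m (qsp_block d \<Phi> e A 1 + mat_adjoint (qsp_block d \<Phi> e A 2))) * B *
     ((1 / 2) \<cdot>\<^sub>m (qsp_block d \<Phi> e A 3 + mat_adjoint (qsp_block d \<Phi> e A 4)))"

locale encoded =
  fixes n a b :: nat and A Ob UA UO Upsi :: "complex mat"
  assumes n: "n > 0" and A: "A \<in> carrier_mat n n" "mat_adjoint A = A" and Ob: "Ob \<in> carrier_mat n n"
    and UA: "block_encoding a n UA A" and UO: "block_encoding b n UO Ob" and Upsi: "unitary_mat n Upsi"
begin

abbreviation "I \<equiv> oracles UA UO Upsi"
abbreviation "ds \<equiv> reg_dim n a b"

lemma dims_pos: "ds r > 0"
  using n by (cases r) auto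

lemma UA_unitary: "unitary_mat (2 ^ a * n) UA" and UO_unitary: "unitary_mat (2 ^ b * n) UO"
  and UA_block: "top_block n UA = A" and UO_block: "top_block n UO = Ob"
  using block_encodingD[OF UA n] block_encodingD[OF UO n] by auto

lemma unitary_noisy: "unitary_circuit I ds (noisy_qsp_circuit s d \<Phi> e k)"
  unfolding noisy_qsp_circuit_def by (rule unitary_qsp_circuit) (simp_all add: UA_unitary)

lemma encodes_noisy: "encodes I ds (noisy_qsp_circuit s d \<Phi> e k) {Rot s, AncA s} (qsp_block d \<Phi> e A k)"
proof -
  have "UA \<in> carrier_mat (2 ^ a * n) (2 ^ a * n)" using UA_unitary by (simp add: unitary_mat_def)
  then have "encodes I ds (noisy_qsp_circuit s d \<Phi> e k) {Rot s, AncA s}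
    (top_block n (qsp_state (2 ^ a * n) n (I OrA) (\<lambda>j. \<Phi> j + e (k, j)) d))"
    unfolding noisy_qsp_circuit_def by (intro encodes_qsp) auto
  moreover have "top_block n (qsp_state (2 ^ a * n) n (I OrA) (\<lambda>j. \<Phi> j + e (k, j)) d) = qsp_block d \<Phi> e A k"
    unfolding qsp_block_def oracles.simps
    using top_block_qsp_state[OF UA_unitary A UA_block] by simp
  ultimately show ?thesis by simp
qed

lemma noisy_touched: "touched (noisy_qsp_circuit s d \<Phi> e k) \<subseteq> {Rot s, AncA s, Sys}"
  unfolding noisy_qsp_circuit_def by (rule touched_qsp_circuit)

lemma observable_unitary: "unitary_circuit I ds (observable_circuit d \<Phi> e)"
proof -
  have "Lcu s \<notin> touched (noisy_qsp_circuit s d \<Phi> e k)" for s k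
    using noisy_touched[of s d \<Phi> e k] by auto
  then have "unitary_circuit I ds (lcu_circuit s (noisy_qsp_circuit s d \<Phi> e k) (adj_circuit (noisy_qsp_circuit s d \<Phi> e k')))" for s k k'
    by (intro unitary_lcu_circuit wf_adj_circuit unitary_noisy) auto
  then show ?thesis
    by (simp add: observable_circuit_def unitary_gate_def wf_gate_def total_dim_def UO_unitary)
qed

text \<open>The two sides and the query to \<open>OrO\<close> use disjoint ancillas, so
  \<open>encodes_append\<close> applies; together these ancillas are all registers but the control
  and the system.\<close>

lemma encodes_observable: "encodes I ds (observable_circuit d \<Phi> e) (- {Ctl, Sys}) (observable_block d \<Phi> A Ob e)"
proof -
  have side: "encodes I ds (lcu_circuit s (noisy_qsp_circuit s d \<Phi> e k) (adj_circuit (noisy_qsp_circuit s d \<Phi> e k')))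
    (insert (Lcu s) {Rot s, AncA s}) ((1 / 2) \<cdot>\<^sub>m (qsp_block d \<Phi> e A k + mat_adjoint (qsp_block d \<Phi> e A k')))" for s k k'
    by (intro encodes_lcu encodes_noisy encodes_adj unitary_noisy) auto
  have O: "encodes I ds [Gate [] (Query OrO False) [AncO, Sys]] {AncO} Ob"
    using encodes_query[of ds n AncO I OrO] n UO_block by simp
  have "encodes I ds (observable_circuit d \<Phi> e)
    (insert (Lcu Rgt) {Rot Rgt, AncA Rgt} \<union> ({AncO} \<union> insert (Lcu Lft) {Rot Lft, AncA Lft}))
    (observable_block d \<Phi> A Ob e)"
    unfolding observable_circuit_def observable_block_def
    by (intro encodes_append side O) auto
  moreover have "insert (Lcu Rgt) {Rot Rgt, AncA Rgt} \<union> ({AncO} \<union> insert (Lcu Lft) {Rot Lft, AncA Lft}) = - {Ctl, Sys}"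
    unfolding Compl_eq_Diff_UNIV UNIV_reg by auto
  ultimately show ?thesis by simp
qed

lemma test_unitary: "unitary_circuit I ds (hadamard_test_circuit d \<Phi> e)"
proof -
  have "Ctl \<notin> touched (observable_circuit d \<Phi> e)" using encodes_observable[of d \<Phi> e] by (auto simp: encodes_def)
  then have "unitary_circuit I ds (ctrl_circuit Ctl 1 (observable_circuit d \<Phi> e))"
    by (intro unitary_ctrl_circuit observable_unitary)
  then show ?thesis
    by (simp add: hadamard_test_circuit_def unitary_gate_def wf_gate_def total_dim_def unitary_hadamard Upsi)
qed

definition final_state where
  "final_state d \<Phi> e = run_circuit I ds (hadamard_test_circuit d \<Phi> e) init_state"

lemma zero_basis: "(\<lambda>_. 0) \<in> basis ds"
  using dims_pos by (simp add: mem_basis)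

lemma final_state_norm: "(\<Sum>x\<in>basis ds. (cmod (final_state d \<Phi> e x))\<^sup>2) = 1"
proof -
  have sq: "iprod ds st st = of_real (\<Sum>x\<in>basis ds. (cmod (st x))\<^sup>2)" for st
    unfolding iprod_def of_real_sum by (intro sum.cong refl) (metis complex_norm_square mult.commute of_real_power)
  have "iprod ds (final_state d \<Phi> e) (final_state d \<Phi> e) = iprod ds init_state init_state"
    unfolding final_state_def by (rule norm_run_circuit[OF test_unitary])
  also have "\<dots> = 1"
    unfolding init_state_def using iprod_delta[OF zero_basis] by simp
  finally show ?thesis unfolding sq by (metis of_real_eq_1_iff)
qed

text \<open>Restricted to labels with zero ancillas: these alone give a nonzero record, and for them
  the block-encoding determines the amplitude.\<close>

lemma final_state_amplitude:
  assumes \<psi>: "\<psi> \<in> carrier_vec n" "Upsi *\<^sub>v unit_vec n 0 = \<psi>"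
    and x: "x \<in> basis ds" "\<And>r. r \<noteq> Ctl \<Longrightarrow> r \<noteq> Sys \<Longrightarrow> x r = 0"
  shows "final_state d \<Phi> e x =
    (\<psi> $ (x Sys) + (if x Ctl = 0 then 1 else -1) * (observable_block d \<Phi> A Ob e *\<^sub>v \<psi>) $ (x Sys)) / 2"
proof -
  let ?M = "observable_block d \<Phi> A Ob e" and ?c = "observable_circuit d \<Phi> e"
  have UpC: "Upsi \<in> carrier_mat n n" using Upsi by (simp add: unitary_mat_def)
  have M: "?M \<in> carrier_mat n n" and t: "touched ?c \<subseteq> insert Sys (- {Ctl, Sys})"
    using encodes_observable[of d \<Phi> e] by (auto simp: encodes_def)
  define st0 where "st0 = apply_gate I ds (Gate [] (Query OrPsi False) [Sys]) init_state"
  define st1 where "st1 = apply_gate I ds (Gate [] (Fixed hadamard_mat) [Ctl]) st0"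
  define st2 where "st2 = run_circuit I ds (ctrl_circuit Ctl 1 ?c) st1"
  have psi: "\<psi> $ i = Upsi $$ (i, 0)" if "i < n" for i
    using that n UpC by (auto simp: \<psi>(2)[symmetric] scalar_prod_def unit_vec_def if_distrib cong: if_cong)
  have st0: "st0 y = (if \<forall>r. r \<noteq> Sys \<longrightarrow> y r = 0 then \<psi> $ (y Sys) else 0)" if "y \<in> basis ds" for y
  proof -
    have ys: "y Sys < n" using that by (metis mem_basis reg_dim.simps(3))
    have "st0 y = (\<Sum>i<n. Upsi $$ (y Sys, i) * init_state (y(Sys := i)))"
      unfolding st0_def by (simp add: apply_gate_single[OF that])
    also have "\<dots> = (\<Sum>i<n. if i = 0 then (if \<forall>r. r \<noteq> Sys \<longrightarrow> y r = 0 then \<psi> $ (y Sys) else 0) else 0)"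
    proof (rule sum.cong)
      fix i
      have "y(Sys := i) = (\<lambda>_. 0) \<longleftrightarrow> i = 0 \<and> (\<forall>r. r \<noteq> Sys \<longrightarrow> y r = 0)"
        by (auto simp: fun_eq_iff)
      then show "Upsi $$ (y Sys, i) * init_state (y(Sys := i)) =
        (if i = 0 then (if \<forall>r. r \<noteq> Sys \<longrightarrow> y r = 0 then \<psi> $ (y Sys) else 0) else 0)"
        using psi[OF ys] by (cases "i = 0"; cases "\<forall>r. r \<noteq> Sys \<longrightarrow> y r = 0") (simp_all only: init_state_def, simp_all)
    qed simp
    finally show ?thesis using n by simp
  qed
  have st1: "st1 y = (if \<forall>r. r \<noteq> Sys \<and> r \<noteq> Ctl \<longrightarrow> y r = 0 then \<psi> $ (y Sys) / sqrt 2 else 0)" if "y \<in> basis ds" for y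
  proof -
    have c: "y(Ctl := 0) \<in> basis ds" "y(Ctl := 1) \<in> basis ds" using that by (auto simp: mem_basis)
    have "st1 y = complex_of_real (1 / sqrt 2) * (st0 (y(Ctl := 0)) + (if y Ctl = 0 then 1 else -1) * st0 (y(Ctl := 1)))"
      unfolding st1_def by (rule apply_hadamard[OF that]) simp
    moreover have "st0 (y(Ctl := 1)) = 0" using st0[OF c(2)] by auto
    moreover have "st0 (y(Ctl := 0)) = (if \<forall>r. r \<noteq> Sys \<and> r \<noteq> Ctl \<longrightarrow> y r = 0 then \<psi> $ (y Sys) else 0)"
      using st0[OF c(1)] by auto
    ultimately show ?thesis
      by (cases "\<forall>r. r \<noteq> Sys \<and> r \<noteq> Ctl \<longrightarrow> y r = 0") (simp_all only:, simp_all)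
  qed
  have xs: "x Sys < n" using x by (metis mem_basis reg_dim.simps(3))
  have c: "x(Ctl := 0) \<in> basis ds" "x(Ctl := 1) \<in> basis ds" using x by (auto simp: mem_basis)
  have Ct: "Ctl \<notin> touched ?c" using t by auto
  have 0: "st2 (x(Ctl := 0)) = \<psi> $ (x Sys) / sqrt 2"
    unfolding st2_def using run_ctrl_circuit[OF Ct c(1), of I 1 st1] st1[OF c(1)] x(2) by simp
  have "run_circuit I ds ?c st1 (x(Ctl := 1)) = (\<Sum>i<ds Sys. ?M $$ ((x(Ctl := 1)) Sys, i) * st1 ((x(Ctl := 1))(Sys := i)))"
  proof (rule encodesD[OF encodes_observable c(2)])
    show "(x(Ctl := 1)) r = 0" if "r \<in> - {Ctl, Sys}" for r using x that by auto
    fix y r assume "y \<in> slice ds (insert Sys (- {Ctl, Sys})) (x(Ctl := 1))" "r \<in> - {Ctl, Sys}" "y r \<noteq> 0"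
    then show "st1 y = 0" using st1[of y] slice_basis by auto
  qed
  also have "\<dots> = (\<Sum>i<n. ?M $$ (x Sys, i) * (\<psi> $ i / sqrt 2))"
  proof (rule sum.cong)
    fix i assume "i \<in> {..<n}"
    then have "(x(Ctl := 1))(Sys := i) \<in> basis ds" using basis_upd[OF c(2), of i Sys] by simp
    from st1[OF this] show "?M $$ ((x(Ctl := 1)) Sys, i) * st1 ((x(Ctl := 1))(Sys := i)) = ?M $$ (x Sys, i) * (\<psi> $ i / sqrt 2)"
      using x(2) by simp
  qed simp
  also have "\<dots> = (?M *\<^sub>v \<psi>) $ (x Sys) / sqrt 2"
    using xs M \<psi>(1) by (simp add: scalar_prod_def sum_divide_distrib lessThan_atLeast0)
  finally have 1: "st2 (x(Ctl := 1)) = (?M *\<^sub>v \<psi>) $ (x Sys) / sqrt 2"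
    unfolding st2_def using run_ctrl_circuit[OF Ct c(2), of I 1 st1] by simp
  have "final_state d \<Phi> e x = apply_gate I ds (Gate [] (Fixed hadamard_mat) [Ctl]) st2 x"
    by (simp add: final_state_def hadamard_test_circuit_def st0_def st1_def st2_def)
  also have "\<dots> = complex_of_real (1 / sqrt 2) * (st2 (x(Ctl := 0)) + (if x Ctl = 0 then 1 else -1) * st2 (x(Ctl := 1)))"
    by (rule apply_hadamard[OF x(1)]) simp
  also have "\<dots> = complex_of_real (1 / sqrt 2 * (1 / sqrt 2)) * (\<psi> $ (x Sys) + (if x Ctl = 0 then 1 else -1) * (?M *\<^sub>v \<psi>) $ (x Sys))"
    unfolding 0 1 of_real_mult by (simp add: of_real_divide algebra_simps)
  also have "1 / sqrt 2 * (1 / sqrt 2) = 1 / 2" by simp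
  finally show ?thesis by simp
qed

text \<open>\<open>restrict\<close> puts \<open>undefined\<close> at \<open>Sys\<close>, which the
  record does not inspect.\<close>

lemma test_record_restrict: "test_record (restrict x (- {Sys})) = test_record x"
proof -
  have "(\<forall>r. r \<noteq> Ctl \<and> r \<noteq> Sys \<longrightarrow> restrict x (- {Sys}) r = 0) \<longleftrightarrow> (\<forall>r. r \<noteq> Ctl \<and> r \<noteq> Sys \<longrightarrow> x r = 0)" by auto
  moreover have "restrict x (- {Sys}) Ctl = x Ctl" by simp
  ultimately show ?thesis unfolding test_record_def by (simp only:)
qed

lemma expected_record:
  assumes \<psi>: "\<psi> \<in> carrier_vec n" "Upsi *\<^sub>v unit_vec n 0 = \<psi>"
  shows "(\<Sum>x\<in>basis ds. (cmod (final_state d \<Phi> e x))\<^sup>2 * real_of_int (test_record x)) =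
    Re (quad_form (observable_block d \<Phi> A Ob e) \<psi>)"
proof -
  let ?M = "observable_block d \<Phi> A Ob e"
  have M: "?M \<in> carrier_mat n n" using encodes_observable[of d \<Phi> e] by (auto simp: encodes_def)
  define z :: label where "z = (\<lambda>_. 0)"
  let ?g = "\<lambda>x. (cmod (final_state d \<Phi> e x))\<^sup>2 * real_of_int (test_record x)"
  have "sum ?g (basis ds) = sum ?g (slice ds (set [Ctl, Sys]) z)"
    by (rule sum.mono_neutral_right) (auto simp: slice_def test_record_def z_def)
  also have "slice ds (set [Ctl, Sys]) z = (\<lambda>(c, i). z(Ctl := c, Sys := i)) ` ({..<2} \<times> {..<n})"
  proof (intro equalityI subsetI)
    fix y assume y: "y \<in> slice ds (set [Ctl, Sys]) z"
    then have "y Ctl < ds Ctl" "y Sys < ds Sys" by (auto simp: slice_def mem_basis simp del: reg_dim.simps ds_simps)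
    moreover have "y = z(Ctl := y Ctl, Sys := y Sys)" using y by (auto simp: slice_def fun_eq_iff)
    ultimately show "y \<in> (\<lambda>(c, i). z(Ctl := c, Sys := i)) ` ({..<2} \<times> {..<n})"
      by (intro image_eqI[of _ _ "(y Ctl, y Sys)"]) auto
  next
    fix y assume "y \<in> (\<lambda>(c, i). z(Ctl := c, Sys := i)) ` ({..<2} \<times> {..<n})"
    then show "y \<in> slice ds (set [Ctl, Sys]) z"
      using dims_pos by (auto simp: slice_def mem_basis z_def)
  qed
  also have "sum ?g \<dots> = (\<Sum>(c, i)\<in>{..<2} \<times> {..<n}. ?g (z(Ctl := c, Sys := i)))"
  proof (subst sum.reindex)
    show "inj_on (\<lambda>(c, i). z(Ctl := c, Sys := i)) ({..<2} \<times> {..<n})"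
      by (rule inj_onI) (auto simp: fun_eq_iff split: if_splits)
  qed (simp add: case_prod_beta)
  also have "\<dots> = (\<Sum>c<2. \<Sum>i<n. ?g (z(Ctl := c, Sys := i)))"
    by (rule sum.cartesian_product[symmetric])
  also have "\<dots> = (\<Sum>i<n. ?g (z(Ctl := 0, Sys := i)) + ?g (z(Ctl := 1, Sys := i)))"
    by (simp add: numeral_2_eq_2 sum.distrib)
  also have "\<dots> = (\<Sum>i<n. Re ((?M *\<^sub>v \<psi>) $ i * cnj (\<psi> $ i)))"
  proof (rule sum.cong)
    fix i assume i: "i \<in> {..<n}"
    have b: "z(Ctl := c, Sys := i) \<in> basis ds" if "c < 2" for c
      using i that dims_pos by (auto simp: mem_basis z_def)
    have f: "final_state d \<Phi> e (z(Ctl := c, Sys := i)) =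
      (\<psi> $ i + (if c = 0 then 1 else -1) * (?M *\<^sub>v \<psi>) $ i) / 2" if "c < 2" for c
      using final_state_amplitude[OF \<psi> b[OF that], of d \<Phi> e] by (simp add: z_def)
    have t: "test_record (z(Ctl := c, Sys := i)) = (if c = 0 then 1 else -1)" for c
      by (simp add: test_record_def z_def)
    let ?p = "\<psi> $ i" and ?q = "(?M *\<^sub>v \<psi>) $ i"
    \<comment> \<open>Polarization: at a fixed system value, the difference of the probabilities of
      the two outcomes is one term of the real part of the quadratic form.\<close>
    have "(cmod ((p + q) / 2))\<^sup>2 - (cmod ((p - q) / 2))\<^sup>2 = Re (q * cnj p)" for p q
      by (simp add: norm_divide power_divide cmod_power2) (simp add: field_simps power2_eq_square)
    from this[of ?p ?q]
    have "(cmod ((?p + ?q) / 2))\<^sup>2 * real_of_int 1 + (cmod ((?p - ?q) / 2))\<^sup>2 * real_of_int (- 1) = Re (?q * cnj ?p)"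
      by simp
    moreover have "final_state d \<Phi> e (z(Ctl := 0, Sys := i)) = (?p + ?q) / 2"
      "final_state d \<Phi> e (z(Ctl := 1, Sys := i)) = (?p - ?q) / 2"
      using f[of 0] f[of 1] by simp_all
    moreover have "test_record (z(Ctl := 0, Sys := i)) = 1" "test_record (z(Ctl := 1, Sys := i)) = - 1"
      using t[of 0] t[of 1] by simp_all
    ultimately show "?g (z(Ctl := 0, Sys := i)) + ?g (z(Ctl := 1, Sys := i)) = Re ((?M *\<^sub>v \<psi>) $ i * cnj (\<psi> $ i))"
      by (simp only:)
  qed simp
  also have "\<dots> = Re (quad_form ?M \<psi>)"
    using \<psi>(1) by (simp add: quad_form_def scalar_prod_def lessThan_atLeast0)
  finally show ?thesis .
qed

end

section \<open>Averaging over the noise\<close>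

text \<open>Fubini, one coordinate at a time. The bound and the averaging rule are demanded for
  every \<open>e\<close>, so that they survive setting a coordinate to zero; as \<open>c i\<close>
  does not depend on \<open>e\<close>, the factors multiply.\<close>

lemma integral_PiM_eliminate:
  fixes f :: "('i \<Rightarrow> real) \<Rightarrow> complex" and M :: "'i \<Rightarrow> real measure"
  assumes M: "\<And>i. prob_space (M i)" and S: "\<And>i. sets (M i) = sets borel" and "finite J"
    and "f \<in> borel_measurable (PiM J M)" "\<And>e. cmod (f e) \<le> B"
    and "\<And>e i. i \<in> J \<Longrightarrow> (\<integral>t. f (e(i := t)) \<partial>M i) = c i * f (e(i := 0))"
  shows "(\<integral>e. f e \<partial>PiM J M) = (\<Prod>i\<in>J. c i) * f (\<lambda>i\<in>J. 0)"
  using assms(3-)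
proof (induction J arbitrary: f rule: finite_induct)
  case empty
  interpret product_prob_space M "{}"
    by (intro product_prob_spaceI M)
  show ?case by (simp add: PiM_empty lebesgue_integral_count_space_finite restrict_def)
next
  case (insert i J)
  interpret P: product_prob_space M "insert i J"
    by (intro product_prob_spaceI M)
  have int: "integrable (PiM (insert i J) M) f"
    by (rule finite_measure.integrable_const_bound[OF prob_space.finite_measure[OF prob_space_PiM[OF M]], of _ B])
      (use insert.prems in auto)
  have "(\<integral>e. f e \<partial>PiM (insert i J) M) = (\<integral>e. (\<integral>t. f (e(i := t)) \<partial>M i) \<partial>PiM J M)"
    by (rule P.product_integral_insert[OF insert.hyps int])
  also have "\<dots> = (\<integral>e. c i * f (e(i := 0)) \<partial>PiM J M)"
    by (rule Bochner_Integration.integral_cong[OF refl]) (rule insert.prems(3), simp)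
  also have "\<dots> = c i * (\<integral>e. f (e(i := 0)) \<partial>PiM J M)"
    by simp
  also have "(\<integral>e. f (e(i := 0)) \<partial>PiM J M) = (\<Prod>i\<in>J. c i) * f ((\<lambda>i\<in>J. 0)(i := 0))"
  proof (rule insert.IH)
    show "(\<lambda>e. f (e(i := 0))) \<in> borel_measurable (PiM J M)"
    proof (rule measurable_compose[OF _ insert.prems(1)])
      have "(0::real) \<in> space (M i)" using sets_eq_imp_space_eq[OF S] by auto
      then have "(\<lambda>e. (e, 0::real)) \<in> PiM J M \<rightarrow>\<^sub>M PiM J M \<Otimes>\<^sub>M M i" by simp
      from measurable_compose[OF this measurable_add_dim]
      show "(\<lambda>e. e(i := 0)) \<in> PiM J M \<rightarrow>\<^sub>M PiM (insert i J) M" by simp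
    qed
    show "cmod (f (e(i := 0))) \<le> B" for e by (rule insert.prems)
    show "(\<integral>t. f ((e(j := t))(i := 0)) \<partial>M j) = c j * f ((e(j := 0))(i := 0))" if "j \<in> J" for e j
    proof -
      have "j \<noteq> i" using that insert.hyps by auto
      then have "(e(j := t))(i := 0) = (e(i := 0))(j := t)" for t by (rule fun_upd_twist)
      then show ?thesis using insert.prems(3)[of j "e(i := 0)"] that by (simp del: fun_upd_apply)
    qed
  qed
  also have "(\<lambda>i\<in>J. 0)(i := 0) = (\<lambda>i\<in>insert i J. 0::real)" by auto
  finally show ?case using insert.hyps by (simp add: mult.assoc)
qed

lemma qsp_polys_cong:
  "(\<And>j. 1 \<le> j \<Longrightarrow> j \<le> k \<Longrightarrow> \<Phi> j = \<Psi> j) \<Longrightarrow> qsp_polys \<Phi> k = qsp_polys \<Psi> k"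
  by (induction k) auto

lemma cis_shift: "cis (\<phi> + t) = of_real (cos t) * cis \<phi> + of_real (sin t) * cis (\<phi> + pi / 2)"
  by (simp add: complex_eq_iff cos_add sin_add)

lemma cis_minus_shift: "cis (- \<phi> - t) = of_real (cos t) * cis (- \<phi>) + of_real (sin t) * cis (- \<phi> - pi / 2)"
  by (simp add: complex_eq_iff cos_add sin_add cos_diff sin_diff)

text \<open>The phase with index \<open>i\<close> enters in a single step, through
  \<open>cis\<close> of its value and of its negative. Both are combinations, with weights cos t and
  sin t, of their values at \<open>\<phi>\<close> and at \<open>\<phi> + pi / 2\<close>, and all
  later steps are linear in the pair.\<close>

lemma qsp_polys_affine:
  assumes "1 \<le> i" "i \<le> k"
  shows "fst (qsp_polys (\<Phi>(i := \<phi> + t)) k) = Polynomial.smult (of_real (cos t)) (fst (qsp_polys (\<Phi>(i := \<phi>)) k))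
      + Polynomial.smult (of_real (sin t)) (fst (qsp_polys (\<Phi>(i := \<phi> + pi / 2)) k)) \<and>
    snd (qsp_polys (\<Phi>(i := \<phi> + t)) k) = Polynomial.smult (of_real (cos t)) (snd (qsp_polys (\<Phi>(i := \<phi>)) k))
      + Polynomial.smult (of_real (sin t)) (snd (qsp_polys (\<Phi>(i := \<phi> + pi / 2)) k))"
  using assms
proof (induction k)
  case (Suc k)
  let ?c = "complex_of_real (cos t)" and ?s = "complex_of_real (sin t)"
  show ?case
  proof (cases "i = Suc k")
    case True
    have c: "qsp_polys (\<Phi>(i := x)) k = qsp_polys \<Phi> k" for x
      by (rule qsp_polys_cong) (use True in auto)
    obtain P Q where PQ: "qsp_polys \<Phi> k = (P, Q)" by fastforce
    show ?thesis
      unfolding True[symmetric] qsp_polys.simps(2)[of _ k, folded True]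
      by (simp add: c PQ cis_shift[of \<phi> t] cis_minus_shift[of \<phi> t] smult_add_left)
  next
    case False
    then have i: "i \<le> k" using Suc.prems by simp
    obtain P0 Q0 where 0: "qsp_polys (\<Phi>(i := \<phi>)) k = (P0, Q0)" by fastforce
    obtain P1 Q1 where 1: "qsp_polys (\<Phi>(i := \<phi> + pi / 2)) k = (P1, Q1)" by fastforce
    have "qsp_polys (\<Phi>(i := \<phi> + t)) k = (Polynomial.smult ?c P0 + Polynomial.smult ?s P1,
        Polynomial.smult ?c Q0 + Polynomial.smult ?s Q1)"
      using Suc.IH[OF Suc.prems(1) i] 0 1 by (metis fst_conv prod.collapse snd_conv)
    moreover have "(\<Phi>(i := x)) (Suc k) = \<Phi> (Suc k)" for x using False by simp
    ultimately show ?thesis unfolding qsp_polys.simps 0 1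
      by (simp add: smult_add_right smult_diff_right mult.commute algebra_simps del: fun_upd_apply)
  qed
qed simp

text \<open>A new coefficient combines at most three old ones with weights of modulus 1. The bound
  is crude but uniform in the phases, which yields integrability over the noise.\<close>

lemma qsp_polys_bound:
  "cmod (coeff (fst (qsp_polys \<Phi> k)) r) \<le> 3 ^ k \<and> cmod (coeff (snd (qsp_polys \<Phi> k)) r) \<le> 3 ^ k"
proof (induction k arbitrary: r)
  case 0
  then show ?case by (simp add: one_pCons coeff_pCons split: nat.split)
next
  case (Suc k)
  obtain P Q where PQ: "qsp_polys \<Phi> k = (P, Q)" by fastforce
  have P: "cmod (coeff (pCons 0 P) r) \<le> 3 ^ k" "cmod (coeff P r) \<le> 3 ^ k" for r
    using Suc[of r] Suc[of "r - 1"] PQ by (auto simp: coeff_pCons split: nat.split)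
  have Q: "cmod (coeff (pCons 0 Q) r) \<le> 3 ^ k" "cmod (coeff Q r) \<le> 3 ^ k" for r
    using Suc[of r] Suc[of "r - 1"] PQ by (auto simp: coeff_pCons split: nat.split)
  have QQ: "cmod (coeff (pCons 0 (pCons 0 Q)) r) \<le> 3 ^ k"
    using Q(1)[of "r - 1"] by (cases r) auto
  have "cmod (coeff (pCons 0 P) r + (coeff Q r - coeff (pCons 0 (pCons 0 Q)) r)) \<le> 3 ^ k + (3 ^ k + 3 ^ k)"
    by (intro order_trans[OF norm_triangle_ineq] add_mono order_trans[OF norm_triangle_ineq4] P Q QQ)
  moreover have "cmod (coeff P r - coeff (pCons 0 Q) r) \<le> 3 ^ k + 3 ^ k"
    by (intro order_trans[OF norm_triangle_ineq4] add_mono P Q)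
  then have "cmod (coeff P r - coeff (pCons 0 Q) r) \<le> 3 * 3 ^ k"
    by (rule order_trans) simp
  ultimately show ?case by (simp add: PQ norm_mult)
qed

text \<open>Any bound that is independent of the phases serves: it fixes the range of summation in
  the matrix entries.\<close>

lemma qsp_polys_degree: "degree (fst (qsp_polys \<Phi> k)) \<le> 2 * k \<and> degree (snd (qsp_polys \<Phi> k)) \<le> 2 * k"
proof (induction k)
  case (Suc k)
  obtain P Q where PQ: "qsp_polys \<Phi> k = (P, Q)" by fastforce
  have "degree (pCons 0 P) \<le> 2 * Suc k" "degree (pCons 0 Q) \<le> 2 * Suc k" "degree P \<le> 2 * Suc k" "degree Q \<le> 2 * Suc k"
    "degree (pCons 0 (pCons 0 Q)) \<le> 2 * Suc k"
    using Suc PQ by (auto intro!: order_trans[OF degree_pCons_le])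
  then show ?case
    by (auto simp: PQ intro!: order_trans[OF degree_smult_le] degree_add_le degree_diff_le)
qed simp

definition noise_index :: "nat \<Rightarrow> (nat \<times> nat) set" where
  "noise_index d = {1..4} \<times> {1..d}"

text \<open>Averaging over a symmetric error kills the sine part and multiplies the cosine part by \<open>E cos e\<close>, so
  such a function is averaged by setting all errors to zero and multiplying by the product of the \<open>E cos e\<^sub>j\<close>.\<close>

locale noise_affine =
  fixes d k :: nat and N :: "(nat \<times> nat \<Rightarrow> real) measure" and g :: "(nat \<times> nat \<Rightarrow> real) \<Rightarrow> complex"
  assumes measurable: "g \<in> borel_measurable N"
    and bounded: "\<exists>B. \<forall>e. cmod (g e) \<le> B"
    and indep: "k' \<noteq> k \<Longrightarrow> g (e((k', j) := t)) = g e"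
    and affine: "j \<in> {1..d} \<Longrightarrow> g (e((k, j) := t)) =
      of_real (cos t) * g (e((k, j) := 0)) + of_real (sin t) * g (e((k, j) := pi / 2))"

lemma (in noise_affine) noise_affine_cnj: "noise_affine d k N (\<lambda>e. cnj (g e))"
proof
  show "(\<lambda>e. cnj (g e)) \<in> borel_measurable N"
    by (rule measurable_compose[OF measurable])
      (intro borel_measurable_continuous_onI continuous_on_cnj continuous_on_id)
  show "\<exists>B. \<forall>e. cmod (cnj (g e)) \<le> B" using bounded by simp
  show "cnj (g (e((k', j) := t))) = cnj (g e)" if "k' \<noteq> k" for e k' j t
    using indep[OF that] by simp
  show "cnj (g (e((k, j) := t))) =
    of_real (cos t) * cnj (g (e((k, j) := 0))) + of_real (sin t) * cnj (g (e((k, j) := pi / 2)))" if "j \<in> {1..d}" for e j t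
    by (subst affine[OF that]) simp
qed

lemma coeff_qsp_measurable:
  assumes "\<And>j. 1 \<le> j \<Longrightarrow> j \<le> k \<Longrightarrow> (\<lambda>e. F e j) \<in> borel_measurable N"
  shows "(\<lambda>e. coeff (fst (qsp_polys (F e) k)) r) \<in> borel_measurable N \<and>
    (\<lambda>e. coeff (snd (qsp_polys (F e) k)) r) \<in> borel_measurable N"
  using assms
proof (induction k arbitrary: r)
  case (Suc k)
  let ?P = "\<lambda>e. fst (qsp_polys (F e) k)" and ?Q = "\<lambda>e. snd (qsp_polys (F e) k)"
  have [measurable]: "(\<lambda>e. coeff (?P e) r) \<in> borel_measurable N" "(\<lambda>e. coeff (?Q e) r) \<in> borel_measurable N" for r
    using Suc.IH Suc.prems by auto
  have p0: "(\<lambda>e. coeff (pCons 0 (R e)) r) \<in> borel_measurable N"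
    if "\<And>r. (\<lambda>e. coeff (R e) r) \<in> borel_measurable N" for R :: "'a \<Rightarrow> complex poly" and r
    using that by (cases r) auto
  have [measurable]: "(\<lambda>e. coeff (pCons 0 (?P e)) r) \<in> borel_measurable N" "(\<lambda>e. coeff (pCons 0 (?Q e)) r) \<in> borel_measurable N"
    "(\<lambda>e. coeff (pCons 0 (pCons 0 (?Q e))) r) \<in> borel_measurable N" for r
    by (intro p0; measurable)+
  have [measurable]: "(\<lambda>e. F e (Suc k)) \<in> borel_measurable N" using Suc.prems by simp
  have cis: "cis \<in> borel_measurable borel"
    by (intro borel_measurable_continuous_onI continuous_intros)
  have [measurable]: "(\<lambda>e. cis (F e (Suc k))) \<in> borel_measurable N" "(\<lambda>e. cis (- F e (Suc k))) \<in> borel_measurable N"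
    by (rule measurable_compose[OF _ cis], measurable)+
  show ?case
    by (simp add: case_prod_beta)
qed simp

lemma noise_affine_qsp_block:
  assumes A: "i < dim_row A" "j < dim_row A" and k: "k \<in> {1..4}"
    and N: "\<And>i. i \<in> noise_index d \<Longrightarrow> (\<lambda>e. e i) \<in> borel_measurable N"
  shows "noise_affine d k N (\<lambda>e. qsp_block d \<Phi> e A k $$ (i, j))"
proof -
  let ?P = "\<lambda>e. fst (qsp_polys (\<lambda>l. \<Phi> l + e (k, l)) d)"
  have eq: "qsp_block d \<Phi> e A k $$ (i, j) = (\<Sum>r\<le>2 * d. coeff (?P e) r * (A ^\<^sub>m r) $$ (i, j))" for e
    unfolding qsp_block_def using qsp_polys_degree by (intro cmat_poly_index A) auto
  have "(\<lambda>e. coeff (?P e) r) \<in> borel_measurable N" for r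
  proof (rule conjunct1[OF coeff_qsp_measurable])
    fix l assume "1 \<le> l" "l \<le> d"
    then have "(\<lambda>e. e (k, l)) \<in> borel_measurable N" using k by (intro N) (simp add: noise_index_def)
    then show "(\<lambda>e. \<Phi> l + e (k, l)) \<in> borel_measurable N" by simp
  qed
  then have m: "(\<lambda>e. qsp_block d \<Phi> e A k $$ (i, j)) \<in> borel_measurable N" unfolding eq by simp
  show ?thesis
  proof (rule noise_affine.intro[OF m])
    show "\<exists>B. \<forall>e. cmod (qsp_block d \<Phi> e A k $$ (i, j)) \<le> B"
      unfolding eq
      by (intro exI[of _ "\<Sum>r\<le>2 * d. 3 ^ d * cmod ((A ^\<^sub>m r) $$ (i, j))"] allI order_trans[OF norm_sum] sum_mono) (simp add: norm_mult mult_right_mono qsp_polys_bound)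
    show "qsp_block d \<Phi> (e((k', l) := t)) A k $$ (i, j) = qsp_block d \<Phi> e A k $$ (i, j)" if "k' \<noteq> k" for e k' l t
    proof -
      have "(e((k', l) := t)) (k, m) = e (k, m)" for m using that by simp
      then show ?thesis by (simp only: qsp_block_def)
    qed
    show "qsp_block d \<Phi> (e((k, l) := t)) A k $$ (i, j) =
      of_real (cos t) * qsp_block d \<Phi> (e((k, l) := 0)) A k $$ (i, j) +
      of_real (sin t) * qsp_block d \<Phi> (e((k, l) := pi / 2)) A k $$ (i, j)" if "l \<in> {1..d}" for e l t
    proof -
      let ?F = "\<lambda>m. \<Phi> m + e (k, m)"
      have u: "(\<lambda>m. \<Phi> m + (e((k, l) := t)) (k, m)) = ?F(l := \<Phi> l + t)" for t
        by auto
      have aff: "fst (qsp_polys (?F(l := \<Phi> l + t)) d) = Polynomial.smult (of_real (cos t)) (fst (qsp_polys (?F(l := \<Phi> l + 0)) d))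
        + Polynomial.smult (of_real (sin t)) (fst (qsp_polys (?F(l := \<Phi> l + pi / 2)) d))"
        using qsp_polys_affine[of l d ?F "\<Phi> l" t] that by simp
      show ?thesis
        unfolding eq u aff by (simp only: coeff_add coeff_smult sum_distrib_left sum.distrib distrib_right mult.assoc)
    qed
  qed
qed

lemma symmetric_sin:
  assumes "symmetric_law M"
  shows "(\<integral>x. sin x \<partial>M) = 0"
proof -
  have s: "sets M = sets borel" and d: "distr M borel uminus = M"
    using assms by (auto simp: symmetric_law_def)
  have "(\<integral>x. sin x \<partial>M) = (\<integral>x. sin x \<partial>distr M borel uminus)" using d by simp
  also have "\<dots> = (\<integral>x. sin (- x) \<partial>M)"
    by (rule integral_distr) (simp_all add: measurable_cong_sets[OF s refl])
  finally show ?thesis by simp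
qed

lemma symmetric_affine:
  assumes "symmetric_law M"
  shows "(\<integral>t. of_real (cos t) * a + of_real (sin t) * b \<partial>M) = of_real (\<integral>t. cos t \<partial>M) * (a :: complex)"
proof -
  interpret prob_space M using assms by (simp add: symmetric_law_def)
  have s: "sets M = sets borel" using assms by (simp add: symmetric_law_def)
  have m: "cos \<in> borel_measurable M" "sin \<in> borel_measurable M"
    by (simp_all add: measurable_cong_sets[OF s refl])
  have c: "integrable M (\<lambda>t. cos t)" and si: "integrable M (\<lambda>t. sin t)"
    by (rule integrable_const_bound[of _ 1]; use m in simp)+
  have "(\<integral>t. of_real (cos t) * a + of_real (sin t) * b \<partial>M) = (\<integral>t. of_real (cos t) * a \<partial>M) + (\<integral>t. of_real (sin t) * b \<partial>M)"
    by (rule Bochner_Integration.integral_add) (use c si in auto)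
  then show ?thesis using symmetric_sin[OF assms] by simp
qed

lemma (in noise_affine) average:
  assumes "symmetric_law M" "j \<in> {1..d}"
  shows "(\<integral>t. g (e((k, j) := t)) \<partial>M) = of_real (\<integral>t. cos t \<partial>M) * g (e((k, j) := 0))"
  by (subst affine[OF assms(2)]) (rule symmetric_affine[OF assms(1)])

text \<open>Since \<open>k1 \<noteq> k2\<close>, at most one of the two functions depends on any
  given error. Each error of the samples \<open>k1\<close> and \<open>k2\<close> thus contributes
  its mean cosine and every other error the factor 1, so each of the two samples yields one
  \<open>mean_cos\<close>.\<close>

lemma noise_expectation:
  assumes sym: "\<And>j. symmetric_law (M j)"
    and "k1 \<in> {1..4}" "k2 \<in> {1..4}" "k1 \<noteq> k2"
    and N: "N = PiM (noise_index d) (\<lambda>(k, j). M j)"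
    and g: "noise_affine d k1 N g1" "noise_affine d k2 N g2"
  shows "(\<integral>e. g1 e * g2 e \<partial>N) = of_real (mean_cos d M ^ 2) * (g1 (\<lambda>i\<in>noise_index d. 0) * g2 (\<lambda>i\<in>noise_index d. 0))"
proof -
  have M: "prob_space (M j)" "sets (M j) = sets borel" for j using sym by (auto simp: symmetric_law_def)
  obtain B1 B2 where B: "\<And>e. cmod (g1 e) \<le> B1" "\<And>e. cmod (g2 e) \<le> B2"
    using noise_affine.bounded[OF g(1)] noise_affine.bounded[OF g(2)] by blast
  let ?c = "\<lambda>i. if fst i = k1 \<or> fst i = k2 then complex_of_real (\<integral>t. cos t \<partial>M (snd i)) else 1"
  have "(\<integral>e. g1 e * g2 e \<partial>N) = (\<Prod>i\<in>noise_index d. ?c i) * (g1 (\<lambda>i\<in>noise_index d. 0) * g2 (\<lambda>i\<in>noise_index d. 0))"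
    unfolding N
  proof (rule integral_PiM_eliminate)
    show "prob_space (case i of (k, j) \<Rightarrow> M j)" "sets (case i of (k, j) \<Rightarrow> M j) = sets borel" for i using M by (cases i; auto)+
    show "(\<lambda>e. g1 e * g2 e) \<in> borel_measurable (PiM (noise_index d) (\<lambda>(k, j). M j))"
      using noise_affine.measurable[OF g(1)] noise_affine.measurable[OF g(2)] unfolding N by (rule borel_measurable_times)
    show "cmod (g1 e * g2 e) \<le> B1 * B2" for e
      unfolding norm_mult by (intro mult_mono B) (auto intro: order_trans[OF norm_ge_zero B(1)])
    fix e :: "nat \<times> nat \<Rightarrow> real" and i assume "i \<in> noise_index d"
    then obtain k j where i: "i = (k, j)" "j \<in> {1..d}" by (auto simp: noise_index_def)
    interpret prob_space "M j" by (rule M)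
    have sy: "symmetric_law (M j)" by (rule sym)
    have "(\<integral>t. g1 (e((k, j) := t)) * g2 (e((k, j) := t)) \<partial>M j) = ?c (k, j) * (g1 (e((k, j) := 0)) * g2 (e((k, j) := 0)))"
    proof -
      consider "k = k1" | "k = k2" | "k \<noteq> k1" "k \<noteq> k2" by blast
      then show ?thesis
      proof cases
        case 1
        then have "k \<noteq> k2" using assms(4) by simp
        then show ?thesis
          using noise_affine.average[OF g(1) sy i(2), of e, folded 1] 1
          by (simp add: noise_affine.indep[OF g(2)] del: fun_upd_apply)
      next
        case 2
        then have "k \<noteq> k1" using assms(4) by simp
        then show ?thesis
          using noise_affine.average[OF g(2) sy i(2), of e, folded 2] 2
          by (simp add: noise_affine.indep[OF g(1)] del: fun_upd_apply)
      next
        case 3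
        then show ?thesis
          using prob_space by (simp add: noise_affine.indep[OF g(1)] noise_affine.indep[OF g(2)] del: fun_upd_apply)
      qed
    qed
    then show "(\<integral>t. g1 (e(i := t)) * g2 (e(i := t)) \<partial>(case i of (k, j) \<Rightarrow> M j)) = ?c i * (g1 (e(i := 0)) * g2 (e(i := 0)))"
      using i by simp
  qed (simp add: noise_index_def)
  also have "(\<Prod>i\<in>noise_index d. ?c i) = (\<Prod>k\<in>{1..4}. if k = k1 \<or> k = k2 then complex_of_real (mean_cos d M) else 1)"
  proof -
    have "(\<Prod>i\<in>noise_index d. ?c i) = (\<Prod>k\<in>{1..4}. \<Prod>j\<in>{1..d}. ?c (k, j))"
      unfolding noise_index_def prod.cartesian_product by (intro prod.cong refl) auto
    also have "\<dots> = (\<Prod>k\<in>{1..4}. if k = k1 \<or> k = k2 then complex_of_real (mean_cos d M) else 1)"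
      by (intro prod.cong refl) (auto simp: mean_cos_def)
    finally show ?thesis .
  qed
  also have "\<dots> = (\<Prod>k\<in>{1..4} \<inter> {k. k = k1 \<or> k = k2}. complex_of_real (mean_cos d M))"
    by (subst prod.inter_restrict) (auto intro!: prod.cong)
  also have "{1..4} \<inter> {k. k = k1 \<or> k = k2} = {k1, k2}" using assms(2,3) by auto
  finally show ?thesis using assms(4) by (simp add: power2_eq_square restrict_def)
qed

section \<open>Concentration and run count\<close>

text \<open>The records lie in an interval of length 2, so the squared lengths add up to 4 N; this
  gives the exponent - N \<eta>^2 / 2.\<close>

lemma hoeffding_iid:
  fixes L :: "int measure" and N :: nat and \<eta> :: real
  assumes L: "prob_space L" "sets L = UNIV" and b: "AE r in L. \<bar>real_of_int r\<bar> \<le> 1" and "N > 0" "\<eta> > 0"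
  shows "measure (PiM {..<N} (\<lambda>_. L))
    {\<omega> \<in> space (PiM {..<N} (\<lambda>_. L)). \<bar>(\<Sum>i<N. real_of_int (\<omega> i)) / N - (\<integral>r. real_of_int r \<partial>L)\<bar> \<ge> \<eta>}
    \<le> 2 * exp (- (N * \<eta>\<^sup>2) / 2)"
proof -
  let ?P = "PiM {..<N} (\<lambda>_. L)"
  interpret P: prob_space ?P by (intro prob_space_PiM L)
  have meas: "f \<in> L \<rightarrow>\<^sub>M borel" for f :: "int \<Rightarrow> real"
    by (simp add: measurable_def L(2))
  have comp: "(\<lambda>\<omega>. \<omega> i) \<in> ?P \<rightarrow>\<^sub>M L" if "i < N" for i
    using that by simp
  have ne: "{..<N} \<noteq> {}" using assms(4) by auto
  \<comment> \<open>Independence of the coordinates: their joint law, the law of the identity, is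
    the product of their marginal laws.\<close>
  have "distr ?P ?P (\<lambda>\<omega>. \<lambda>i\<in>{..<N}. \<omega> i) = ?P"
  proof -
    have "distr ?P ?P (\<lambda>\<omega>. \<lambda>i\<in>{..<N}. \<omega> i) = distr ?P ?P (\<lambda>\<omega>. \<omega>)"
      by (rule distr_cong) (auto simp: space_PiM PiE_def extensional_restrict)
    then show ?thesis by simp
  qed
  also have "?P = (\<Pi>\<^sub>M i\<in>{..<N}. distr ?P L (\<lambda>\<omega>. \<omega> i))"
    by (intro PiM_cong refl distr_PiM_component[symmetric] L) auto
  finally have "P.indep_vars (\<lambda>_. L) (\<lambda>i \<omega>. \<omega> i) {..<N}"
    by (subst P.indep_vars_iff_distr_eq_PiM'[OF ne comp]) auto
  then have indep: "P.indep_vars (\<lambda>_. borel) (\<lambda>i \<omega>. real_of_int (\<omega> i)) {..<N}"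
    using meas by (intro P.indep_vars_compose2[where Y = "\<lambda>_. real_of_int"]) auto
  have AEb: "AE \<omega> in ?P. real_of_int (\<omega> i) \<in> {-1..1}" if "i < N" for i
  proof -
    have "AE \<omega> in ?P. \<bar>real_of_int (\<omega> i)\<bar> \<le> 1"
      using that by (intro AE_PiM_component L b) auto
    then show ?thesis by (rule eventually_mono) auto
  qed
  have ex: "P.expectation (\<lambda>\<omega>. real_of_int (\<omega> i)) = (\<integral>r. real_of_int r \<partial>L)" if "i < N" for i
  proof -
    have "(\<integral>r. real_of_int r \<partial>L) = (\<integral>r. real_of_int r \<partial>distr ?P L (\<lambda>\<omega>. \<omega> i))"
      using that by (subst distr_PiM_component) (auto intro: L)
    also have "\<dots> = P.expectation (\<lambda>\<omega>. real_of_int (\<omega> i))"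
      by (rule integral_distr[OF comp[OF that] meas])
    finally show ?thesis by simp
  qed
  let ?m = "\<integral>r. real_of_int r \<partial>L"
  interpret H: Hoeffding_ineq ?P "{..<N}" "\<lambda>i \<omega>. real_of_int (\<omega> i)" "\<lambda>_. -1" "\<lambda>_. 1" "real N * ?m"
    by unfold_locales (use indep AEb ex in auto)
  have "{\<omega> \<in> space ?P. \<bar>(\<Sum>i<N. real_of_int (\<omega> i)) / N - ?m\<bar> \<ge> \<eta>}
    = {\<omega> \<in> space ?P. \<bar>(\<Sum>i<N. real_of_int (\<omega> i)) - N * ?m\<bar> \<ge> N * \<eta>}"
  proof -
    have "\<bar>x / N - ?m\<bar> \<ge> \<eta> \<longleftrightarrow> \<bar>x - N * ?m\<bar> \<ge> N * \<eta>" for x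
    proof -
      have "x - N * ?m = N * (x / N - ?m)" using assms(4) by (simp add: field_simps)
      then have "\<bar>x - N * ?m\<bar> = N * \<bar>x / N - ?m\<bar>" by (simp add: abs_mult)
      then show ?thesis using assms(4) by simp
    qed
    then show ?thesis by simp
  qed
  also have "measure ?P \<dots> \<le> 2 * exp (-2 * (N * \<eta>)\<^sup>2 / (\<Sum>i<N. (1 - - 1)\<^sup>2))"
    using assms(4,5) by (intro H.Hoeffding_ineq_abs_ge) auto
  also have "-2 * (N * \<eta>)\<^sup>2 / (\<Sum>i<N. (1 - - 1)\<^sup>2) = - (N * \<eta>\<^sup>2) / 2"
    using assms(4) by (simp add: power2_eq_square field_simps)
  finally show ?thesis .
qed

lemma has_bochner_integralI:
  "integrable M f \<Longrightarrow> integral\<^sup>L M f = x \<Longrightarrow> has_bochner_integral M f x"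
  by (simp add: has_bochner_integral_iff)

lemma quad_form_sum:
  assumes "M \<in> carrier_mat n n" "\<psi> \<in> carrier_vec n"
  shows "quad_form M \<psi> = (\<Sum>i<n. \<Sum>j<n. M $$ (i, j) * (\<psi> $ j * cnj (\<psi> $ i)))"
  using assms by (simp add: quad_form_def scalar_prod_def lessThan_atLeast0 sum_distrib_right mult.assoc)

lemma quad_form_hermitian_real:
  assumes "M \<in> carrier_mat n n" "\<psi> \<in> carrier_vec n" "mat_adjoint M = M"
  shows "quad_form M \<psi> \<in> \<real>"
proof -
  have "cnj (M $$ (i, j)) = M $$ (j, i)" if "i < n" "j < n" for i j
    using that assms(1) mat_adjoint_index[of j M i] unfolding assms(3) by simp
  then have "cnj (quad_form M \<psi>) = (\<Sum>i<n. \<Sum>j<n. M $$ (j, i) * (\<psi> $ i * cnj (\<psi> $ j)))"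
    unfolding quad_form_sum[OF assms(1,2)] by (simp add: mult.commute mult.left_commute)
  also have "\<dots> = quad_form M \<psi>"
    unfolding quad_form_sum[OF assms(1,2)] by (rule sum.swap)
  finally show ?thesis by (simp add: Reals_cnj_iff)
qed

lemma symmetric_law_return: "symmetric_law (return borel 0)"
  unfolding symmetric_law_def by (auto simp: prob_space_return distr_return)

locale noisy_test = encoded +
  fixes d :: nat and \<Phi> :: "nat \<Rightarrow> real" and \<mu> :: "nat \<Rightarrow> real measure" and \<psi> :: "complex vec"
  assumes \<psi>: "\<psi> \<in> carrier_vec n" "Upsi *\<^sub>v unit_vec n 0 = \<psi>"
    and sym: "\<And>j. j \<in> {1..d} \<Longrightarrow> symmetric_law (\<mu> j)"
begin

text \<open>The hypotheses constrain \<open>\<mu> j\<close> for \<open>j \<in> {1..d}\<close> only; \<open>\<nu>\<close> makes all factors probability measures.\<close>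

definition "\<nu> j = (if j \<in> {1..d} then \<mu> j else return borel 0)"

lemma sym_\<nu>: "symmetric_law (\<nu> j)"
  by (simp add: \<nu>_def sym symmetric_law_return)

lemma \<nu>: "prob_space (\<nu> j)" "sets (\<nu> j) = sets borel"
  using sym_\<nu>[of j] by (auto simp: symmetric_law_def)

abbreviation "Noise \<equiv> noise_law d \<mu>"

lemma Noise_eq: "Noise = PiM (noise_index d) (\<lambda>(k, j). \<nu> j)"
  unfolding noise_law_def noise_index_def by (intro PiM_cong refl) (auto simp: \<nu>_def)

lemma mean_cos_\<nu>: "mean_cos d \<nu> = mean_cos d \<mu>"
  unfolding mean_cos_def by (intro prod.cong refl) (simp add: \<nu>_def)

lemma prob_Noise: "prob_space Noise"
  unfolding Noise_eq using \<nu> by (intro prob_space_PiM) (auto split: prod.splits)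

lemma Noise_component: "i \<in> noise_index d \<Longrightarrow> (\<lambda>e. e i) \<in> borel_measurable Noise"
proof -
  assume i: "i \<in> noise_index d"
  have "(\<lambda>e. e i) \<in> Noise \<rightarrow>\<^sub>M (case i of (k, j) \<Rightarrow> \<nu> j)"
    unfolding Noise_eq by (rule measurable_component_singleton[OF i])
  moreover have s: "sets (case i of (k, j) \<Rightarrow> \<nu> j) = sets borel" using \<nu> by (cases i) auto
  ultimately show ?thesis unfolding measurable_cong_sets[OF refl s] by blast
qed

abbreviation "X k e \<equiv> qsp_block d \<Phi> e A k"
abbreviation "Obs e \<equiv> observable_block d \<Phi> A Ob e"
abbreviation "e0 \<equiv> (\<lambda>i\<in>noise_index d. 0 :: real)"

lemma X_carrier: "X k e \<in> carrier_mat n n"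
  unfolding qsp_block_def using A by simp

lemma Obs_carrier: "Obs e \<in> carrier_mat n n"
  using encodes_observable[of d \<Phi> e] by (auto simp: encodes_def)

text \<open>Exhibits every summand as an entry sum of the left samples times one of the right
  samples times a constant, the form in which the expectation can be taken.\<close>

lemma Obs_index:
  assumes "i < n" "j < n"
  shows "Obs e $$ (i, j) = (\<Sum>m<n. \<Sum>l<n. (X 1 e $$ (i, l) + cnj (X 2 e $$ (l, i))) *
    (X 3 e $$ (m, j) + cnj (X 4 e $$ (j, m))) * (Ob $$ (l, m) / 4))"
proof -
  define L where "L = (1 / 2) \<cdot>\<^sub>m (X 1 e + mat_adjoint (X 2 e))"
  define R where "R = (1 / 2) \<cdot>\<^sub>m (X 3 e + mat_adjoint (X 4 e))"
  have L: "L \<in> carrier_mat n n" and R: "R \<in> carrier_mat n n" using X_carrier by (auto simp: L_def R_def)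
  have Li: "L $$ (i, l) = (X 1 e $$ (i, l) + cnj (X 2 e $$ (l, i))) / 2" if "l < n" for l
    using that assms carrier_matD[OF X_carrier[of e 1]] carrier_matD[OF X_carrier[of e 2]] by (simp add: L_def)
  have Ri: "R $$ (m, j) = (X 3 e $$ (m, j) + cnj (X 4 e $$ (j, m))) / 2" if "m < n" for m
    using that assms carrier_matD[OF X_carrier[of e 3]] carrier_matD[OF X_carrier[of e 4]] by (simp add: R_def)
  have "Obs e = L * Ob * R" by (simp only: observable_block_def L_def R_def)
  then have "Obs e $$ (i, j) = (\<Sum>m<n. (L * Ob) $$ (i, m) * R $$ (m, j))"
    by (simp only: mult_mat_index[OF mult_carrier_mat[OF L Ob] R assms])
  also have "\<dots> = (\<Sum>m<n. (\<Sum>l<n. L $$ (i, l) * Ob $$ (l, m)) * R $$ (m, j))"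
    using assms(1) by (intro sum.cong refl) (simp only: mult_mat_index[OF L Ob] lessThan_iff)
  also have "\<dots> = (\<Sum>m<n. \<Sum>l<n. (X 1 e $$ (i, l) + cnj (X 2 e $$ (l, i))) *
    (X 3 e $$ (m, j) + cnj (X 4 e $$ (j, m))) * (Ob $$ (l, m) / 4))"
    unfolding sum_distrib_right
  proof (intro sum.cong refl)
    fix m l assume ml: "m \<in> {..<n}" "l \<in> {..<n}"
    have "p / 2 * q * (r / 2) = p * r * (q / 4)" for p q r :: complex by simp
    then show "L $$ (i, l) * Ob $$ (l, m) * R $$ (m, j) = (X 1 e $$ (i, l) + cnj (X 2 e $$ (l, i))) *
      (X 3 e $$ (m, j) + cnj (X 4 e $$ (j, m))) * (Ob $$ (l, m) / 4)"
      using ml by (simp only: Li Ri lessThan_iff)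
  qed
  finally show ?thesis .
qed

lemma X_affine: "i < n \<Longrightarrow> j < n \<Longrightarrow> k \<in> {1..4} \<Longrightarrow> noise_affine d k Noise (\<lambda>e. X k e $$ (i, j))"
  using A(1) by (intro noise_affine_qsp_block Noise_component) auto

lemma X_pair:
  assumes "noise_affine d k1 Noise g1" "noise_affine d k2 Noise g2" "k1 \<in> {1..4}" "k2 \<in> {1..4}" "k1 \<noteq> k2"
  shows "has_bochner_integral Noise (\<lambda>e. g1 e * g2 e) (of_real ((mean_cos d \<mu>)\<^sup>2) * (g1 e0 * g2 e0))"
proof (rule has_bochner_integralI)
  obtain B1 B2 where B: "\<And>e. cmod (g1 e) \<le> B1" "\<And>e. cmod (g2 e) \<le> B2"
    using noise_affine.bounded[OF assms(1)] noise_affine.bounded[OF assms(2)] by blast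
  have "cmod (g1 e * g2 e) \<le> B1 * B2" for e
    unfolding norm_mult by (intro mult_mono B) (auto intro: order_trans[OF norm_ge_zero B(1)])
  moreover have "(\<lambda>e. g1 e * g2 e) \<in> borel_measurable Noise"
    using noise_affine.measurable[OF assms(1)] noise_affine.measurable[OF assms(2)] by (rule borel_measurable_times)
  ultimately show "integrable Noise (\<lambda>e. g1 e * g2 e)"
    by (intro finite_measure.integrable_const_bound[OF prob_space.finite_measure[OF prob_Noise], of _ "B1 * B2"]) auto
  show "(\<integral>e. g1 e * g2 e \<partial>Noise) = of_real ((mean_cos d \<mu>)\<^sup>2) * (g1 e0 * g2 e0)"
    using noise_expectation[OF sym_\<nu> assms(3-5) Noise_eq assms(1,2)] by (simp only: mean_cos_\<nu>)
qed

text \<open>Multiplying out leaves the sample pairs (1,3), (1,4), (2,3) and (2,4). Each consists of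
  two different samples, so all four carry the same factor, which can be taken out of the
  sum.\<close>

lemma Obs_expectation:
  assumes "i < n" "j < n"
  shows "has_bochner_integral Noise (\<lambda>e. Obs e $$ (i, j)) (of_real ((mean_cos d \<mu>)\<^sup>2) * Obs e0 $$ (i, j))"
proof -
  let ?\<kappa> = "complex_of_real ((mean_cos d \<mu>)\<^sup>2)"
  let ?F = "\<lambda>e l m. (X 1 e $$ (i, l) + cnj (X 2 e $$ (l, i))) *
      (X 3 e $$ (m, j) + cnj (X 4 e $$ (j, m))) * (Ob $$ (l, m) / 4)"
  have "has_bochner_integral Noise (\<lambda>e. ?F e l m)
      (?\<kappa> * ?F e0 l m)" if "m < n" "l < n" for m l
  proof -
    note aff = X_affine[OF assms(1) that(2), of 1] noise_affine.noise_affine_cnj[OF X_affine[OF that(2) assms(1), of 2]]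
      X_affine[OF that(1) assms(2), of 3] noise_affine.noise_affine_cnj[OF X_affine[OF assms(2) that(1), of 4]]
    have "has_bochner_integral Noise (\<lambda>e. (X 1 e $$ (i, l) * X 3 e $$ (m, j) + X 1 e $$ (i, l) * cnj (X 4 e $$ (j, m))
        + (cnj (X 2 e $$ (l, i)) * X 3 e $$ (m, j) + cnj (X 2 e $$ (l, i)) * cnj (X 4 e $$ (j, m)))) * (Ob $$ (l, m) / 4))
      ((?\<kappa> * (X 1 e0 $$ (i, l) * X 3 e0 $$ (m, j)) + ?\<kappa> * (X 1 e0 $$ (i, l) * cnj (X 4 e0 $$ (j, m)))
        + (?\<kappa> * (cnj (X 2 e0 $$ (l, i)) * X 3 e0 $$ (m, j)) + ?\<kappa> * (cnj (X 2 e0 $$ (l, i)) * cnj (X 4 e0 $$ (j, m))))) * (Ob $$ (l, m) / 4))"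
      by (intro has_bochner_integral_mult_left has_bochner_integral_add X_pair[OF aff(1) aff(3)] X_pair[OF aff(1) aff(4)]
          X_pair[OF aff(2) aff(3)] X_pair[OF aff(2) aff(4)]) auto
    then show ?thesis by (simp only: distrib_left distrib_right mult.assoc add_ac)
  qed
  then have "has_bochner_integral Noise (\<lambda>e. \<Sum>m<n. \<Sum>l<n. ?F e l m)
      (\<Sum>m<n. \<Sum>l<n. ?\<kappa> * ?F e0 l m)"
    by (intro has_bochner_integral_sum) auto
  then show ?thesis unfolding Obs_index[OF assms] sum_distrib_left .
qed

lemma quad_expectation:
  "has_bochner_integral Noise (\<lambda>e. quad_form (Obs e) \<psi>) (of_real ((mean_cos d \<mu>)\<^sup>2) * quad_form (Obs e0) \<psi>)"
proof -
  have "has_bochner_integral Noise (\<lambda>e. \<Sum>i<n. \<Sum>j<n. Obs e $$ (i, j) * (\<psi> $ j * cnj (\<psi> $ i)))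
    (\<Sum>i<n. \<Sum>j<n. of_real ((mean_cos d \<mu>)\<^sup>2) * Obs e0 $$ (i, j) * (\<psi> $ j * cnj (\<psi> $ i)))"
    by (intro has_bochner_integral_sum has_bochner_integral_mult_left Obs_expectation) auto
  then show ?thesis
    unfolding quad_form_sum[OF Obs_carrier \<psi>(1)] by (simp only: sum_distrib_left mult.assoc)
qed

lemma Obs_noiseless:
  assumes "qsp_phases p d \<Phi>"
  shows "Obs e0 = mat_adjoint (mat_poly p A) * Ob * mat_poly p A" "mat_adjoint (mat_poly p A) = mat_poly p A"
proof -
  let ?P = "cmat_poly (fst (qsp_polys \<Phi> d)) A" and ?p = "mat_poly p A"
  have P: "?P \<in> carrier_mat n n" and p: "?p \<in> carrier_mat n n" using A by (auto simp: mat_poly_def)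
  have X: "X k e0 = ?P" if "k \<in> {1..4}" for k
  proof -
    have "qsp_polys (\<lambda>j. \<Phi> j + e0 (k, j)) d = qsp_polys \<Phi> d"
      using that by (intro qsp_polys_cong) (simp add: noise_index_def)
    then show ?thesis by (simp add: qsp_block_def)
  qed
  have half: "(1 / 2) \<cdot>\<^sub>m (?P + mat_adjoint ?P) = ?p"
    unfolding qsp_noiseless[OF A assms] by (rule eq_matI) simp_all
  have "mat_adjoint ((1 / 2) \<cdot>\<^sub>m (?P + mat_adjoint ?P)) = (1 / 2) \<cdot>\<^sub>m (?P + mat_adjoint ?P)"
    by (rule eq_matI) (simp_all add: carrier_matD[OF P] add.commute)
  then show adj: "mat_adjoint ?p = ?p" unfolding half .
  show "Obs e0 = mat_adjoint ?p * Ob * ?p"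
    unfolding adj observable_block_def X[of 1, simplified] X[of 2, simplified] X[of 3, simplified] X[of 4, simplified]
    by (simp add: X half)
qed

section \<open>The law of the record of one run\<close>

definition weight :: "(nat \<times> nat \<Rightarrow> real) \<Rightarrow> int set \<Rightarrow> real" where
  "weight e S = (\<Sum>x\<in>{x \<in> basis ds. test_record x \<in> S}. (cmod (final_state d \<Phi> e x))\<^sup>2)"

definition outcome :: "(nat \<times> nat \<Rightarrow> real) \<Rightarrow> int measure" where
  "outcome e = distr (measure_regs ds (- {Sys}) (final_state d \<Phi> e)) (count_space UNIV) test_record"

lemma record_cases: "test_record x \<in> {-1, 0, 1}"
  by (simp add: test_record_def)

text \<open>Labels are grouped by their measured part and the parts by their record; this is
  consistent because the record of a label depends on the measured part only.\<close>

lemma group_records: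
  "(\<Sum>m\<in>{m \<in> (\<Pi>\<^sub>E r\<in>- {Sys}. {..<ds r}). test_record m \<in> S}. \<Sum>x\<in>{x \<in> basis ds. restrict x (- {Sys}) = m}. h x)
    = (\<Sum>x\<in>{x \<in> basis ds. test_record x \<in> S}. h x)"
proof -
  let ?B = "{x \<in> basis ds. test_record x \<in> S}" and ?T = "{m \<in> (\<Pi>\<^sub>E r\<in>- {Sys}. {..<ds r}). test_record m \<in> S}"
  have fin: "finite ?T" by (intro finite_subset[OF _ finite_PiE[of "- {Sys}" "\<lambda>r. {..<ds r}"]]) auto
  have rb: "restrict x (- {Sys}) \<in> (\<Pi>\<^sub>E r\<in>- {Sys}. {..<ds r})" if "x \<in> basis ds" for x
    using that by (auto simp: mem_basis)
  have im: "(\<lambda>x. restrict x (- {Sys})) ` ?B \<subseteq> ?T"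
  proof (rule image_subsetI)
    fix x assume "x \<in> ?B"
    then show "restrict x (- {Sys}) \<in> ?T" using rb[of x] test_record_restrict[of x] by (simp only: mem_Collect_eq)
  qed
  have "sum h ?B = (\<Sum>m\<in>?T. sum h {x \<in> ?B. restrict x (- {Sys}) = m})"
    using fin im by (intro sum.group[symmetric]) auto
  also have "\<dots> = (\<Sum>m\<in>?T. sum h {x \<in> basis ds. restrict x (- {Sys}) = m})"
  proof (rule sum.cong)
    fix m assume "m \<in> ?T"
    then have "{x \<in> ?B. restrict x (- {Sys}) = m} = {x \<in> basis ds. restrict x (- {Sys}) = m}"
      using test_record_restrict by auto
    then show "sum h {x \<in> ?B. restrict x (- {Sys}) = m} = sum h {x \<in> basis ds. restrict x (- {Sys}) = m}" by simp
  qed simp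
  finally show ?thesis by simp
qed

lemma emeasure_outcome: "emeasure (outcome e) S = ennreal (weight e S)"
proof -
  let ?PP = "\<Pi>\<^sub>E r\<in>- {Sys}. {..<ds r}"
  let ?w = "\<lambda>m. \<Sum>x\<in>{x \<in> basis ds. restrict x (- {Sys}) = m}. (cmod (final_state d \<Phi> e x))\<^sup>2"
  have fin: "finite ?PP" by (intro finite_PiE) auto
  have "emeasure (outcome e) S = emeasure (measure_regs ds (- {Sys}) (final_state d \<Phi> e)) (test_record -` S \<inter> ?PP)"
    unfolding outcome_def by (subst emeasure_distr) (auto simp: measure_regs_def space_point_measure)
  also have "\<dots> = (\<Sum>m\<in>test_record -` S \<inter> ?PP. ennreal (?w m))"
    unfolding measure_regs_def using fin by (intro emeasure_point_measure_finite) auto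
  also have "\<dots> = ennreal (\<Sum>m\<in>test_record -` S \<inter> ?PP. ?w m)"
    by (intro sum_ennreal sum_nonneg) auto
  also have "test_record -` S \<inter> ?PP = {m \<in> ?PP. test_record m \<in> S}" by auto
  also have "(\<Sum>m\<in>{m \<in> ?PP. test_record m \<in> S}. ?w m) = weight e S"
    unfolding weight_def by (rule group_records)
  finally show ?thesis .
qed

lemma weight_UNIV: "weight e UNIV = 1"
  using final_state_norm[of d \<Phi> e] by (simp add: weight_def)

lemma prob_outcome: "prob_space (outcome e)"
proof (rule prob_spaceI)
  have "space (outcome e) = UNIV" by (simp add: outcome_def)
  then show "emeasure (outcome e) (space (outcome e)) = 1" by (simp add: emeasure_outcome weight_UNIV)
qed

lemma weight_split: "weight e S = (\<Sum>v\<in>{-1, 0, 1}. if v \<in> S then weight e {v} else 0)"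
proof -
  have fin: "finite {x \<in> basis ds. test_record x \<in> S}" by (rule finite_subset[OF _ finite_basis]) auto
  have "weight e S = (\<Sum>v\<in>{-1, 0, 1} \<inter> S. \<Sum>x\<in>{x \<in> {x \<in> basis ds. test_record x \<in> S}. test_record x = v}. (cmod (final_state d \<Phi> e x))\<^sup>2)"
    unfolding weight_def using record_cases by (intro sum.group[symmetric] fin) auto
  also have "\<dots> = (\<Sum>v\<in>{-1, 0, 1} \<inter> S. weight e {v})"
    unfolding weight_def by (intro sum.cong) auto
  also have "\<dots> = (\<Sum>v\<in>{-1, 0, 1}. if v \<in> S then weight e {v} else 0)"
    by (rule sum.inter_restrict) simp
  finally show ?thesis .
qed

text \<open>An explicit amplitude, in terms of the entries of the observable, is available only for
  labels with nonzero record. The weight of the record 0 is the complement to the total weight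
  1.\<close>

lemma weight_measurable: "(\<lambda>e. weight e S) \<in> borel_measurable Noise"
proof -
  have Om: "(\<lambda>e. Obs e $$ (i, j)) \<in> borel_measurable Noise" if "i < n" "j < n" for i j
    using Obs_expectation[OF that] by (auto simp: has_bochner_integral_iff)
  have amp: "(\<lambda>e. final_state d \<Phi> e x) \<in> borel_measurable Noise"
    if x: "x \<in> basis ds" "test_record x \<noteq> 0" for x
  proof -
    have z: "x r = 0" if "r \<noteq> Ctl" "r \<noteq> Sys" for r
      using x(2) that by (auto simp: test_record_def split: if_splits)
    have xs: "x Sys < n" using x(1) by (metis mem_basis reg_dim.simps(3))
    have "(Obs e *\<^sub>v \<psi>) $ (x Sys) = (\<Sum>j<n. Obs e $$ (x Sys, j) * \<psi> $ j)" for e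
      using xs Obs_carrier[of e] \<psi>(1) by (simp add: scalar_prod_def lessThan_atLeast0)
    then have "(\<lambda>e. (Obs e *\<^sub>v \<psi>) $ (x Sys)) \<in> borel_measurable Noise"
      using Om xs by (simp add: borel_measurable_sum)
    then show ?thesis
      by (subst measurable_cong[OF final_state_amplitude[OF \<psi> x(1) z]]) auto
  qed
  have w: "(\<lambda>e. weight e {v}) \<in> borel_measurable Noise" if "v \<noteq> 0" for v
    unfolding weight_def using amp that by (intro borel_measurable_sum borel_measurable_power borel_measurable_norm) auto
  have "weight e UNIV = weight e {-1} + (weight e {0} + weight e {1})" for e
    by (subst weight_split) simp
  then have 0: "weight e {0} = 1 - weight e {-1} - weight e {1}" for e
    unfolding weight_UNIV by (simp add: algebra_simps)
  have "(\<lambda>e. weight e {v}) \<in> borel_measurable Noise" for v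
    using w by (cases "v = 0") (auto simp: 0)
  then show ?thesis by (subst weight_split) (intro borel_measurable_sum, simp)
qed

text \<open>Lets integrals and almost sure statements pass through the bind that defines the law of
  a run.\<close>

lemma outcome_kernel: "outcome \<in> Noise \<rightarrow>\<^sub>M subprob_algebra (count_space UNIV)"
proof (rule measurable_subprob_algebra)
  show "subprob_space (outcome e)" for e using prob_outcome by (rule prob_space_imp_subprob_space)
  show "sets (outcome e) = sets (count_space UNIV)" for e by (simp add: outcome_def)
  show "(\<lambda>e. emeasure (outcome e) S) \<in> borel_measurable Noise" for S
    unfolding emeasure_outcome using weight_measurable by simp
qed

abbreviation "Run \<equiv> run_law I ds d \<Phi> \<mu>"

lemma Run_eq: "Run = Noise \<bind> outcome"
  unfolding run_law_def outcome_def[abs_def] final_state_def[abs_def] ..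

lemma prob_Run: "prob_space Run"
  unfolding Run_eq using prob_outcome outcome_kernel by (intro prob_space.prob_space_bind[OF prob_Noise]) auto

lemma sets_Run: "sets Run = UNIV"
proof -
  have "sets (Noise \<bind> outcome) = sets (count_space UNIV)"
    by (rule sets_bind) (use prob_space.not_empty[OF prob_Noise] in \<open>auto simp: outcome_def\<close>)
  then show ?thesis by (simp add: Run_eq)
qed

lemma AE_outcome: "AE r in outcome e. r \<in> {-1, 0, 1}"
  unfolding outcome_def by (subst AE_distr_iff) (use record_cases in \<open>auto simp: measure_regs_def\<close>)

lemma AE_Run: "AE r in Run. \<bar>real_of_int r\<bar> \<le> 1"
proof -
  have "AE r in outcome e. \<bar>real_of_int r\<bar> \<le> 1" for e
    using AE_outcome[of e] by (rule eventually_mono) auto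
  then show ?thesis unfolding Run_eq by (subst AE_bind[OF outcome_kernel]) auto
qed

lemma outcome_mean: "(\<integral>r. f r \<partial>outcome e) = (\<Sum>x\<in>basis ds. (cmod (final_state d \<Phi> e x))\<^sup>2 * f (test_record x))"
  for f :: "int \<Rightarrow> real"
proof -
  let ?PP = "\<Pi>\<^sub>E r\<in>- {Sys}. {..<ds r}"
  let ?h = "\<lambda>x. (cmod (final_state d \<Phi> e x))\<^sup>2"
  let ?w = "\<lambda>m. \<Sum>x\<in>{x \<in> basis ds. restrict x (- {Sys}) = m}. ?h x"
  have fin: "finite ?PP" by (intro finite_PiE) auto
  have "(\<integral>r. f r \<partial>outcome e) = (\<integral>m. f (test_record m) \<partial>measure_regs ds (- {Sys}) (final_state d \<Phi> e))"
    unfolding outcome_def by (rule integral_distr) (auto simp: measure_regs_def)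
  also have "\<dots> = (\<Sum>m\<in>?PP. ?w m *\<^sub>R f (test_record m))"
    unfolding measure_regs_def using fin by (intro lebesgue_integral_point_measure_finite sum_nonneg) auto
  also have "\<dots> = (\<Sum>m\<in>?PP. \<Sum>x\<in>{x \<in> basis ds. restrict x (- {Sys}) = m}. ?h x * f (test_record x))"
    unfolding real_scaleR_def sum_distrib_right using test_record_restrict by (intro sum.cong refl) auto
  also have "\<dots> = (\<Sum>x\<in>basis ds. ?h x * f (test_record x))"
    using group_records[of "\<lambda>x. ?h x * f (test_record x)" UNIV] by simp
  finally show ?thesis .
qed

lemma Run_mean: "(\<integral>r. real_of_int r \<partial>Run) = (mean_cos d \<mu>)\<^sup>2 * Re (quad_form (Obs e0) \<psi>)"
proof -
  interpret Noise: prob_space Noise by (rule prob_Noise)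
  \<comment> \<open>Integrating through the bind uses a bounded function, whereas the identity on
    the integers is bounded only almost surely under \<open>Run\<close>. Clipping changes nothing at
    the values -1, 0 and 1.\<close>
  let ?f = "\<lambda>r. max (-1) (min 1 (real_of_int r))"
  have "(\<integral>r. real_of_int r \<partial>Run) = (\<integral>r. ?f r \<partial>Run)"
    by (rule integral_cong_AE) (use AE_Run in \<open>auto simp: measurable_def sets_Run elim!: eventually_mono\<close>)
  also have "\<dots> = (\<integral>e. (\<integral>r. ?f r \<partial>outcome e) \<partial>Noise)"
    unfolding Run_eq
    by (rule integral_bind[OF _ _ outcome_kernel, of _ 1 1])
      (use prob_space.emeasure_space_1[OF prob_outcome] in \<open>auto intro: Noise.finite_measure\<close>)
  also have "\<dots> = (\<integral>e. Re (quad_form (Obs e) \<psi>) \<partial>Noise)"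
  proof (rule Bochner_Integration.integral_cong[OF refl])
    fix e
    have "?f (test_record x) = real_of_int (test_record x)" for x by (simp add: test_record_def)
    then show "(\<integral>r. ?f r \<partial>outcome e) = Re (quad_form (Obs e) \<psi>)"
      unfolding outcome_mean using expected_record[OF \<psi>, of d \<Phi> e] by simp
  qed
  also have "\<dots> = Re (\<integral>e. quad_form (Obs e) \<psi> \<partial>Noise)"
    using quad_expectation by (intro integral_Re) (auto simp: has_bochner_integral_iff)
  also have "(\<integral>e. quad_form (Obs e) \<psi> \<partial>Noise) = of_real ((mean_cos d \<mu>)\<^sup>2) * quad_form (Obs e0) \<psi>"
    using quad_expectation by (simp add: has_bochner_integral_iff)
  finally show ?thesis by simp
qed

lemma accuracy:
  assumes p: "qsp_phases p d \<Phi>" and herm: "mat_adjoint Ob = Ob"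
    and pos: "\<epsilon> > 0" "\<delta> > 0" "mean_cos d \<mu> \<noteq> 0" "N > 0"
    and N: "real N \<ge> 2 * ln (2 / \<delta>) / (\<epsilon>\<^sup>2 * mean_cos d \<mu> ^ 4)"
  shows "measure (estimator_law N I ds d \<Phi> \<mu>)
    {y. cmod (complex_of_real y - quad_form (mat_adjoint (mat_poly p A) * Ob * mat_poly p A) \<psi>) \<le> \<epsilon>} \<ge> 1 - \<delta>"
proof -
  let ?M = "mat_adjoint (mat_poly p A) * Ob * mat_poly p A" and ?\<kappa> = "mean_cos d \<mu>"
  define q where "q = Re (quad_form ?M \<psi>)"
  have Pc: "mat_poly p A \<in> carrier_mat n n" using A by (auto simp: mat_poly_def)
  note adj = Obs_noiseless(2)[OF p]
  have PO: "mat_poly p A * Ob \<in> carrier_mat n n" using Pc Ob by (rule mult_carrier_mat)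
  have "mat_adjoint (mat_poly p A * Ob * mat_poly p A) = mat_poly p A * (Ob * mat_poly p A)"
    by (simp only: mat_adjoint_mult[OF PO Pc] mat_adjoint_mult[OF Pc Ob] adj herm)
  then have "mat_adjoint ?M = ?M"
    unfolding adj by (simp only: assoc_mult_mat[OF Pc Ob Pc])
  \<comment> \<open>The algorithm estimates a real part only, so the target itself has to be
    real.\<close>
  then have "quad_form ?M \<psi> \<in> \<real>"
    by (intro quad_form_hermitian_real[OF _ \<psi>(1)]) (use Obs_carrier Obs_noiseless(1)[OF p] in metis)
  then have q: "quad_form ?M \<psi> = of_real q" by (simp add: q_def of_real_Re)
  let ?S = "{y. cmod (complex_of_real y - quad_form ?M \<psi>) \<le> \<epsilon>}"
  have S: "?S = cball q \<epsilon>"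
    unfolding q by (auto simp: dist_real_def norm_minus_commute simp flip: of_real_diff)
  let ?P = "PiM {..<N} (\<lambda>_. Run)" and ?g = "\<lambda>\<omega>. ((\<Sum>i<N. real_of_int (\<omega> i)) / real N) / ?\<kappa>\<^sup>2"
  interpret P: prob_space ?P by (intro prob_space_PiM prob_Run)
  have "real_of_int \<in> Run \<rightarrow>\<^sub>M borel" by (simp add: measurable_def sets_Run)
  then have "(\<lambda>\<omega>. real_of_int (\<omega> i)) \<in> ?P \<rightarrow>\<^sub>M borel" if "i < N" for i
    using that by (intro measurable_compose[OF measurable_component_singleton]) auto
  then have g: "?g \<in> ?P \<rightarrow>\<^sub>M borel"
    by (intro borel_measurable_divide borel_measurable_sum) auto
  have \<kappa>2: "?\<kappa>\<^sup>2 > 0" using pos(3) by simp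
  \<comment> \<open>The final division by \<kappa>^2 magnifies the statistical error, so the mean
    record has to be accurate up to \<kappa>^2 \<epsilon>. Squared in the exponent of Hoeffding's
    bound, this produces the power \<kappa>^4 in the number of runs.\<close>
  define E where "E = {\<omega> \<in> space ?P. \<bar>(\<Sum>i<N. real_of_int (\<omega> i)) / N - (\<integral>r. real_of_int r \<partial>Run)\<bar> \<ge> ?\<kappa>\<^sup>2 * \<epsilon>}"
  have mean: "(\<integral>r. real_of_int r \<partial>Run) = ?\<kappa>\<^sup>2 * q"
    using Run_mean Obs_noiseless(1)[OF p] by (simp add: q_def)
  have sub: "space ?P - (?g -` ?S \<inter> space ?P) \<subseteq> E"
  proof
    fix \<omega> assume "\<omega> \<in> space ?P - (?g -` ?S \<inter> space ?P)"
    then have w: "\<omega> \<in> space ?P" "\<bar>?g \<omega> - q\<bar> > \<epsilon>" by (auto simp: S dist_real_def abs_minus_commute)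
    have "(\<Sum>i<N. real_of_int (\<omega> i)) / N - ?\<kappa>\<^sup>2 * q = ?\<kappa>\<^sup>2 * (?g \<omega> - q)"
      using \<kappa>2 by (simp add: right_diff_distrib)
    then have "\<bar>(\<Sum>i<N. real_of_int (\<omega> i)) / N - ?\<kappa>\<^sup>2 * q\<bar> = ?\<kappa>\<^sup>2 * \<bar>?g \<omega> - q\<bar>"
      by (simp only: abs_mult abs_power2)
    also have "\<dots> \<ge> ?\<kappa>\<^sup>2 * \<epsilon>" using w(2) by (intro mult_left_mono) auto
    finally show "\<omega> \<in> E" using w(1) by (simp add: E_def mean)
  qed
  have Em: "E \<in> P.events"
  proof -
    have "(\<lambda>\<omega>. (\<Sum>i<N. real_of_int (\<omega> i)) / N) \<in> ?P \<rightarrow>\<^sub>M borel"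
      using \<open>\<And>i. i < N \<Longrightarrow> (\<lambda>\<omega>. real_of_int (\<omega> i)) \<in> ?P \<rightarrow>\<^sub>M borel\<close>
      by (intro borel_measurable_divide borel_measurable_sum) auto
    then show ?thesis unfolding E_def by measurable
  qed
  have "1 - P.prob (?g -` ?S \<inter> space ?P) = P.prob (space ?P - (?g -` ?S \<inter> space ?P))"
    using g S by (intro P.prob_compl[symmetric] measurable_sets) auto
  also have "\<dots> \<le> P.prob E" by (rule P.finite_measure_mono[OF sub Em])
  also have "\<dots> \<le> 2 * exp (- (N * (?\<kappa>\<^sup>2 * \<epsilon>)\<^sup>2) / 2)"
    unfolding E_def using \<kappa>2 pos by (intro hoeffding_iid prob_Run sets_Run AE_Run) auto
  also have "\<dots> \<le> \<delta>"
  proof -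
    have k4: "(?\<kappa>\<^sup>2 * \<epsilon>)\<^sup>2 = \<epsilon>\<^sup>2 * ?\<kappa> ^ 4" by (simp add: power_mult_distrib mult.commute flip: power_mult)
    have "\<epsilon>\<^sup>2 * ?\<kappa> ^ 4 > 0" using pos by simp
    then have "2 * ln (2 / \<delta>) \<le> N * (\<epsilon>\<^sup>2 * ?\<kappa> ^ 4)" using N by (simp add: pos_divide_le_eq)
    then have "- (N * (?\<kappa>\<^sup>2 * \<epsilon>)\<^sup>2) / 2 \<le> - ln (2 / \<delta>)" unfolding k4 by simp
    then have "exp (- (N * (?\<kappa>\<^sup>2 * \<epsilon>)\<^sup>2) / 2) \<le> exp (- ln (2 / \<delta>))" by (simp only: exp_le_cancel_iff)
    also have "\<dots> = \<delta> / 2" using pos(2) by (simp add: exp_minus)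
    finally show ?thesis by simp
  qed
  finally have "1 - \<delta> \<le> P.prob (?g -` ?S \<inter> space ?P)" by simp
  also have "\<dots> = measure (estimator_law N I ds d \<Phi> \<mu>) ?S"
    unfolding estimator_law_def S by (intro measure_distr[symmetric] g) simp
  finally show ?thesis .
qed

end

section \<open>Query counts and the number of runs\<close>

lemma queries_simps [simp]: "queries q [] = 0"
  "queries q (g # c) = (if \<exists>dg. oper_of g = Query q dg then 1 else 0) + queries q c"
  "queries q (c @ c') = queries q c + queries q c'"
  by (auto simp: queries_def)

lemma queries_ctrl [simp]: "queries q (ctrl_circuit r v c) = queries q c"
proof -
  have "oper_of (ctrl_gate r v g) = oper_of g" for g by (cases g) auto
  then show ?thesis by (simp add: queries_def ctrl_circuit_def filter_map comp_def)
qed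

lemma queries_adj [simp]: "queries q (adj_circuit c) = queries q c"
proof -
  have "(\<exists>dg. adj_oper u = Query q dg) = (\<exists>dg. u = Query q dg)" for u
    by (cases u) (auto simp: ex_bool_eq)
  then show ?thesis by (simp add: queries_def adj_circuit_def filter_map comp_def flip: rev_filter)
qed

lemma queries_qsp: "queries q (qsp_circuit s k \<Phi>) = (if q = OrA then k else 0)"
  by (induction k) (auto simp: ex_bool_eq)

text \<open>There are four noisy samples with one query to \<open>OrA\<close> per phase; neither
  adding controls nor inverting a circuit changes a count.\<close>

lemma queries_test: "queries q (hadamard_test_circuit d \<Phi> e) = (case q of OrA \<Rightarrow> 4 * d | _ \<Rightarrow> 1)"
  by (cases q) (simp_all add: hadamard_test_circuit_def observable_circuit_def lcu_circuit_def
      noisy_qsp_circuit_def queries_qsp ex_bool_eq)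

text \<open>The solution N of 2 exp (- N (\<kappa>^2 \<epsilon>)^2 / 2) = \<delta>, rounded
  up.\<close>

definition run_count :: "real \<Rightarrow> real \<Rightarrow> real \<Rightarrow> nat" where
  "run_count \<epsilon> \<delta> \<kappa> = nat \<lceil>2 * ln (2 / \<delta>) / (\<epsilon>\<^sup>2 * \<kappa> ^ 4)\<rceil>"

text \<open>The summand ln 2 of ln (2 / \<delta>) and the rounding error 1 are both absorbed by ln
  (1 / \<delta>), which is at least ln (1 / \<delta>0) > 0; for the rounding error, 1 /
  (\<epsilon>^2 \<kappa>^4) \<ge> 1 enters as well. This is the origin of the constant.\<close>

lemma run_count_bigo:
  assumes "\<delta>0 \<in> {0<..<1}"
  shows "(\<lambda>(\<epsilon>, \<delta>, \<kappa>). real (run_count \<epsilon> \<delta> \<kappa>))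
    \<in> O[principal (param_range \<delta>0)](\<lambda>(\<epsilon>, \<delta>, \<kappa>). 1 / (\<epsilon>\<^sup>2 * \<kappa> ^ 4) * ln (1 / \<delta>))"
proof (rule bigoI)
  define l where "l = ln (1 / \<delta>0)"
  have l: "l > 0" using assms by (simp add: l_def)
  have "real (run_count \<epsilon> \<delta> \<kappa>) \<le> (2 * (ln 2 / l + 1) + 1 / l) * \<bar>1 / (\<epsilon>\<^sup>2 * \<kappa> ^ 4) * ln (1 / \<delta>)\<bar>"
    if "(\<epsilon>, \<delta>, \<kappa>) \<in> param_range \<delta>0" for \<epsilon> \<delta> \<kappa>
  proof -
    have r: "0 < \<epsilon>" "\<epsilon> < 1" "0 < \<delta>" "\<delta> \<le> \<delta>0" "\<kappa> \<noteq> 0" "\<bar>\<kappa>\<bar> \<le> 1"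
      using that by (auto simp: param_range_def)
    define w where "w = 1 / (\<epsilon>\<^sup>2 * \<kappa> ^ 4)"
    define L where "L = ln (1 / \<delta>)"
    have "\<kappa> ^ 4 > 0" "\<kappa> ^ 4 \<le> 1" using r(5,6) power_le_one[of "\<bar>\<kappa>\<bar>" 4] by (simp_all add: power_even_abs)
    moreover have "\<epsilon>\<^sup>2 > 0" "\<epsilon>\<^sup>2 \<le> 1" using r(1,2) by (simp_all add: power_le_one)
    ultimately have den: "\<epsilon>\<^sup>2 * \<kappa> ^ 4 > 0" "\<epsilon>\<^sup>2 * \<kappa> ^ 4 \<le> 1"
      by (simp_all add: mult_le_one)
    then have w: "w \<ge> 1" by (simp add: w_def)
    have L: "L \<ge> l"
      unfolding L_def l_def using r(3,4) assms by (simp add: ln_div)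
    have "ln (2 / \<delta>) = ln 2 + L" using r(3) by (simp add: L_def ln_div)
    also have "ln 2 \<le> ln 2 / l * L" using L l by (simp add: field_simps)
    finally have 1: "ln (2 / \<delta>) \<le> (ln 2 / l + 1) * L" by (simp add: algebra_simps)
    have "1 * 1 \<le> w * (L / l)" using w L l by (intro mult_mono) auto
    then have 2: "1 \<le> 1 / l * (w * L)" by (simp add: mult.commute)
    have "ln (2 / \<delta>) \<ge> 0" using r(3,4) assms by simp
    then have "2 * ln (2 / \<delta>) * w \<ge> 0" using w by simp
    then have "real (run_count \<epsilon> \<delta> \<kappa>) \<le> 2 * ln (2 / \<delta>) * w + 1"
      unfolding run_count_def w_def by (simp add: of_nat_nat)
    also have "\<dots> \<le> 2 * ((ln 2 / l + 1) * L) * w + 1 / l * (w * L)"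
      using 1 2 w by (intro add_mono mult_right_mono mult_left_mono) auto
    also have "\<dots> = (2 * (ln 2 / l + 1) + 1 / l) * (w * L)" by (simp add: algebra_simps)
    also have "w * L = \<bar>w * L\<bar>" using w L l by simp
    finally show ?thesis by (simp only: w_def L_def)
  qed
  then show "\<forall>\<^sub>F x in principal (param_range \<delta>0). norm (case x of (\<epsilon>, \<delta>, \<kappa>) \<Rightarrow> real (run_count \<epsilon> \<delta> \<kappa>))
    \<le> (2 * (ln 2 / l + 1) + 1 / l) * norm (case x of (\<epsilon>, \<delta>, \<kappa>) \<Rightarrow> 1 / (\<epsilon>\<^sup>2 * \<kappa> ^ 4) * ln (1 / \<delta>))"
    unfolding eventually_principal by (auto simp del: abs_mult abs_divide times_divide_eq_left)
qed

lemma run_count_bounds: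
  assumes "\<epsilon> \<in> {0<..<1}" "\<delta> \<in> {0<..<1}" "\<kappa> \<noteq> 0"
  shows "run_count \<epsilon> \<delta> \<kappa> > 0" "real (run_count \<epsilon> \<delta> \<kappa>) \<ge> 2 * ln (2 / \<delta>) / (\<epsilon>\<^sup>2 * \<kappa> ^ 4)"
proof -
  have "\<epsilon>\<^sup>2 * \<kappa> ^ 4 > 0" using assms by simp
  moreover have "ln (2 / \<delta>) > 0" using assms by simp
  ultimately have "2 * ln (2 / \<delta>) / (\<epsilon>\<^sup>2 * \<kappa> ^ 4) > 0" by simp
  then show "run_count \<epsilon> \<delta> \<kappa> > 0" unfolding run_count_def by simp
  show "real (run_count \<epsilon> \<delta> \<kappa>) \<ge> 2 * ln (2 / \<delta>) / (\<epsilon>\<^sup>2 * \<kappa> ^ 4)"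
    unfolding run_count_def by (rule real_nat_ceiling_ge)
qed

theorem theorem15:
  shows "\<exists>(N :: real \<Rightarrow> real \<Rightarrow> real \<Rightarrow> nat) (C :: real).
    (\<forall>\<delta>0 \<in> {0<..<1}.
       (\<lambda>(\<epsilon>, \<delta>, \<kappa>). real (N \<epsilon> \<delta> \<kappa>))
         \<in> O[principal (param_range \<delta>0)](\<lambda>(\<epsilon>, \<delta>, \<kappa>). 1 / (\<epsilon>\<^sup>2 * \<kappa> ^ 4) * ln (1 / \<delta>))) \<and>
    (\<forall>(n :: nat) (a :: nat) (b :: nat) (d :: nat) (p :: real poly)
       (A :: complex mat) (Ob :: complex mat) (\<psi> :: complex vec)
       (UA :: complex mat) (UO :: complex mat) (Upsi :: complex mat) (\<mu> :: nat \<Rightarrow> real measure).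
       degree p = d \<and> (\<forall>x. poly p (- x) = (- 1) ^ d * poly p x) \<and>
       (\<forall>x \<in> {-1..1}. \<bar>poly p x\<bar> \<le> 1) \<and>
       n > 0 \<and> A \<in> carrier_mat n n \<and> hermitian_mat A \<and> spectral_norm A \<le> 1 \<and>
       Ob \<in> carrier_mat n n \<and> hermitian_mat Ob \<and> spectral_norm Ob \<le> 1 \<and>
       \<psi> \<in> carrier_vec n \<and> vec_norm \<psi> = 1 \<and>
       block_encoding a n UA A \<and> block_encoding b n UO Ob \<and>
       unitary_mat n Upsi \<and> Upsi *\<^sub>v unit_vec n 0 = \<psi> \<and>
       (\<forall>j \<in> {1..d}. symmetric_law (\<mu> j)) \<and> mean_cos d \<mu> \<noteq> 0 \<longrightarrow>
       (d > 0 \<longrightarrow> (\<exists>\<Phi>. qsp_phases p d \<Phi>)) \<and>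
       (\<forall>\<Phi>. qsp_phases p d \<Phi> \<longrightarrow>
          (\<forall>\<epsilon> \<in> {0<..<1}. \<forall>\<delta> \<in> {0<..<1}.
             measure (estimator_law (N \<epsilon> \<delta> (mean_cos d \<mu>)) (oracles UA UO Upsi) (reg_dim n a b) d \<Phi> \<mu>)
               {y. cmod (complex_of_real y -
                     quad_form (mat_adjoint (mat_poly p A) * Ob * mat_poly p A) \<psi>) \<le> \<epsilon>}
               \<ge> 1 - \<delta>) \<and>
          (\<forall>e. real (queries OrA (hadamard_test_circuit d \<Phi> e)) \<le> C * real d \<and>
               real (queries OrO (hadamard_test_circuit d \<Phi> e)) \<le> C \<and>
               real (queries OrPsi (hadamard_test_circuit d \<Phi> e)) \<le> C)))"
proof (intro exI[of _ run_count] exI[of _ 4] conjI ballI allI impI, goal_cases)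
  case (1 \<delta>0)
  then show ?case by (rule run_count_bigo)
next
  case (2 n a b d p)
  then show ?case by (intro qsp_phases_exist) auto
next
  case (3 n a b d p A Ob \<psi> UA UO Upsi \<mu> \<Phi> \<epsilon> \<delta>)
  interpret noisy_test n a b A Ob UA UO Upsi d \<Phi> \<mu> \<psi>
    by unfold_locales (use 3 in \<open>auto simp: hermitian_mat_def\<close>)
  show ?case
    by (rule accuracy) (use 3 run_count_bounds[of \<epsilon> \<delta> "mean_cos d \<mu>"] in \<open>auto simp: hermitian_mat_def\<close>)
qed (simp_all add: queries_test)

end
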